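(* Let $G:\mathbb{D}\to\mathbb{C}$ be holomorphic and let $\eta>0$. Suppose that $$\operatorname{ess\,sup}_{z\in\mathbb{T}}\operatorname{Re}(\overline{z}\,G(z))\le-\eta$$ and that $\operatorname{Re}G'$ is bounded on $\mathbb{D}$. Then $A$, defined by $Af=Gf'$, generates an immediately trace-class semigroup of composition operators on $H^2(\mathbb{D})$ and on $\mathcal{D}$.
   Context: $\mathbb{D}$ is the open unit disc and $\mathbb{T}$ the unit circle; for $z\in\mathbb{T}$, $G(z)$ denotes the radial limit of $G$ at $z$ (existing a.e.). $H^2(\mathbb{D})$ is the Hilbert space of analytic $f(z)=\sum_{n\ge0}c_nz^n$ on $\mathbb{D}$ with $\|f\|^2=\sum_{n\ge 0}|c_n|^2<\infty$; $\mathcal{D}$ is the Dirichlet space, with $\|f\|^2=|c_0|^2+\sum_{n\ge1}n|c_n|^2<\infty$. For $X=H^2(\mathbb{D})$ or $\mathcal{D}$ the domain of $A$ is the natural one, $\{f\in X: Gf'\in X\}$. A $C_0$-semigroup $(T(t))_{t\ge0}$ on $X$ is a family of bounded operators with $T(0)=I$, $T(t+s)=T(t)T(s)$ and $\lim_{t\to0}T(t)x=x$ for all $x\in X$. Its generator is $Ax=\lim_{t\to0^+}(T(t)x-x)/t$, with domain the set of $x$ for which this limit exists. "Semigroup" here means $C_0$-semigroup. A composition operator is an operator $C_\varphi f=f\circ\varphi$ with $\varphi:\mathbb{D}\to\mathbb{D}$ analytic. A semigroup $(T(t))_{t\ge0}$ is immediately trace-class if $T(t)$ is trace-class for all $t>0$.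 *)

theory Defs
  imports "HOL-Complex_Analysis.Complex_Analysis" "HOL-Probability.Essential_Supremum"
begin

section \<open>Functions on the unit disc\<close>

abbreviation unit_disc :: "complex set" where
  "unit_disc \<equiv> ball 0 1"

text \<open>A function on the disc is represented by the function on the whole plane that
  extends it by zero. Two elements of a function space are then equal iff they agree on
  the disc, and the representatives are closed under pointwise linear operations.\<close>

definition on_disc :: "(complex \<Rightarrow> complex) \<Rightarrow> complex \<Rightarrow> complex" where
  "on_disc h = (\<lambda>z. if z \<in> unit_disc then h z else 0)"

definition disc_analytic :: "(complex \<Rightarrow> complex) set" where
  "disc_analytic = {f. f holomorphic_on unit_disc \<and> (\<forall>z. z \<notin> unit_disc \<longrightarrow> f z = 0)}"

definition taylor_coeff :: "(complex \<Rightarrow> complex) \<Rightarrow> nat \<Rightarrow> complex" where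
  "taylor_coeff f n = (deriv ^^ n) f 0 / fact n"

section \<open>Hilbert spaces of analytic functions\<close>

text \<open>A complex Hilbert space of functions: the underlying set, with the pointwise linear
  structure, and an inner product that is linear in its first argument.\<close>

record hilbert_fun_space =
  elements :: "(complex \<Rightarrow> complex) set"
  inner_prod :: "(complex \<Rightarrow> complex) \<Rightarrow> (complex \<Rightarrow> complex) \<Rightarrow> complex"

definition norm_in :: "hilbert_fun_space \<Rightarrow> (complex \<Rightarrow> complex) \<Rightarrow> real" where
  "norm_in X f = sqrt (Re (inner_prod X f f))"

definition hardy_space :: hilbert_fun_space where
  "hardy_space = \<lparr>
     elements = {f \<in> disc_analytic. summable (\<lambda>n. (cmod (taylor_coeff f n))\<^sup>2)},
     inner_prod = (\<lambda>f g. \<Sum>n. taylor_coeff f n * cnj (taylor_coeff g n)) \<rparr>"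

definition dirichlet_space :: hilbert_fun_space where
  "dirichlet_space = \<lparr>
     elements = {f \<in> disc_analytic. summable (\<lambda>n. real n * (cmod (taylor_coeff f n))\<^sup>2)},
     inner_prod = (\<lambda>f g. taylor_coeff f 0 * cnj (taylor_coeff g 0) +
       (\<Sum>n. of_nat n * taylor_coeff f n * cnj (taylor_coeff g n))) \<rparr>"

lemma norm_hardy_space:
  assumes "f \<in> elements hardy_space"
  shows "(norm_in hardy_space f)\<^sup>2 = (\<Sum>n. (cmod (taylor_coeff f n))\<^sup>2)"
proof -
  have s: "summable (\<lambda>n. (cmod (taylor_coeff f n))\<^sup>2)"
    using assms by (simp add: hardy_space_def)
  have "inner_prod hardy_space f f = (\<Sum>n. complex_of_real ((cmod (taylor_coeff f n))\<^sup>2))"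
    by (simp add: hardy_space_def complex_norm_square[symmetric] del: of_real_power)
  also have "\<dots> = complex_of_real (\<Sum>n. (cmod (taylor_coeff f n))\<^sup>2)"
    using suminf_of_real[OF s] by metis
  finally show ?thesis
    using suminf_nonneg[OF s] by (simp add: norm_in_def)
qed

lemma norm_dirichlet_space:
  assumes "f \<in> elements dirichlet_space"
  shows "(norm_in dirichlet_space f)\<^sup>2 =
    (cmod (taylor_coeff f 0))\<^sup>2 + (\<Sum>n. real n * (cmod (taylor_coeff f n))\<^sup>2)"
proof -
  have s: "summable (\<lambda>n. real n * (cmod (taylor_coeff f n))\<^sup>2)"
    using assms by (simp add: dirichlet_space_def)
  have "inner_prod dirichlet_space f f = complex_of_real ((cmod (taylor_coeff f 0))\<^sup>2) +
      (\<Sum>n. complex_of_real (real n * (cmod (taylor_coeff f n))\<^sup>2))"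
    by (simp add: dirichlet_space_def mult.assoc complex_norm_square[symmetric] del: of_real_power)
  also have "(\<Sum>n. complex_of_real (real n * (cmod (taylor_coeff f n))\<^sup>2)) =
      complex_of_real (\<Sum>n. real n * (cmod (taylor_coeff f n))\<^sup>2)"
    using suminf_of_real[OF s] by metis
  finally show ?thesis
    using suminf_nonneg[OF s] by (simp add: norm_in_def)
qed

section \<open>Bounded operators and trace class\<close>

text \<open>Operators are functions on the ambient type; only their restriction to
  \<^term>\<open>elements X\<close> matters.\<close>

definition bounded_op ::
  "hilbert_fun_space \<Rightarrow> ((complex \<Rightarrow> complex) \<Rightarrow> complex \<Rightarrow> complex) \<Rightarrow> bool" where
  "bounded_op X S \<longleftrightarrow>
     (\<forall>f\<in>elements X. S f \<in> elements X) \<and>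
     (\<forall>f\<in>elements X. \<forall>g\<in>elements X. S (\<lambda>z. f z + g z) = (\<lambda>z. S f z + S g z)) \<and>
     (\<forall>c. \<forall>f\<in>elements X. S (\<lambda>z. c * f z) = (\<lambda>z. c * S f z)) \<and>
     (\<exists>C. \<forall>f\<in>elements X. norm_in X (S f) \<le> C * norm_in X f)"

definition positive_op ::
  "hilbert_fun_space \<Rightarrow> ((complex \<Rightarrow> complex) \<Rightarrow> complex \<Rightarrow> complex) \<Rightarrow> bool" where
  "positive_op X P \<longleftrightarrow>
     bounded_op X P \<and> (\<forall>f\<in>elements X. inner_prod X (P f) f \<in> \<real>\<^sub>\<ge>\<^sub>0)"

text \<open>\<open>P\<close> is the absolute value of \<open>S\<close>, i.e. the positive operator with \<open>P P = S* S\<close>.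
  The adjoint \<open>S*\<close> is eliminated by its defining property.\<close>

definition is_absolute_value ::
  "hilbert_fun_space \<Rightarrow> ((complex \<Rightarrow> complex) \<Rightarrow> complex \<Rightarrow> complex)
     \<Rightarrow> ((complex \<Rightarrow> complex) \<Rightarrow> complex \<Rightarrow> complex) \<Rightarrow> bool" where
  "is_absolute_value X P S \<longleftrightarrow>
     positive_op X P \<and>
     (\<forall>f\<in>elements X. \<forall>g\<in>elements X. inner_prod X (P (P f)) g = inner_prod X (S f) (S g))"

text \<open>An orthonormal basis of a Hilbert space is a maximal orthonormal set.\<close>

definition orthonormal_basis :: "hilbert_fun_space \<Rightarrow> (complex \<Rightarrow> complex) set \<Rightarrow> bool" where
  "orthonormal_basis X E \<longleftrightarrow>
     E \<subseteq> elements X \<and>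
     (\<forall>d\<in>E. \<forall>e\<in>E. inner_prod X d e = (if d = e then 1 else 0)) \<and>
     (\<forall>f\<in>elements X. (\<forall>e\<in>E. inner_prod X f e = 0) \<longrightarrow> f = (\<lambda>z. 0))"

text \<open>Finiteness of the trace of the absolute value. The trace of a positive operator does
  not depend on the orthonormal basis in which it is computed.\<close>

definition trace_class ::
  "hilbert_fun_space \<Rightarrow> ((complex \<Rightarrow> complex) \<Rightarrow> complex \<Rightarrow> complex) \<Rightarrow> bool" where
  "trace_class X S \<longleftrightarrow>
     bounded_op X S \<and>
     (\<exists>P E. is_absolute_value X P S \<and> orthonormal_basis X E \<and>
        (\<lambda>e. inner_prod X (P e) e) summable_on E)"

section \<open>Semigroups\<close>

text \<open>Semigroups are indexed by \<^typ>\<open>real\<close>, their values at negative times being irrelevant.\<close>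

definition C0_semigroup ::
  "hilbert_fun_space \<Rightarrow> (real \<Rightarrow> (complex \<Rightarrow> complex) \<Rightarrow> complex \<Rightarrow> complex) \<Rightarrow> bool" where
  "C0_semigroup X T \<longleftrightarrow>
     (\<forall>t\<ge>0. bounded_op X (T t)) \<and>
     (\<forall>f\<in>elements X. T 0 f = f) \<and>
     (\<forall>s\<ge>0. \<forall>t\<ge>0. \<forall>f\<in>elements X. T (s + t) f = T s (T t f)) \<and>
     (\<forall>f\<in>elements X. ((\<lambda>t. norm_in X (\<lambda>z. T t f z - f z)) \<longlongrightarrow> 0) (at_right 0))"

text \<open>\<open>g\<close> is the limit in \<open>X\<close> of the difference quotients \<open>(T(t)f - f)/t\<close>.\<close>

definition has_generator_limit ::
  "hilbert_fun_space \<Rightarrow> (real \<Rightarrow> (complex \<Rightarrow> complex) \<Rightarrow> complex \<Rightarrow> complex)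
     \<Rightarrow> (complex \<Rightarrow> complex) \<Rightarrow> (complex \<Rightarrow> complex) \<Rightarrow> bool" where
  "has_generator_limit X T f g \<longleftrightarrow>
     g \<in> elements X \<and>
     ((\<lambda>t. norm_in X (\<lambda>z. (T t f z - f z) / of_real t - g z)) \<longlongrightarrow> 0) (at_right 0)"

text \<open>The operator \<open>A\<close> with domain \<open>D\<close> is the generator of \<open>T\<close>.\<close>

definition is_generator ::
  "hilbert_fun_space \<Rightarrow> (real \<Rightarrow> (complex \<Rightarrow> complex) \<Rightarrow> complex \<Rightarrow> complex)
     \<Rightarrow> (complex \<Rightarrow> complex) set \<Rightarrow> ((complex \<Rightarrow> complex) \<Rightarrow> complex \<Rightarrow> complex) \<Rightarrow> bool" where
  "is_generator X T D A \<longleftrightarrow>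
     D = {f \<in> elements X. \<exists>g. has_generator_limit X T f g} \<and>
     (\<forall>f\<in>D. has_generator_limit X T f (A f))"

definition composition_op ::
  "hilbert_fun_space \<Rightarrow> ((complex \<Rightarrow> complex) \<Rightarrow> complex \<Rightarrow> complex) \<Rightarrow> bool" where
  "composition_op X S \<longleftrightarrow>
     (\<exists>\<phi>. \<phi> holomorphic_on unit_disc \<and> \<phi> ` unit_disc \<subseteq> unit_disc \<and>
        (\<forall>f\<in>elements X. S f = on_disc (f \<circ> \<phi>)))"

definition immediately_trace_class ::
  "hilbert_fun_space \<Rightarrow> (real \<Rightarrow> (complex \<Rightarrow> complex) \<Rightarrow> complex \<Rightarrow> complex) \<Rightarrow> bool" where
  "immediately_trace_class X T \<longleftrightarrow> (\<forall>t>0. trace_class X (T t))"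

section \<open>The operator and its symbol\<close>

definition symbol_op :: "(complex \<Rightarrow> complex) \<Rightarrow> (complex \<Rightarrow> complex) \<Rightarrow> complex \<Rightarrow> complex" where
  "symbol_op G f = on_disc (\<lambda>z. G z * deriv f z)"

definition symbol_op_domain ::
  "hilbert_fun_space \<Rightarrow> (complex \<Rightarrow> complex) \<Rightarrow> (complex \<Rightarrow> complex) set" where
  "symbol_op_domain X G = {f \<in> elements X. symbol_op G f \<in> elements X}"

text \<open>An unspecified value where the limit does not exist.\<close>

definition radial_limit :: "(complex \<Rightarrow> complex) \<Rightarrow> complex \<Rightarrow> complex" where
  "radial_limit G z = Lim (at_left 1) (\<lambda>r. G (of_real r * z))"

definition circle_measure :: "complex measure" where
  "circle_measure = distr (restrict_space lborel {0..<2 * pi})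
     (restrict_space borel (sphere 0 1)) cis"

text \<open>\<^const>\<open>distr\<close> silently yields the zero measure for a non-measurable map.\<close>

lemma emeasure_circle_measure:
  "emeasure circle_measure (sphere 0 1) = ennreal (2 * pi)"
proof -
  have "cis \<in> borel_measurable (restrict_space lborel {0..<2 * pi})"
    by (intro measurable_restrict_space1)
      (simp add: borel_measurable_continuous_onI continuous_on_cis)
  then have m: "cis \<in> restrict_space lborel {0..<2 * pi} \<rightarrow>\<^sub>M restrict_space borel (sphere 0 1)"
    by (intro measurable_restrict_space2) auto
  have "sphere 0 1 \<in> sets (restrict_space borel (sphere (0::complex) 1))"
    using sets.top[of "restrict_space borel (sphere (0::complex) 1)"]
    by (simp add: space_restrict_space)
  moreover have "cis -` sphere 0 1 \<inter> {0..<2 * pi} = {0..<2 * pi}"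
    by auto
  ultimately show ?thesis
    using m by (simp add: circle_measure_def emeasure_distr space_restrict_space
        emeasure_restrict_space)
qed

end

theory Submission
  imports Defs "HOL-Real_Asymp.Real_Asymp"
begin

text \<open>
The semigroup is composition with the flow of the vector field \<open>G\<close>.

\<^emph>\<open>The field.\<close> If \<open>Re G'\<close> is bounded, then \<open>exp \<circ> G'\<close> is bounded above and away from zero, and
Cauchy's estimate for it gives \<open>G'' = O(1 / (1 - |z|))\<close>. Hence \<open>G'\<close> grows at most
logarithmically, \<open>G\<close> converges to its radial limits uniformly on the circle, and the boundary
condition, which is assumed almost everywhere, holds at every boundary point and, with a
smaller constant, in an annulus (\<open>inward_field_from_boundary\<close>).

\<^emph>\<open>The flow.\<close> Since \<open>G\<close> points inwards in an annulus, the Euler steps \<open>z + h G(z)\<close> leave every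
large disc invariant. Halving the step size makes the Euler polygons converge locally uniformly
to holomorphic maps \<open>\<phi>\<^sub>t\<close> of the disc into itself. They form a semigroup, \<open>\<phi>\<^sub>t\<close> maps the disc
into a smaller disc when \<open>t > 0\<close>, and \<open>|\<phi>\<^sub>t'| \<le> exp (K t)\<close> because \<open>Re G' \<le> K\<close>.

\<^emph>\<open>The growth bound.\<close> Both spaces are weighted \<open>\<ell>\<^sup>2\<close> spaces of Taylor coefficients. On a circle
of radius \<open>r < 1\<close> everything is smooth, and at \<open>t = 0\<close> the squared norm of \<open>f \<circ> \<phi>\<^sub>t\<close> changes at
twice the rate \<open>Re \<langle>G f', f\<rangle>\<^sub>r\<close>. By Parseval, \<open>Re \<langle>G v, z v\<rangle>\<^sub>r\<close> is the mean of
\<open>Re (cnj z G) |v|\<^sup>2\<close>, which is not positive when \<open>r\<close> is close to one. For the Dirichlet weight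
this is the whole rate, with \<open>v = f'\<close>, except for a term at index zero. For the Hardy weight
write \<open>f = f(0) + z q\<close>: the rate for \<open>f\<close> is such a flux, plus \<open>r\<^sup>2\<close> times the rate for \<open>q\<close>,
plus a term with \<open>G(0)\<close>, and one iterates. In both cases the rate is at most \<open>|G(0)| / r\<close> times
the squared norm (\<open>hardy_dissipative\<close>, \<open>dirichlet_dissipative\<close>). Letting \<open>r\<close> tend to one gives
\<open>\<parallel>T(t)\<parallel> \<le> exp (\<omega> t)\<close>. The step from the rate to the bound, like every other argument about the
time variable below, uses only the first order expansion \<open>f \<circ> \<phi>\<^sub>h = f + h G f' + O(h\<^sup>2)\<close> on
compact sets together with the semigroup law; no differential equation has to be solved.

\<^emph>\<open>The semigroup.\<close> Coefficients of \<open>T(t) f\<close> converge to those of \<open>f\<close>; with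
\<open>\<parallel>T(t) f\<parallel> \<le> exp (\<omega> t) \<parallel>f\<parallel>\<close> weak convergence becomes norm convergence. If \<open>g = G f'\<close> lies in the
space, then \<open>T(t) f - f - t g\<close> is an average of \<open>T(s) g - g\<close> over \<open>s \<le> t\<close>, multiplied by \<open>t\<close>,
so \<open>f\<close> is in the domain of the generator. The converse holds because point evaluations are
bounded.

\<^emph>\<open>Trace class.\<close> For \<open>t > 0\<close> let \<open>|\<phi>\<^sub>t| \<le> q < 1\<close>. The normalized monomials are mapped to
multiples of \<open>\<phi>\<^sub>t\<^sup>n\<close>, whose norms are at most \<open>q\<^sup>n + n q\<^sup>n\<^sup>-\<^sup>1 exp (K t)\<close>, which is summable.
If \<open>P\<close> is the absolute value of \<open>S\<close> then \<open>\<langle>P e, e\<rangle> \<le> \<parallel>P e\<parallel> = \<parallel>S e\<parallel>\<close>, so summable norms imply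
trace class. The absolute value exists by the Riesz representation of bounded forms and the
binomial series of \<open>sqrt (1 - x)\<close> at \<open>x = 1 - S* S / C\<^sup>2\<close>, where \<open>C\<close> bounds \<open>S\<close>
(\<open>absolute_value_exists\<close>).
\<close>

section \<open>Weighted square-summable sequences\<close>

definition wsummable :: "(nat \<Rightarrow> real) \<Rightarrow> (nat \<Rightarrow> complex) \<Rightarrow> bool" where
  "wsummable w a \<longleftrightarrow> summable (\<lambda>n. w n * (cmod (a n))\<^sup>2)"

definition wip :: "(nat \<Rightarrow> real) \<Rightarrow> (nat \<Rightarrow> complex) \<Rightarrow> (nat \<Rightarrow> complex) \<Rightarrow> complex" where
  "wip w a b = (\<Sum>n. of_real (w n) * a n * cnj (b n))"

definition wnorm :: "(nat \<Rightarrow> real) \<Rightarrow> (nat \<Rightarrow> complex) \<Rightarrow> real" where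
  "wnorm w a = sqrt (\<Sum>n. w n * (cmod (a n))\<^sup>2)"

context
  fixes w :: "nat \<Rightarrow> real"
  assumes w_nonneg: "\<And>n. 0 \<le> w n"
begin

lemma wsummable_add:
  assumes "wsummable w a" "wsummable w b"
  shows "wsummable w (\<lambda>n. a n + b n)"
  unfolding wsummable_def
proof (rule summable_comparison_test', rule summable_add)
  show "summable (\<lambda>n. 2 * (w n * (cmod (a n))\<^sup>2))" "summable (\<lambda>n. 2 * (w n * (cmod (b n))\<^sup>2))"
    using assms by (auto simp: wsummable_def intro: summable_mult)
  fix n
  have "(cmod (a n + b n))\<^sup>2 \<le> (cmod (a n) + cmod (b n))\<^sup>2"
    by (intro power_mono norm_triangle_ineq) auto
  also have "\<dots> \<le> 2 * (cmod (a n))\<^sup>2 + 2 * (cmod (b n))\<^sup>2"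
    using sum_squares_bound[of "cmod (a n)" "cmod (b n)"] by (simp add: power2_sum)
  finally show "norm (w n * (cmod (a n + b n))\<^sup>2)
      \<le> 2 * (w n * (cmod (a n))\<^sup>2) + 2 * (w n * (cmod (b n))\<^sup>2)"
    using mult_left_mono[OF _ w_nonneg[of n]] w_nonneg[of n] by (fastforce simp: algebra_simps)
qed

lemma wsummable_cmult: "wsummable w a \<Longrightarrow> wsummable w (\<lambda>n. c * a n)"
  unfolding wsummable_def
  using summable_mult[of "\<lambda>n. w n * (cmod (a n))\<^sup>2" "(cmod c)\<^sup>2"]
  by (simp add: norm_mult power_mult_distrib mult_ac)

lemma wsummable_diff:
  "wsummable w a \<Longrightarrow> wsummable w b \<Longrightarrow> wsummable w (\<lambda>n. a n - b n)"
  using wsummable_add[of a "\<lambda>n. - 1 * b n"] wsummable_cmult[of b "-1"] by simp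

lemma wnorm_nonneg: "wsummable w a \<Longrightarrow> 0 \<le> wnorm w a"
  unfolding wnorm_def wsummable_def by (simp add: suminf_nonneg w_nonneg)

lemma wnorm_sq: "wsummable w a \<Longrightarrow> (wnorm w a)\<^sup>2 = (\<Sum>n. w n * (cmod (a n))\<^sup>2)"
  unfolding wnorm_def wsummable_def by (subst real_sqrt_pow2) (auto intro!: suminf_nonneg simp:
      w_nonneg)

lemma wsum_le_wnorm_sq: "wsummable w a \<Longrightarrow> (\<Sum>n<N. w n * (cmod (a n))\<^sup>2) \<le> (wnorm w a)\<^sup>2"
  unfolding wnorm_sq wsummable_def by (subst wnorm_sq) (auto simp: wsummable_def w_nonneg intro!:
      sum_le_suminf)

lemma wterm_le_wnorm_sq: "wsummable w a \<Longrightarrow> w n * (cmod (a n))\<^sup>2 \<le> (wnorm w a)\<^sup>2"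
  using wsum_le_wnorm_sq[of a "Suc n"] sum_nonneg[of "{..<n}" "\<lambda>n. w n * (cmod (a n))\<^sup>2"]
  by (simp add: w_nonneg)

lemma wnorm_sq_leI:
  assumes "\<And>N. (\<Sum>n<N. w n * (cmod (a n))\<^sup>2) \<le> C"
  shows "wsummable w a" "(wnorm w a)\<^sup>2 \<le> C"
proof -
  show s: "wsummable w a"
    unfolding wsummable_def
    by (rule summableI_nonneg_bounded[where x = C]) (auto simp: w_nonneg assms)
  show "(wnorm w a)\<^sup>2 \<le> C"
    unfolding wnorm_sq[OF s] using s
    by (intro suminf_le_const) (auto simp: wsummable_def assms)
qed

lemma wip_abs_partial:
  assumes a: "wsummable w a" and b: "wsummable w b"
  shows "(\<Sum>n<N. cmod (of_real (w n) * a n * cnj (b n))) \<le> wnorm w a * wnorm w b"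
proof -
  have "(\<Sum>n<N. cmod (of_real (w n) * a n * cnj (b n)))
      = (\<Sum>n<N. \<bar>sqrt (w n) * cmod (a n)\<bar> * \<bar>sqrt (w n) * cmod (b n)\<bar>)"
    by (intro sum.cong refl) (simp add: norm_mult w_nonneg abs_mult)
  also have "\<dots> \<le> L2_set (\<lambda>n. sqrt (w n) * cmod (a n)) {..<N} * L2_set (\<lambda>n. sqrt (w n) * cmod
      (b n)) {..<N}"
    by (rule L2_set_mult_ineq)
  also have "\<dots> \<le> wnorm w a * wnorm w b"
    using wsum_le_wnorm_sq[OF a, of N] wsum_le_wnorm_sq[OF b, of N]
    by (intro mult_mono L2_set_nonneg wnorm_nonneg assms)
      (auto simp: L2_set_def power_mult_distrib w_nonneg intro!: real_le_lsqrt sum_nonneg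
          wnorm_nonneg assms)
  finally show ?thesis .
qed

lemma wip_abs_summable:
  assumes "wsummable w a" "wsummable w b"
  shows "summable (\<lambda>n. cmod (of_real (w n) * a n * cnj (b n)))"
  by (rule summableI_nonneg_bounded[where x = "wnorm w a * wnorm w b"])
    (auto intro!: wip_abs_partial assms)

lemma wip_summable:
  assumes "wsummable w a" "wsummable w b"
  shows "summable (\<lambda>n. of_real (w n) * a n * cnj (b n))"
  using wip_abs_summable[OF assms] by (rule summable_norm_cancel)

lemma wip_Cauchy_Schwarz:
  assumes "wsummable w a" "wsummable w b"
  shows "cmod (wip w a b) \<le> wnorm w a * wnorm w b"
proof -
  have "cmod (wip w a b) \<le> (\<Sum>n. cmod (of_real (w n) * a n * cnj (b n)))"
    unfolding wip_def by (rule summable_norm[OF wip_abs_summable[OF assms]])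
  also have "\<dots> \<le> wnorm w a * wnorm w b"
    by (intro suminf_le_const wip_abs_summable wip_abs_partial assms)
  finally show ?thesis .
qed

lemma wip_add_left:
  assumes "wsummable w a" "wsummable w b" "wsummable w c"
  shows "wip w (\<lambda>n. a n + b n) c = wip w a c + wip w b c"
  using suminf_add[OF wip_summable[OF assms(1,3)] wip_summable[OF assms(2,3)]]
  by (simp add: wip_def algebra_simps)

lemma wip_cmult_left:
  assumes "wsummable w a" "wsummable w b"
  shows "wip w (\<lambda>n. c * a n) b = c * wip w a b"
  using suminf_mult[OF wip_summable[OF assms], of c]
  by (simp add: wip_def algebra_simps)

lemma wip_cnj:
  assumes "wsummable w a" "wsummable w b"
  shows "wip w b a = cnj (wip w a b)"
proof -
  have "(\<lambda>n. of_real (w n) * a n * cnj (b n)) sums wip w a b"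
    unfolding wip_def using wip_summable[OF assms] by (rule summable_sums)
  then have "(\<lambda>n. cnj (of_real (w n) * a n * cnj (b n))) sums cnj (wip w a b)"
    by (subst sums_cnj)
  then show ?thesis
    by (simp add: wip_def sums_iff mult_ac)
qed

lemma wip_self:
  assumes "wsummable w a"
  shows "wip w a a = of_real ((wnorm w a)\<^sup>2)"
proof -
  have "of_real (w n) * a n * cnj (a n) = complex_of_real (w n * (cmod (a n))\<^sup>2)" for n
    by (simp add: mult.assoc complex_norm_square[symmetric] del: of_real_power)
  then show ?thesis
    unfolding wnorm_sq[OF assms] wip_def
    using suminf_of_real[of "\<lambda>n. w n * (cmod (a n))\<^sup>2", where 'a = complex] assms
    by (simp only: wsummable_def)
qed

lemma wnorm_add_sq:
  assumes a: "wsummable w a" and b: "wsummable w b"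
  shows "(wnorm w (\<lambda>n. a n + b n))\<^sup>2 = (wnorm w a)\<^sup>2 + 2 * Re (wip w b a) + (wnorm w b)\<^sup>2"
proof -
  have s: "(\<lambda>n. w n * (cmod (a n))\<^sup>2) sums (wnorm w a)\<^sup>2"
      "(\<lambda>n. w n * (cmod (b n))\<^sup>2) sums (wnorm w b)\<^sup>2"
    using assms by (auto simp: wnorm_sq wsummable_def)
  have "(\<lambda>n. Re (of_real (w n) * b n * cnj (a n))) sums Re (wip w b a)"
    unfolding wip_def by (intro sums_Re summable_sums wip_summable assms)
  from sums_add[OF sums_add[OF s(1) sums_mult[OF this, of 2]] s(2)]
  have "(\<lambda>n. w n * (cmod (a n))\<^sup>2 + 2 * Re (of_real (w n) * b n * cnj (a n)) + w n * (cmod (b n))\<^sup>2)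
      sums ((wnorm w a)\<^sup>2 + 2 * Re (wip w b a) + (wnorm w b)\<^sup>2)" .
  also have "(\<lambda>n. w n * (cmod (a n))\<^sup>2 + 2 * Re (of_real (w n) * b n * cnj (a n))
      + w n * (cmod (b n))\<^sup>2)
     = (\<lambda>n. w n * (cmod (a n + b n))\<^sup>2)"
    by (intro ext) (simp only: cmod_power2, simp add: algebra_simps power2_eq_square)
  finally show ?thesis
    by (simp add: wnorm_sq wsummable_add[OF a b] sums_iff)
qed

lemma wnorm_triangle:
  assumes a: "wsummable w a" and b: "wsummable w b"
  shows "wnorm w (\<lambda>n. a n + b n) \<le> wnorm w a + wnorm w b"
proof (rule power2_le_imp_le)
  show "(wnorm w (\<lambda>n. a n + b n))\<^sup>2 \<le> (wnorm w a + wnorm w b)\<^sup>2"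
    using wnorm_add_sq[OF a b] wip_Cauchy_Schwarz[OF b a] complex_Re_le_cmod[of "wip w b a"]
    by (simp add: power2_sum algebra_simps)
qed (simp add: wnorm_nonneg assms)

lemma wnorm_cmult:
  assumes "wsummable w a"
  shows "wnorm w (\<lambda>n. c * a n) = cmod c * wnorm w a"
proof -
  have "(\<Sum>n. (cmod c)\<^sup>2 * (w n * (cmod (a n))\<^sup>2)) = (cmod c)\<^sup>2 * (\<Sum>n. w n * (cmod (a n))\<^sup>2)"
    using assms by (intro suminf_mult) (simp add: wsummable_def)
  then show ?thesis
    unfolding wnorm_def
    by (simp add: norm_mult power_mult_distrib mult_ac real_sqrt_mult)
qed

end

section \<open>Taylor coefficients and Parseval's identity on circles\<close>

lemma taylor_coeff_cong:
  assumes "f holomorphic_on unit_disc" "\<And>z. z \<in> unit_disc \<Longrightarrow> g z = f z"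
  shows "taylor_coeff g n = taylor_coeff f n"
proof -
  have "g holomorphic_on unit_disc"
    using assms holomorphic_cong by metis
  then show ?thesis
    using higher_deriv_transform_within_open[of f unit_disc g 0 n] assms
    by (simp add: taylor_coeff_def)
qed

lemma taylor_coeff_on_disc:
  "f holomorphic_on unit_disc \<Longrightarrow> taylor_coeff (on_disc f) n = taylor_coeff f n"
  by (rule taylor_coeff_cong) (auto simp: on_disc_def)

lemma taylor_coeff_add:
  "f holomorphic_on unit_disc \<Longrightarrow> g holomorphic_on unit_disc \<Longrightarrow>
    taylor_coeff (\<lambda>z. f z + g z) n = taylor_coeff f n + taylor_coeff g n"
  using higher_deriv_add[of f unit_disc g 0 n] by (simp add: taylor_coeff_def add_divide_distrib)

lemma taylor_coeff_diff:
  "f holomorphic_on unit_disc \<Longrightarrow> g holomorphic_on unit_disc \<Longrightarrow>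
    taylor_coeff (\<lambda>z. f z - g z) n = taylor_coeff f n - taylor_coeff g n"
  using higher_deriv_diff[of f unit_disc g 0 n] by (simp add: taylor_coeff_def diff_divide_distrib)

lemma taylor_coeff_cmult:
  "f holomorphic_on unit_disc \<Longrightarrow> taylor_coeff (\<lambda>z. c * f z) n = c * taylor_coeff f n"
  using higher_deriv_cmult[of f unit_disc 0 n c] by (simp add: taylor_coeff_def)

lemma taylor_coeff_deriv:
  "taylor_coeff (deriv f) n = of_nat (Suc n) * taylor_coeff f (Suc n)"
  by (simp add: taylor_coeff_def funpow_swap1 del: of_nat_Suc)

lemma taylor_coeff_0: "taylor_coeff f 0 = f 0"
  by (simp add: taylor_coeff_def)

lemma taylor_sums:
  "f holomorphic_on unit_disc \<Longrightarrow> z \<in> unit_disc \<Longrightarrow> (\<lambda>n. taylor_coeff f n * z ^ n) sums f z"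
  using holomorphic_power_series[of f 0 1 z] by (simp add: taylor_coeff_def)

text \<open>A power series that converges on the disc is the Taylor series of its sum. This is how
coefficients of explicitly constructed functions are computed below.\<close>

lemma taylor_coeff_unique:
  assumes "\<And>z. z \<in> unit_disc \<Longrightarrow> (\<lambda>n. a n * z ^ n) sums f z"
  shows "f holomorphic_on unit_disc" "taylor_coeff f n = a n"
proof -
  show hol: "f holomorphic_on unit_disc"
    using power_series_holomorphic[of 0 1 a f] assms by simp
  define F where "F = Abs_fps a"
  have "conv_radius a \<ge> 1"
  proof (rule conv_radius_geI_ex')
    fix r :: real
    assume "0 < r" "ereal r < 1"
    then show "summable (\<lambda>n. a n * of_real r ^ n)"
      using assms[of "of_real r"] by (auto simp: sums_iff)
  qed
  moreover have "eval_fps F z = f z" if "z \<in> unit_disc" for z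
    using assms[OF that] by (simp add: eval_fps_def F_def sums_iff)
  ultimately have "f has_fps_expansion F"
    using eventually_nhds_in_open[of unit_disc 0]
    by (auto simp: has_fps_expansion_def fps_conv_radius_def F_def elim!: eventually_mono
        intro: less_le_trans[of 0 1])
  from fps_nth_fps_expansion[OF this, of n] show "taylor_coeff f n = a n"
    by (simp add: taylor_coeff_def F_def)
qed

lemma taylor_coeff_mult_z:
  assumes "f holomorphic_on unit_disc"
  shows "taylor_coeff (\<lambda>z. z * f z) n = (case n of 0 \<Rightarrow> 0 | Suc m \<Rightarrow> taylor_coeff f m)"
proof (rule taylor_coeff_unique)
  fix z :: complex
  assume "z \<in> unit_disc"
  from sums_mult[OF taylor_sums[OF assms this], of z]
  have "(\<lambda>n. (case Suc n of 0 \<Rightarrow> 0 | Suc m \<Rightarrow> taylor_coeff f m) * z ^ Suc n) sums (z * f z)"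
    by (simp add: mult_ac)
  then show "(\<lambda>n. (case n of 0 \<Rightarrow> 0 | Suc m \<Rightarrow> taylor_coeff f m) * z ^ n) sums (z * f z)"
    by (subst (asm) sums_Suc_iff) simp
qed

lemma taylor_coeff_le:
  assumes "f holomorphic_on unit_disc" "0 < R" "R < 1" "\<And>z. cmod z \<le> R \<Longrightarrow> cmod (f z) \<le> B"
  shows "cmod (taylor_coeff f n) \<le> B / R ^ n"
proof -
  have "cmod ((deriv ^^ n) f 0) \<le> fact n * B / R ^ n"
    using assms
    by (intro Cauchy_inequality holomorphic_on_imp_continuous_on)
       (auto elim!: holomorphic_on_subset)
  then show ?thesis
    by (simp add: taylor_coeff_def norm_divide field_simps)
qed

text \<open>Orthogonality of the monomials: for \<open>n \<noteq> m\<close> the integrand is a multiple of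
\<open>cis ((n - m) \<theta>)\<close>, which has a periodic antiderivative.\<close>

lemma has_integral_circle_monomials:
  fixes r :: real
  shows "((\<lambda>\<theta>. (of_real r * cis \<theta>) ^ n * cnj ((of_real r * cis \<theta>) ^ m)) has_integral
    (if n = m then 2 * of_real pi * of_real (r ^ (2 * n)) else 0)) {0..2 * pi}"
proof (cases "n = m")
  case True
  have "(of_real r * cis \<theta>) ^ n * cnj ((of_real r * cis \<theta>) ^ m) = of_real (r ^ (2 * n))" for \<theta>
    unfolding True complex_norm_square[symmetric]
    by (simp add: norm_power norm_mult power_mult [symmetric] mult.commute power_even_abs del:
        of_real_power flip: of_real_power)
  with True show ?thesis
    using has_integral_const_real[of "complex_of_real (r ^ (2 * n))" 0 "2 * pi"]
    by (simp add: scaleR_conv_of_real)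
next
  case False
  define k :: real where "k = real n - real m"
  with False have k: "k \<noteq> 0" by simp
  define F where "F = (\<lambda>\<theta>. of_real (r ^ (n + m)) * cis (k * \<theta>) / (\<i> * of_real k))"
  have "((\<lambda>\<theta>. of_real (r ^ (n + m)) * cis (k * \<theta>)) has_integral (F (2 * pi) - F 0)) {0..2 * pi}"
  proof (rule fundamental_theorem_of_calculus)
    show "(F has_vector_derivative of_real (r ^ (n + m)) * cis (k * x)) (at x within {0..2 * pi})"
        for x
      unfolding F_def cis_conv_exp using k
      by (auto intro!: derivative_eq_intros has_vector_derivative_real_field simp: field_simps)
  qed auto
  moreover have "F (2 * pi) = F 0"
  proof -
    have "k * (2 * pi) = 2 * pi * of_int (int n - int m)"
      by (simp add: k_def algebra_simps)
    then have "cis (k * (2 * pi)) = 1"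
      by (metis cis_multiple_2pi Ints_of_int)
    then show ?thesis by (simp add: F_def)
  qed
  moreover have "of_real (r ^ (n + m)) * cis (k * \<theta>)
      = (of_real r * cis \<theta>) ^ n * cnj ((of_real r * cis \<theta>) ^ m)" for \<theta>
    by (simp add: k_def power_mult_distrib power_add cis_cnj Complex.DeMoivre cis_mult
        algebra_simps)
  ultimately show ?thesis
    using False by simp
qed

lemma circle_mem: "0 \<le> r \<Longrightarrow> r < 1 \<Longrightarrow> of_real r * cis \<theta> \<in> unit_disc"
  by (simp add: norm_mult)

lemma taylor_abs_summable:
  assumes "f holomorphic_on unit_disc" "0 \<le> r" "r < 1"
  shows "summable (\<lambda>n. cmod (taylor_coeff f n) * r ^ n)"
proof -
  define R where "R = (1 + r) / 2"
  have R: "r < R" "R < 1" "0 < R" using assms by (auto simp: R_def)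
  have "summable (\<lambda>n. taylor_coeff f n * of_real R ^ n)"
    using taylor_sums[OF assms(1), of "of_real R"] R by (auto simp: sums_iff)
  from powser_insidea[OF this, of "of_real r"] show ?thesis
    using R assms by (simp add: norm_mult norm_power)
qed

text \<open>On a circle inside the disc the Taylor polynomials converge uniformly, so the identity
for polynomials, where it is orthogonality, passes to the limit.\<close>

lemma Parseval_circle:
  assumes f: "f holomorphic_on unit_disc" and g: "g holomorphic_on unit_disc"
    and r: "0 < r" "r < 1"
  shows "((\<lambda>\<theta>. f (of_real r * cis \<theta>) * cnj (g (of_real r * cis \<theta>))) has_integral
     2 * of_real pi * wip (\<lambda>n. r ^ (2 * n)) (taylor_coeff f) (taylor_coeff g)) {0..2 * pi}"
proof -
  define Z where "Z = (\<lambda>\<theta>. of_real r * cis \<theta>)"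
  have Zd: "Z \<theta> \<in> unit_disc" for \<theta> using circle_mem r by (simp add: Z_def)
  have nZ: "cmod (Z \<theta>) = r" for \<theta> using r by (simp add: Z_def norm_mult)
  have lim: "uniform_limit {0..2*pi} (\<lambda>N \<theta>. \<Sum>n<N. taylor_coeff h n * Z \<theta> ^ n) (\<lambda>\<theta>. h (Z \<theta>))
      sequentially"
    if h: "h holomorphic_on unit_disc" for h
  proof -
    have "uniform_limit {0..2*pi} (\<lambda>N \<theta>. \<Sum>n<N. taylor_coeff h n * Z \<theta> ^ n)
       (\<lambda>\<theta>. \<Sum>n. taylor_coeff h n * Z \<theta> ^ n) sequentially"
      using taylor_abs_summable[OF h, of r] r
      by (intro Weierstrass_m_test) (auto simp: norm_mult norm_power nZ)
    also have "(\<lambda>\<theta>. \<Sum>n. taylor_coeff h n * Z \<theta> ^ n) = (\<lambda>\<theta>. h (Z \<theta>))"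
      using taylor_sums[OF h Zd] by (auto simp: sums_iff)
    finally show ?thesis .
  qed
  have bdd: "bounded ((\<lambda>\<theta>. h (Z \<theta>)) ` {0..2*pi})" if h: "h holomorphic_on unit_disc" for h
    unfolding Z_def using r
    by (intro compact_imp_bounded compact_continuous_image continuous_intros
        continuous_on_compose2[OF holomorphic_on_imp_continuous_on[OF h]])
       (auto simp: norm_mult)
  define P where "P = (\<lambda>N \<theta>. (\<Sum>n<N. taylor_coeff f n * Z \<theta> ^ n) * cnj (\<Sum>m<N. taylor_coeff g m * Z
      \<theta> ^ m))"
  have "uniform_limit {0..2*pi} (\<lambda>N \<theta>. cnj (\<Sum>m<N. taylor_coeff g m * Z \<theta> ^ m)) (\<lambda>\<theta>. cnj (g (Z \<theta>)))
      sequentially"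
    using lim[OF g] by (simp add: uniform_limit_iff dist_norm flip: complex_cnj_diff del: cnj_sum)
  moreover have "bounded ((\<lambda>\<theta>. cnj (g (Z \<theta>))) ` {0..2*pi})"
    using bdd[OF g] by (auto simp: bounded_iff)
  ultimately have ul: "uniform_limit {0..2*pi} P (\<lambda>\<theta>. f (Z \<theta>) * cnj (g (Z \<theta>))) sequentially"
    unfolding P_def
    by (intro uniform_lim_mult lim[OF f] bdd[OF f])
  have Pint: "(P N has_integral 2 * of_real pi * (\<Sum>n<N. of_real (r ^ (2 * n)) * taylor_coeff f n *
      cnj (taylor_coeff g n))) {0..2*pi}" for N
  proof -
    have "((\<lambda>\<theta>. \<Sum>n<N. \<Sum>m<N. (taylor_coeff f n * cnj (taylor_coeff g m)) *
        (Z \<theta> ^ n * cnj (Z \<theta> ^ m))) has_integral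
       (\<Sum>n<N. \<Sum>m<N. (taylor_coeff f n * cnj (taylor_coeff g m)) *
         (if n = m then 2 * of_real pi * of_real (r ^ (2 * n)) else 0))) {0..2*pi}"
      unfolding Z_def
      by (intro has_integral_sum has_integral_mult_right has_integral_circle_monomials) auto
    moreover have "(\<Sum>n<N. \<Sum>m<N. (taylor_coeff f n * cnj (taylor_coeff g m)) *
        (Z \<theta> ^ n * cnj (Z \<theta> ^ m))) = P N \<theta>" for \<theta>
      by (simp add: P_def sum_product mult_ac)
    moreover have "(\<Sum>n<N. \<Sum>m<N. (taylor_coeff f n * cnj (taylor_coeff g m)) *
         (if n = m then 2 * of_real pi * of_real (r ^ (2 * n)) else 0))
       = 2 * of_real pi * (\<Sum>n<N. of_real (r ^ (2 * n)) * taylor_coeff f n * cnj (taylor_coeff g n))"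
      unfolding sum_distrib_left
      by (intro sum.cong refl) (simp add: if_distrib[where f = "\<lambda>x. _ * x"] mult_ac cong: if_cong)
    ultimately show ?thesis by (simp only:)
  qed
  have Pcont: "continuous_on {0..2*pi} (P N)" for N
    unfolding P_def Z_def by (intro continuous_intros)
  obtain I J where I: "\<And>N. (P N has_integral I N) {0..2*pi}"
    and J: "((\<lambda>\<theta>. f (Z \<theta>) * cnj (g (Z \<theta>))) has_integral J) {0..2*pi}" and IJ: "I \<longlonglongrightarrow> J"
    using uniform_limit_integral[OF ul Pcont sequentially_bot] by metis
  have I_eq: "I = (\<lambda>N. 2 * of_real pi * (\<Sum>n<N. of_real (r ^ (2 * n)) * taylor_coeff f n * cnj
      (taylor_coeff g n)))"
    by (rule ext, rule has_integral_unique[OF I Pint])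
  have "(\<lambda>N. 2 * of_real pi * (\<Sum>n<N. of_real (r ^ (2 * n)) * taylor_coeff f n * cnj
      (taylor_coeff g n))) \<longlonglongrightarrow> J"
    using IJ unfolding I_eq .
  from tendsto_mult_left[OF this, of "1 / (2 * of_real pi)"]
  have "(\<lambda>n. of_real (r ^ (2 * n)) * taylor_coeff f n * cnj (taylor_coeff g n)) sums
      (J / (2 * of_real pi))"
    by (simp add: sums_def mult.assoc)
  then have "2 * of_real pi * wip (\<lambda>n. r ^ (2 * n)) (taylor_coeff f) (taylor_coeff g) = J"
    by (simp add: wip_def sums_iff)
  with J show ?thesis by (simp add: Z_def)
qed

section \<open>Norms on circles of radius less than one\<close>

lemma taylor_coeff_powser:
  assumes "\<And>z. z \<in> unit_disc \<Longrightarrow> summable (\<lambda>n. a n * z ^ n)"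
  shows "(\<lambda>z. \<Sum>n. a n * z ^ n) holomorphic_on unit_disc"
    "taylor_coeff (\<lambda>z. \<Sum>n. a n * z ^ n) n = a n"
  using taylor_coeff_unique[of a "\<lambda>z. \<Sum>n. a n * z ^ n"] assms by (auto simp: summable_sums)

text \<open>With this weight the norm of \<open>f\<close> is that of \<open>z \<mapsto> f (r z)\<close>, whose coefficients are
\<open>r\<^sup>n c\<^sub>n\<close>.\<close>

definition radial_weight :: "(nat \<Rightarrow> real) \<Rightarrow> real \<Rightarrow> nat \<Rightarrow> real" where
  "radial_weight w r n = w n * r ^ (2 * n)"

text \<open>The constant in the comparison of the weighted norm on the circle of radius \<open>r\<close> with the
maximum norm on the disc of radius \<open>R > r\<close>, for weights that grow at most linearly.\<close>

definition radial_const :: "real \<Rightarrow> real \<Rightarrow> real" where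
  "radial_const r R = (\<Sum>n. real (Suc n) * ((r / R)\<^sup>2) ^ n)"

lemma radial_const_sums:
  assumes "0 < r" "r < R"
  shows "summable (\<lambda>n. real (Suc n) * ((r / R)\<^sup>2) ^ n)"
proof -
  have *: "norm ((r / R)\<^sup>2) < 1"
    using assms by (simp add: power_divide divide_simps power_strict_mono)
  have "summable (\<lambda>n. diffs (\<lambda>_. 1::real) n * ((r / R)\<^sup>2) ^ n)"
    by (rule termdiff_converges[of _ 1]) (use * in \<open>auto intro: summable_geometric\<close>)
  then show ?thesis
    by (simp add: diffs_def)
qed

text \<open>Cauchy's estimate \<open>|c\<^sub>n| \<le> B / R\<^sup>n\<close> beats the linear growth of the weight because
\<open>r < R\<close>. Through this lemma, locally uniform estimates become estimates in the norms on
circles.\<close>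

lemma radial_norm_le_sup:
  assumes w: "\<And>n. 0 \<le> w n" "\<And>n. w n \<le> real (Suc n)"
    and r: "0 < r" "r < R" "R < 1"
    and f: "f holomorphic_on unit_disc" "\<And>z. cmod z \<le> R \<Longrightarrow> cmod (f z) \<le> B"
  shows "wsummable (radial_weight w r) (taylor_coeff f)"
    and "(wnorm (radial_weight w r) (taylor_coeff f))\<^sup>2 \<le> radial_const r R * B\<^sup>2"
proof -
  have B0: "0 \<le> B" using f(2)[of 0] r norm_ge_zero order_trans
    by (metis less_imp_le norm_zero order_less_trans)
  have w': "0 \<le> radial_weight w r n" for n
    using w r by (simp add: radial_weight_def)
  have le: "radial_weight w r n * (cmod (taylor_coeff f n))\<^sup>2 \<le> (real (Suc n) * ((r / R)\<^sup>2) ^ n) *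
      B\<^sup>2" for n
  proof -
    have "radial_weight w r n * (cmod (taylor_coeff f n))\<^sup>2
        \<le> (real (Suc n) * r ^ (2 * n)) * (B / R ^ n)\<^sup>2"
      unfolding radial_weight_def
      using w r taylor_coeff_le[OF f(1) _ r(3) f(2)] by (intro mult_mono power_mono) auto
    also have "\<dots> = (real (Suc n) * ((r / R)\<^sup>2) ^ n) * B\<^sup>2"
      by (simp add: power_divide power_mult power_mult_distrib field_simps flip: power_mult)
    finally show ?thesis .
  qed
  have "(\<Sum>n<N. radial_weight w r n * (cmod (taylor_coeff f n))\<^sup>2) \<le> radial_const r R * B\<^sup>2" for N
  proof -
    have "(\<Sum>n<N. radial_weight w r n * (cmod (taylor_coeff f n))\<^sup>2)
        \<le> (\<Sum>n<N. real (Suc n) * ((r / R)\<^sup>2) ^ n) * B\<^sup>2"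
      unfolding sum_distrib_right by (intro sum_mono le)
    also have "\<dots> \<le> radial_const r R * B\<^sup>2"
      unfolding radial_const_def using r
      by (intro mult_right_mono sum_le_suminf radial_const_sums) auto
    finally show ?thesis .
  qed
  from wnorm_sq_leI[OF w' this]
  show "wsummable (radial_weight w r) (taylor_coeff f)"
    "(wnorm (radial_weight w r) (taylor_coeff f))\<^sup>2 \<le> radial_const r R * B\<^sup>2" by auto
qed

lemma bounded_on_cball:
  assumes "f holomorphic_on unit_disc" "R < 1"
  obtains B where "0 \<le> B" "\<And>z. cmod z \<le> R \<Longrightarrow> cmod (f z) \<le> B"
proof -
  have "compact (f ` cball 0 R)"
    using assms by (intro compact_continuous_image holomorphic_on_imp_continuous_on)
      (auto elim!: holomorphic_on_subset)
  then have "bounded (f ` cball 0 R)" by (rule compact_imp_bounded)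
  then obtain B where "0 < B" "\<forall>z\<in>f ` cball 0 R. cmod z \<le> B"
    unfolding bounded_pos by blast
  then show ?thesis by (intro that[of B]) auto
qed

lemma radial_wsummable:
  assumes w: "\<And>n. 0 \<le> w n" "\<And>n. w n \<le> real (Suc n)"
    and r: "0 < r" "r < 1" and f: "f holomorphic_on unit_disc"
  shows "wsummable (radial_weight w r) (taylor_coeff f)"
proof -
  have R: "r < (1 + r) / 2" "(1 + r) / 2 < 1" using r by auto
  obtain B where "\<And>z. cmod z \<le> (1 + r) / 2 \<Longrightarrow> cmod (f z) \<le> B"
    using bounded_on_cball[OF f R(2)] by blast
  then show ?thesis
    using radial_norm_le_sup(1)[OF w r(1) R f] by blast
qed

abbreviation circle_weight :: "real \<Rightarrow> nat \<Rightarrow> real" where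
  "circle_weight r \<equiv> (\<lambda>n. r ^ (2 * n))"

lemma radial_weight_1: "radial_weight (\<lambda>_. 1) r = circle_weight r"
  by (simp add: radial_weight_def fun_eq_iff)

lemma circle_wsummable:
  assumes "0 < r" "r < 1" "f holomorphic_on unit_disc"
  shows "wsummable (circle_weight r) (taylor_coeff f)"
  using radial_wsummable[of "\<lambda>_. 1" r f] assms by (simp add: radial_weight_1)

text \<open>By Parseval both sides are mean squares over the circle of radius \<open>r\<close>.\<close>

lemma circle_norm_mult_le:
  assumes G: "G holomorphic_on unit_disc" and u: "u holomorphic_on unit_disc"
    and r: "0 < r" "r < 1" and M: "\<And>z. cmod z = r \<Longrightarrow> cmod (G z) \<le> M"
  shows "wnorm (circle_weight r) (taylor_coeff (\<lambda>z. G z * u z)) \<le> M * wnorm (circle_weight r)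
      (taylor_coeff u)"
proof -
  define W where "W = circle_weight r"
  have W: "0 \<le> W n" for n using r by (simp add: W_def)
  have M0: "0 \<le> M" using M[of "of_real r"] r norm_ge_zero order_trans
    by (metis abs_of_pos norm_of_real)
  have Gu: "(\<lambda>z. G z * u z) holomorphic_on unit_disc" using G u by (intro holomorphic_intros)
  have int: "((\<lambda>\<theta>. (cmod (h (of_real r * cis \<theta>)))\<^sup>2) has_integral 2 * pi *
      (wnorm W (taylor_coeff h))\<^sup>2) {0..2*pi}"
    if h: "h holomorphic_on unit_disc" for h
  proof -
    have "wip W (taylor_coeff h) (taylor_coeff h) = of_real ((wnorm W (taylor_coeff h))\<^sup>2)"
      unfolding W_def by (intro wip_self circle_wsummable r h) (use r in auto)
    with has_integral_Re[OF Parseval_circle[OF h h r]] show ?thesis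
      unfolding complex_norm_square[symmetric] by (simp add: W_def)
  qed
  have "2 * pi * (wnorm W (taylor_coeff (\<lambda>z. G z * u z)))\<^sup>2
      \<le> M\<^sup>2 * (2 * pi * (wnorm W (taylor_coeff u))\<^sup>2)"
  proof (rule has_integral_le[OF int[OF Gu] has_integral_mult_right[OF int[OF u]]])
    fix \<theta>
    have "cmod (G (of_real r * cis \<theta>)) \<le> M" using r by (intro M) (simp add: norm_mult)
    then show "(cmod (G (of_real r * cis \<theta>) * u (of_real r * cis \<theta>)))\<^sup>2
        \<le> M\<^sup>2 * (cmod (u (of_real r * cis \<theta>)))\<^sup>2"
      by (auto simp: norm_mult power_mult_distrib intro!: mult_right_mono power_mono)
  qed
  then have "(wnorm W (taylor_coeff (\<lambda>z. G z * u z)))\<^sup>2 \<le> (M * wnorm W (taylor_coeff u))\<^sup>2"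
    by (simp add: power_mult_distrib)
  then show ?thesis
    unfolding W_def[symmetric]
    by (rule power2_le_imp_le) (use M0 W wnorm_nonneg[OF W] circle_wsummable[OF r u] in \<open>auto
        simp: W_def\<close>)
qed

text \<open>By Parseval the inner product is the mean of \<open>cnj z G(z) |v(z)|\<^sup>2\<close> over the circle: the
energy that \<open>G\<close> transports through the circle.\<close>

lemma circle_flux_nonpos:
  assumes G: "G holomorphic_on unit_disc" and v: "v holomorphic_on unit_disc"
    and r: "0 < r" "r < 1" and neg: "\<And>z. cmod z = r \<Longrightarrow> Re (cnj z * G z) \<le> 0"
  shows "Re (wip (circle_weight r) (taylor_coeff (\<lambda>z. G z * v z)) (taylor_coeff (\<lambda>z. z * v z))) \<le> 0"
proof -
  have "((\<lambda>\<theta>. Re (G (of_real r * cis \<theta>) * v (of_real r * cis \<theta>) * cnj (of_real r * cis \<theta> * v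
      (of_real r * cis \<theta>))))
     has_integral Re (2 * of_real pi * wip (circle_weight r) (taylor_coeff (\<lambda>z. G z * v z))
         (taylor_coeff (\<lambda>z. z * v z)))) {0..2*pi}"
    using G v r by (intro has_integral_Re Parseval_circle holomorphic_intros)
  then have "Re (2 * of_real pi * wip (circle_weight r) (taylor_coeff (\<lambda>z. G z * v z))
      (taylor_coeff (\<lambda>z. z * v z))) \<le> 0"
  proof (rule has_integral_le[OF _ has_integral_0])
    fix \<theta>
    define z where "z = of_real r * cis \<theta>"
    have "G z * v z * cnj (z * v z) = of_real ((cmod (v z))\<^sup>2) * (cnj z * G z)"
      unfolding complex_norm_square by (simp add: mult_ac)
    then show "Re (G (of_real r * cis \<theta>) * v (of_real r * cis \<theta>) * cnj (of_real r * cis \<theta> * v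
        (of_real r * cis \<theta>))) \<le> 0"
      unfolding z_def[symmetric]
      using neg[of z] r by (simp only: Re_complex_of_real times_complex.sel Im_complex_of_real)
        (simp add: z_def norm_mult mult_nonneg_nonpos)
  qed
  then show ?thesis using pi_gt_zero by (simp add: mult_le_0_iff)
qed

lemma circle_shift:
  assumes r: "0 < r" and a: "wsummable (circle_weight r) a" and b: "wsummable (circle_weight r) b"
  shows "wip (circle_weight r)
      (\<lambda>n. case n of 0 \<Rightarrow> 0 | Suc m \<Rightarrow> a m) (\<lambda>n. case n of 0 \<Rightarrow> 0 | Suc m \<Rightarrow> b m)
    = of_real (r\<^sup>2) * wip (circle_weight r) a b"
proof -
  define F where "F n = of_real (circle_weight r n) * (case n of 0 \<Rightarrow> 0 | Suc m \<Rightarrow> a m) * cnj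
      (case n of 0 \<Rightarrow> 0 | Suc m \<Rightarrow> b m)" for n
  have "(\<lambda>n. of_real (r\<^sup>2) * (of_real (circle_weight r n) * a n * cnj (b n))) sums
      (of_real (r\<^sup>2) * wip (circle_weight r) a b)"
    unfolding wip_def using r by (intro sums_mult summable_sums wip_summable a b) auto
  also have "(\<lambda>n. of_real (r\<^sup>2) * (of_real (circle_weight r n) * a n * cnj (b n)))
      = (\<lambda>n. F (Suc n))"
    by (simp add: F_def fun_eq_iff power2_eq_square mult_ac)
  finally have "F sums (of_real (r\<^sup>2) * wip (circle_weight r) a b)"
    by (subst (asm) sums_Suc_iff) (simp add: F_def)
  moreover have "wip (circle_weight r)
      (\<lambda>n. case n of 0 \<Rightarrow> 0 | Suc m \<Rightarrow> a m) (\<lambda>n. case n of 0 \<Rightarrow> 0 | Suc m \<Rightarrow> b m) = suminf F"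
    unfolding wip_def F_def by (rule refl)
  ultimately show ?thesis
    by (simp only: sums_iff)
qed

section \<open>The rate of change of the energy\<close>

text \<open>The \<open>m\<close>-th iterate of \<open>f \<mapsto> (f - f(0)) / z\<close>.\<close>

definition backward_shift :: "nat \<Rightarrow> (complex \<Rightarrow> complex) \<Rightarrow> complex \<Rightarrow> complex" where
  "backward_shift m f z = (\<Sum>n. taylor_coeff f (n + m) * z ^ n)"

lemma backward_shift:
  assumes "f holomorphic_on unit_disc"
  shows "backward_shift m f holomorphic_on unit_disc"
    "taylor_coeff (backward_shift m f) n = taylor_coeff f (n + m)"
proof -
  have "summable (\<lambda>n. taylor_coeff f (n + m) * z ^ n)" if "z \<in> unit_disc" for z
    using taylor_sums[OF assms that] by (simp add: summable_powser_ignore_initial_segment sums_iff)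
  from taylor_coeff_powser[OF this]
  show "backward_shift m f holomorphic_on unit_disc"
    "taylor_coeff (backward_shift m f) n = taylor_coeff f (n + m)"
    by (simp_all add: backward_shift_def[abs_def])
qed

lemma backward_shift_shift:
  assumes "f holomorphic_on unit_disc"
  shows "backward_shift (Suc 0) (backward_shift m f) = backward_shift (Suc m) f"
  by (rule ext) (simp add: backward_shift_def[of "Suc 0"] backward_shift_def[of
      "Suc m"] backward_shift(2)[OF assms])

lemma backward_shift_eq:
  assumes f: "f holomorphic_on unit_disc" and z: "z \<in> unit_disc"
  shows "f z = taylor_coeff f 0 + z * backward_shift 1 f z"
proof -
  have s: "summable (\<lambda>n. taylor_coeff f n * z ^ n)" using taylor_sums[OF f z]
    by (simp add: sums_iff)
  have "f z = (\<Sum>n. taylor_coeff f n * z ^ n)" using taylor_sums[OF f z] by (simp add: sums_iff)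
  then show ?thesis
    using powser_split_head(1)[OF s] by (simp add: backward_shift_def mult.commute)
qed

lemma backward_shift_deriv:
  assumes f: "f holomorphic_on unit_disc" and z: "z \<in> unit_disc"
  shows "deriv f z = backward_shift 1 f z + z * deriv (backward_shift 1 f) z"
proof -
  let ?q = "backward_shift 1 f"
  have q: "?q holomorphic_on unit_disc" by (rule backward_shift[OF f])
  have "deriv f z = deriv (\<lambda>z. taylor_coeff f 0 + z * ?q z) z"
    using backward_shift_eq[OF f] f q z
    by (intro complex_derivative_transform_within_open[of _ unit_disc] holomorphic_intros) auto
  also have "\<dots> = ?q z + z * deriv ?q z"
    using holomorphic_derivI[OF q _ z]
    by (intro DERIV_imp_deriv) (auto intro!: derivative_eq_intros)
  finally show ?thesis .
qed

text \<open>Half the derivative at \<open>t = 0\<close> of the squared norm of \<open>f \<circ> \<phi>\<^sub>t\<close>, since \<open>G f'\<close> is the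
derivative of \<open>f \<circ> \<phi>\<^sub>t\<close>.\<close>

definition energy_rate :: "(nat \<Rightarrow> real) \<Rightarrow> (complex \<Rightarrow> complex) \<Rightarrow> (complex \<Rightarrow> complex) \<Rightarrow> real" where
  "energy_rate w G f = Re (wip w (taylor_coeff (\<lambda>z. G z * deriv f z)) (taylor_coeff f))"

text \<open>The value at zero accounts for the summand \<open>|c\<^sub>0|\<^sup>2\<close> of the squared Dirichlet norm, which
keeps the weight at least one.\<close>

definition dirichlet_weight :: "nat \<Rightarrow> real" where
  "dirichlet_weight n = (if n = 0 then 1 else real n)"

context
  fixes G :: "complex \<Rightarrow> complex" and r :: real
  assumes G: "G holomorphic_on unit_disc" and r: "0 < r" "r < 1"
    and neg: "\<And>z. cmod z = r \<Longrightarrow> Re (cnj z * G z) \<le> 0"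
begin

lemma holo_symbol_op: "f holomorphic_on unit_disc \<Longrightarrow> (\<lambda>z. G z * deriv f z) holomorphic_on unit_disc"
  using G by (intro holomorphic_intros) auto

text \<open>With \<open>f = c\<^sub>0 + z q\<close> one has \<open>G f' = G q + z G q'\<close>. Pairing with \<open>f\<close>, the constant \<open>c\<^sub>0\<close>
sees only the value \<open>G(0) c\<^sub>1\<close> at the origin, \<open>G q\<close> against \<open>z q\<close> is a flux, and \<open>z G q'\<close>
against \<open>z q\<close> is \<open>r\<^sup>2\<close> times the pairing for \<open>q\<close>.\<close>

lemma energy_rate_shift:
  assumes f: "f holomorphic_on unit_disc"
  shows "energy_rate (circle_weight r) G f \<le> cmod (G 0) * cmod (taylor_coeff f 1) * cmod
      (taylor_coeff f 0)
     + r\<^sup>2 * energy_rate (circle_weight r) G (backward_shift 1 f)"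
proof -
  define q where "q = backward_shift 1 f"
  have q: "q holomorphic_on unit_disc" unfolding q_def by (rule backward_shift[OF f])
  have hol: "(\<lambda>z. G z * q z) holomorphic_on unit_disc"
      "(\<lambda>z. z * (G z * deriv q z)) holomorphic_on unit_disc"
    "(\<lambda>z. z * q z) holomorphic_on unit_disc"
        "(\<lambda>z. G z * q z + z * (G z * deriv q z)) holomorphic_on unit_disc"
    using G q by (auto intro!: holomorphic_intros)
  define W where "W = circle_weight r"
  have W: "0 \<le> W n" for n using r by (simp add: W_def)
  have ws: "wsummable W (taylor_coeff h)" if "h holomorphic_on unit_disc" for h
    unfolding W_def by (rule circle_wsummable[OF r that])
  define A where "A = taylor_coeff (\<lambda>z. G z * deriv f z)"
  have A_eq: "A n = taylor_coeff (\<lambda>z. G z * q z) n + taylor_coeff (\<lambda>z. z * (G z * deriv q z)) n"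
      for n
    unfolding A_def taylor_coeff_add[OF hol(1,2), symmetric]
    by (rule taylor_coeff_cong[OF hol(4)]) (simp add: backward_shift_deriv[OF f] q_def
        algebra_simps)
  have wsA: "wsummable W A"
    unfolding A_def by (intro ws holo_symbol_op f)
  define c0 where "c0 = (\<lambda>n::nat. if n = 0 then taylor_coeff f 0 else 0)"
  have f_eq: "taylor_coeff f n = c0 n + taylor_coeff (\<lambda>z. z * q z) n" for n
    unfolding c0_def taylor_coeff_mult_z[OF q]
      by (simp add: q_def backward_shift[OF f] split: nat.split)
  have c0: "wsummable W c0" unfolding wsummable_def c0_def
    by (rule summable_finite[of "{0}"]) auto
  have "wip W A (taylor_coeff f) = cnj (wip W (\<lambda>n. c0 n + taylor_coeff (\<lambda>z. z * q z) n) A)"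
    unfolding f_eq[abs_def, symmetric] by (rule wip_cnj[OF W]) (auto simp: ws f wsA)
  also have "\<dots> = cnj (wip W c0 A) + cnj (wip W (taylor_coeff (\<lambda>z. z * q z)) A)"
    by (subst wip_add_left[OF W]) (auto simp: c0 ws hol wsA)
  also have "cnj (wip W c0 A) = A 0 * cnj (taylor_coeff f 0)"
  proof -
    have "wip W c0 A = (\<Sum>n\<in>{0}. of_real (W n) * c0 n * cnj (A n))"
      unfolding wip_def by (rule suminf_finite) (auto simp: c0_def)
    then show ?thesis by (simp add: c0_def W_def)
  qed
  also have "cnj (wip W (taylor_coeff (\<lambda>z. z * q z)) A) = wip W A (taylor_coeff (\<lambda>z. z * q z))"
    by (rule wip_cnj[OF W, symmetric]) (auto simp: ws hol wsA)
  also have "\<dots> = wip W (taylor_coeff (\<lambda>z. G z * q z)) (taylor_coeff (\<lambda>z. z * q z))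
       + wip W (taylor_coeff (\<lambda>z. z * (G z * deriv q z))) (taylor_coeff (\<lambda>z. z * q z))"
    unfolding A_eq[abs_def] by (rule wip_add_left[OF W]) (auto simp: ws hol)
  also have "wip W (taylor_coeff (\<lambda>z. z * (G z * deriv q z))) (taylor_coeff (\<lambda>z. z * q z))
      = of_real (r\<^sup>2) * wip W (taylor_coeff (\<lambda>z. G z * deriv q z)) (taylor_coeff q)"
    unfolding W_def taylor_coeff_mult_z[OF q, abs_def] taylor_coeff_mult_z[OF
        holo_symbol_op[OF q], abs_def]
    by (rule circle_shift[OF r(1)]) (use ws q holo_symbol_op in \<open>auto simp: W_def\<close>)
  finally have "energy_rate W G f = Re (A 0 * cnj (taylor_coeff f 0))
      + Re (wip W (taylor_coeff (\<lambda>z. G z * q z)) (taylor_coeff (\<lambda>z. z * q z))) + r\<^sup>2 * energy_rate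
          W G q"
    unfolding energy_rate_def A_def by simp
  moreover have "Re (wip W (taylor_coeff (\<lambda>z. G z * q z)) (taylor_coeff (\<lambda>z. z * q z))) \<le> 0"
    unfolding W_def by (rule circle_flux_nonpos[OF G q r neg])
  moreover have "A 0 = G 0 * taylor_coeff f 1"
    unfolding A_def taylor_coeff_0 by (simp add: taylor_coeff_def)
  then have "Re (A 0 * cnj (taylor_coeff f 0)) \<le> cmod (G 0) * cmod (taylor_coeff f 1) * cmod
      (taylor_coeff f 0)"
    using complex_Re_le_cmod[of "A 0 * cnj (taylor_coeff f 0)"] by (simp add: norm_mult)
  ultimately show ?thesis unfolding W_def q_def by linarith
qed

lemma energy_rate_shift_iterate:
  assumes f: "f holomorphic_on unit_disc"
  shows "energy_rate (circle_weight r) G f \<le>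
     cmod (G 0) * (\<Sum>k<m. r ^ (2 * k) * (cmod (taylor_coeff f (Suc k)) * cmod (taylor_coeff f k)))
     + r ^ (2 * m) * energy_rate (circle_weight r) G (backward_shift m f)"
proof (induction m)
  case 0
  have [simp]: "\<And>z. z \<in> unit_disc \<Longrightarrow> backward_shift 0 f z = f z"
    using taylor_sums[OF f] by (simp add: backward_shift_def sums_iff)
  have "taylor_coeff (\<lambda>z. G z * deriv (backward_shift 0 f) z) = taylor_coeff (\<lambda>z. G z * deriv f z)"
    using complex_derivative_transform_within_open[of "backward_shift 0 f" unit_disc f] f
        backward_shift[OF f, of 0]
    by (intro ext taylor_coeff_cong holo_symbol_op f) auto
  moreover have "taylor_coeff (backward_shift 0 f) = taylor_coeff f"
    using backward_shift[OF f, of 0] by auto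
  ultimately show ?case by (simp add: energy_rate_def)
next
  case (Suc m)
  have "energy_rate (circle_weight r) G (backward_shift m f) \<le>
      cmod (G 0) * cmod (taylor_coeff f (Suc m)) * cmod (taylor_coeff f m)
     + r\<^sup>2 * energy_rate (circle_weight r) G (backward_shift (Suc m) f)"
    using energy_rate_shift[OF backward_shift(1)[OF f, of m]]
    by (simp add: backward_shift_shift[OF f] backward_shift[OF f])
  then have "r ^ (2 * m) * energy_rate (circle_weight r) G (backward_shift m f) \<le>
      r ^ (2 * m) * (cmod (G 0) * cmod (taylor_coeff f (Suc m)) * cmod (taylor_coeff f m)
     + r\<^sup>2 * energy_rate (circle_weight r) G (backward_shift (Suc m) f))"
    using r by (intro mult_left_mono) auto
  with Suc show ?case
    by (simp add: algebra_simps power_add power2_eq_square)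
qed

text \<open>By the Cauchy-Schwarz inequality the remainder is at most \<open>r\<^sup>m\<parallel>q'\<parallel> r\<^sup>m\<parallel>q\<parallel>\<close>, up to a
constant, with \<open>q\<close> the \<open>m\<close>-th backward shift. The second factor is bounded by \<open>\<parallel>f\<parallel>\<close>, and the
square of the first by a tail of the convergent series for \<open>\<parallel>f'\<parallel>\<^sup>2\<close>.\<close>

lemma energy_rate_shift_tendsto_0:
  assumes f: "f holomorphic_on unit_disc"
  shows "(\<lambda>m. r ^ (2 * m) * energy_rate (circle_weight r) G (backward_shift m f)) \<longlonglongrightarrow> 0"
proof -
  define W where "W = circle_weight r"
  have W: "0 \<le> W n" for n using r by (simp add: W_def)
  have ws: "wsummable W (taylor_coeff h)" if "h holomorphic_on unit_disc" for h
    unfolding W_def by (rule circle_wsummable[OF r that])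
  obtain M where M: "0 \<le> M" "\<And>z. cmod z \<le> r \<Longrightarrow> cmod (G z) \<le> M"
    using bounded_on_cball[OF G r(2)] by blast
  have f': "deriv f holomorphic_on unit_disc" using f by (intro holomorphic_intros) auto
  define T where "T = (\<lambda>m. \<Sum>n. W (n + m) * (cmod (taylor_coeff (deriv f) (n + m)))\<^sup>2)"
  have T0: "T \<longlonglongrightarrow> 0"
    unfolding T_def by (rule suminf_exist_split2) (use ws[OF f'] in \<open>simp add: wsummable_def\<close>)
  have bound: "norm (r ^ (2 * m) * energy_rate W G (backward_shift m f))
      \<le> M * sqrt (T m) * wnorm W (taylor_coeff f)" for m
  proof -
    define q where "q = backward_shift m f"
    have q: "q holomorphic_on unit_disc" "\<And>n. taylor_coeff q n = taylor_coeff f (n + m)"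
      unfolding q_def by (rule backward_shift[OF f])+
    have q': "deriv q holomorphic_on unit_disc" using q by (intro holomorphic_intros) auto
    have n1: "r ^ m * wnorm W (taylor_coeff q) \<le> wnorm W (taylor_coeff f)"
    proof (rule power2_le_imp_le)
      have s: "summable (\<lambda>n. W n * (cmod (taylor_coeff f n))\<^sup>2)" using ws[OF f]
        by (simp add: wsummable_def)
      have "(r ^ m * wnorm W (taylor_coeff q))\<^sup>2
          = r ^ (2 * m) * (\<Sum>n. W n * (cmod (taylor_coeff q n))\<^sup>2)"
        by (simp add: power_mult_distrib wnorm_sq[OF W ws[OF q(1)]] power_mult[symmetric]
            mult.commute)
      also have "\<dots> = (\<Sum>n. r ^ (2 * m) * (W n * (cmod (taylor_coeff q n))\<^sup>2))"
        using ws[OF q(1)] by (intro suminf_mult[symmetric]) (simp add: wsummable_def)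
      also have "\<dots> = (\<Sum>n. W (n + m) * (cmod (taylor_coeff f (n + m)))\<^sup>2)"
        by (simp add: q W_def power_add mult_ac distrib_left)
      also have "\<dots> \<le> (\<Sum>n. W n * (cmod (taylor_coeff f n))\<^sup>2)"
        using suminf_split_initial_segment[OF s, of m] sum_nonneg[of "{..<m}"
            "\<lambda>n. W n * (cmod (taylor_coeff f n))\<^sup>2"] W
        by simp
      also have "\<dots> = (wnorm W (taylor_coeff f))\<^sup>2" by (simp add: wnorm_sq[OF W ws[OF f]])
      finally show "(r ^ m * wnorm W (taylor_coeff q))\<^sup>2 \<le> (wnorm W (taylor_coeff f))\<^sup>2" .
    qed (rule wnorm_nonneg[OF W ws[OF f]])
    have n2: "r ^ m * wnorm W (taylor_coeff (deriv q)) \<le> sqrt (T m)"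
    proof (rule real_le_rsqrt)
      have s: "summable (\<lambda>n. W n * (cmod (taylor_coeff (deriv f) n))\<^sup>2)" using ws[OF f']
        by (simp add: wsummable_def)
      have "(r ^ m * wnorm W (taylor_coeff (deriv q)))\<^sup>2
          = r ^ (2 * m) * (\<Sum>n. W n * (cmod (taylor_coeff (deriv q) n))\<^sup>2)"
        by (simp add: power_mult_distrib wnorm_sq[OF W ws[OF q']] power_mult[symmetric]
            mult.commute)
      also have "\<dots> = (\<Sum>n. r ^ (2 * m) * (W n * (cmod (taylor_coeff (deriv q) n))\<^sup>2))"
        using ws[OF q'] by (intro suminf_mult[symmetric]) (simp add: wsummable_def)
      also have "\<dots> \<le> T m"
        unfolding T_def
      proof (rule suminf_le)
        show "summable (\<lambda>n. r ^ (2 * m) * (W n * (cmod (taylor_coeff (deriv q) n))\<^sup>2))"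
          using ws[OF q'] by (intro summable_mult) (simp add: wsummable_def)
        show "summable (\<lambda>n. W (n + m) * (cmod (taylor_coeff (deriv f) (n + m)))\<^sup>2)"
          using s by (rule summable_ignore_initial_segment)
        fix n
        have "cmod (taylor_coeff (deriv q) n) \<le> cmod (taylor_coeff (deriv f) (n + m))"
          unfolding taylor_coeff_deriv q norm_mult norm_of_nat by (intro mult_mono) auto
        then have "W (n + m) * (cmod (taylor_coeff (deriv q) n))\<^sup>2
            \<le> W (n + m) * (cmod (taylor_coeff (deriv f) (n + m)))\<^sup>2"
          using W by (intro mult_left_mono power_mono) auto
        then show "r ^ (2 * m) * (W n * (cmod (taylor_coeff (deriv q) n))\<^sup>2)
            \<le> W (n + m) * (cmod (taylor_coeff (deriv f) (n + m)))\<^sup>2"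
          by (simp add: W_def power_add mult_ac distrib_left)
      qed
      finally show "(r ^ m * wnorm W (taylor_coeff (deriv q)))\<^sup>2 \<le> T m" .
    qed
    have "\<bar>energy_rate W G q\<bar> \<le> wnorm W (taylor_coeff (\<lambda>z. G z * deriv q z)) * wnorm W
        (taylor_coeff q)"
      unfolding energy_rate_def
      using wip_Cauchy_Schwarz[OF W ws[OF holo_symbol_op[OF q(1)]] ws[OF q(1)]] abs_Re_le_cmod
          order_trans by blast
    also have "\<dots> \<le> M * wnorm W (taylor_coeff (deriv q)) * wnorm W (taylor_coeff q)"
      unfolding W_def
      by (intro mult_right_mono circle_norm_mult_le G q' r) (use M wnorm_nonneg[OF W ws[OF q(1)]]
          in \<open>auto simp: W_def\<close>)
    finally have "r ^ (2 * m) * \<bar>energy_rate W G q\<bar>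
        \<le> r ^ (2 * m) * (M * wnorm W (taylor_coeff (deriv q)) * wnorm W (taylor_coeff q))"
      using r by (intro mult_left_mono) auto
    also have "\<dots> = M * (r ^ m * wnorm W (taylor_coeff (deriv q))) *
        (r ^ m * wnorm W (taylor_coeff q))"
      by (simp add: power_mult power2_eq_square mult_ac power_mult_distrib)
    also have "\<dots> \<le> M * sqrt (T m) * wnorm W (taylor_coeff f)"
    proof (intro mult_mono n1 n2 M(1))
      have "0 \<le> r ^ m * wnorm W (taylor_coeff (deriv q))"
        using r wnorm_nonneg[OF W ws[OF q']] by simp
      with n2 have "0 \<le> sqrt (T m)" by linarith
      with M(1) show "0 \<le> M * sqrt (T m)" by simp
    qed (use r wnorm_nonneg[OF W ws[OF q(1)]] wnorm_nonneg[OF W ws[OF q']] in auto)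
    finally show ?thesis using r by (simp add: abs_mult q_def)
  qed
  have "(\<lambda>m. M * sqrt (T m) * wnorm W (taylor_coeff f)) \<longlonglongrightarrow> M * sqrt 0 * wnorm W (taylor_coeff f)"
    by (intro tendsto_intros T0)
  then have "(\<lambda>m. r ^ (2 * m) * energy_rate W G (backward_shift m f)) \<longlonglongrightarrow> 0"
    by (intro Lim_null_comparison[OF always_eventually[OF allI[OF bound]]]) simp
  then show ?thesis by (simp add: W_def)
qed

text \<open>Iterating \<open>energy_rate_shift\<close> leaves the sum of the terms \<open>r\<^sup>2\<^sup>k |c\<^sub>k\<^sub>+\<^sub>1| |c\<^sub>k|\<close>, which
the inequality between arithmetic and geometric mean bounds by \<open>\<parallel>f\<parallel>\<^sup>2 / r\<close>.\<close>

lemma hardy_dissipative: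
  assumes f: "f holomorphic_on unit_disc"
  shows "energy_rate (circle_weight r) G f
      \<le> cmod (G 0) / r * (wnorm (circle_weight r) (taylor_coeff f))\<^sup>2"
proof -
  define W where "W = circle_weight r"
  have W: "0 \<le> W n" for n using r by (simp add: W_def)
  have ws: "wsummable W (taylor_coeff f)"
    unfolding W_def by (rule circle_wsummable[OF r f])
  define c where "c = (\<lambda>n. cmod (taylor_coeff f n))"
  define S where "S = (wnorm W (taylor_coeff f))\<^sup>2"
  have partial: "(\<Sum>k<m. r ^ (2 * k) * (c (Suc k) * c k)) \<le> S / r" for m
  proof -
    have "r * (\<Sum>k<m. r ^ (2 * k) * (c (Suc k) * c k))
        = (\<Sum>k<m. (r ^ Suc k * c (Suc k)) * (r ^ k * c k))"
      unfolding sum_distrib_left by (intro sum.cong refl) (simp add: power_mult power2_eq_square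
          power_mult_distrib mult_ac)
    also have "\<dots> \<le> (\<Sum>k<m. (W (Suc k) * (c (Suc k))\<^sup>2 + W k * (c k)\<^sup>2) / 2)"
    proof (rule sum_mono)
      fix k
      show "(r ^ Suc k * c (Suc k)) * (r ^ k * c k) \<le> (W (Suc k) * (c (Suc k))\<^sup>2 + W k * (c k)\<^sup>2)
          / 2"
        using sum_squares_bound[of "r ^ Suc k * c (Suc k)" "r ^ k * c k"]
        unfolding W_def power_mult_distrib power_mult[symmetric]
        by (simp add: mult.commute)
    qed
    also have "\<dots> = ((\<Sum>k<m. W (Suc k) * (c (Suc k))\<^sup>2) + (\<Sum>k<m. W k * (c k)\<^sup>2)) / 2"
      by (simp add: sum.distrib flip: sum_divide_distrib)
    also have "(\<Sum>k<m. W (Suc k) * (c (Suc k))\<^sup>2) \<le> (\<Sum>k<Suc m. W k * (c k)\<^sup>2)"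
      unfolding sum.lessThan_Suc_shift using W by simp
    also have "(\<Sum>k<Suc m. W k * (c k)\<^sup>2) \<le> S"
      unfolding S_def c_def by (rule wsum_le_wnorm_sq[OF W ws])
    also have "(\<Sum>k<m. W k * (c k)\<^sup>2) \<le> S"
      unfolding S_def c_def by (rule wsum_le_wnorm_sq[OF W ws])
    finally show ?thesis using r by (simp add: field_simps)
  qed
  have "energy_rate W G f \<le> cmod (G 0) * (S / r) + r ^ (2 * m) * energy_rate W G
      (backward_shift m f)" for m
    using energy_rate_shift_iterate[OF f, of m] mult_left_mono[OF partial[of m], of "cmod (G 0)"]
    unfolding W_def c_def by simp
  moreover have "(\<lambda>m. cmod (G 0) * (S / r) + r ^ (2 * m) * energy_rate W G (backward_shift m f))
      \<longlonglongrightarrow> cmod (G 0) * (S / r) + 0"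
    unfolding W_def by (intro tendsto_intros energy_rate_shift_tendsto_0 f)
  ultimately have "energy_rate W G f \<le> cmod (G 0) * (S / r) + 0"
    by (intro LIMSEQ_le_const) auto
  then show ?thesis by (simp add: W_def S_def)
qed

text \<open>Since \<open>n c\<^sub>n\<close> are the coefficients of \<open>z f'\<close>, the pairing of \<open>G f'\<close> with \<open>f\<close> for the
weight \<open>n\<close> is the flux of \<open>f'\<close>. Only the summand at index zero, \<open>G(0) c\<^sub>1 cnj c\<^sub>0\<close>, remains to
be estimated.\<close>

lemma dirichlet_dissipative:
  assumes f: "f holomorphic_on unit_disc"
  shows "energy_rate (radial_weight dirichlet_weight r) G f
    \<le> cmod (G 0) / r * (wnorm (radial_weight dirichlet_weight r) (taylor_coeff f))\<^sup>2"
proof -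
  define W where "W = circle_weight r"
  define V where "V = radial_weight dirichlet_weight r"
  have W: "0 \<le> W n" for n using r by (simp add: W_def)
  have V: "0 \<le> V n" for n using r by (simp add: V_def radial_weight_def dirichlet_weight_def)
  have V_ws: "wsummable V (taylor_coeff h)" if "h holomorphic_on unit_disc" for h
    unfolding V_def by (intro radial_wsummable r that) (auto simp: dirichlet_weight_def)
  have f': "deriv f holomorphic_on unit_disc" using f by (intro holomorphic_intros) auto
  have zf': "(\<lambda>z. z * deriv f z) holomorphic_on unit_disc" using f
    by (intro holomorphic_intros) auto
  define A where "A = taylor_coeff (\<lambda>z. G z * deriv f z)"
  have A: "wsummable V A" "wsummable W A"
    using V_ws circle_wsummable[OF r] holo_symbol_op[OF f] by (auto simp: A_def W_def)
  define F where "F n = of_real (V n) * A n * cnj (taylor_coeff f n)" for n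
  define H where "H n = of_real (W n) * A n * cnj (taylor_coeff (\<lambda>z. z * deriv f z) n)" for n
  \<comment> \<open>The two pairings differ only at index zero, where \<open>z f'\<close> has no coefficient.\<close>
  have HF: "H n = (if n = 0 then 0 else F n)" for n
    unfolding H_def F_def taylor_coeff_mult_z[OF f']
    by (cases n) (simp_all add: taylor_coeff_deriv W_def V_def radial_weight_def
        dirichlet_weight_def mult_ac)
  have "F sums wip V A (taylor_coeff f)"
    unfolding F_def wip_def by (intro summable_sums wip_summable[OF V] A V_ws f)
  moreover have "(\<lambda>n. if n = 0 then F n else 0) sums F 0"
    by (rule sums_single)
  ultimately have "(\<lambda>n. F n - (if n = 0 then F n else 0)) sums (wip V A (taylor_coeff f) - F 0)"
    by (rule sums_diff)
  also have "(\<lambda>n. F n - (if n = 0 then F n else 0)) = H" by (auto simp: HF)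
  finally have "wip V A (taylor_coeff f) - F 0 = wip W A (taylor_coeff (\<lambda>z. z * deriv f z))"
    unfolding wip_def H_def[symmetric] by (simp add: sums_iff)
  moreover have "Re (wip W A (taylor_coeff (\<lambda>z. z * deriv f z))) \<le> 0"
    unfolding W_def A_def by (rule circle_flux_nonpos[OF G f' r neg])
  ultimately have "energy_rate V G f \<le> Re (F 0)"
    unfolding energy_rate_def A_def by (simp add: algebra_simps)
  also have "Re (F 0) \<le> cmod (G 0) * (cmod (taylor_coeff f 1) * cmod (taylor_coeff f 0))"
  proof -
    have "A 0 = G 0 * taylor_coeff f 1"
      unfolding A_def taylor_coeff_0 by (simp add: taylor_coeff_def)
    then have "cmod (F 0) = cmod (G 0) * (cmod (taylor_coeff f 1) * cmod (taylor_coeff f 0))"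
      by (simp add: F_def V_def radial_weight_def dirichlet_weight_def norm_mult)
    then show ?thesis using complex_Re_le_cmod[of "F 0"] by simp
  qed
  also have "\<dots> \<le> cmod (G 0) * ((wnorm V (taylor_coeff f))\<^sup>2 / r)"
  proof (rule mult_left_mono)
    have "r * (cmod (taylor_coeff f 1) * cmod (taylor_coeff f 0))
       \<le> ((r * cmod (taylor_coeff f 1))\<^sup>2 + (cmod (taylor_coeff f 0))\<^sup>2) / 2"
      using sum_squares_bound[of "r * cmod (taylor_coeff f 1)" "cmod (taylor_coeff f 0)"] by simp
    also have "\<dots> = (\<Sum>n<2. V n * (cmod (taylor_coeff f n))\<^sup>2) / 2"
      by (simp add: V_def radial_weight_def dirichlet_weight_def power_mult_distrib
          eval_nat_numeral)
    also have "\<dots> \<le> (wnorm V (taylor_coeff f))\<^sup>2"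
      using wsum_le_wnorm_sq[OF V V_ws[OF f], of 2] zero_le_power2[of "wnorm V (taylor_coeff f)"]
        by linarith
    finally show "cmod (taylor_coeff f 1) * cmod (taylor_coeff f 0) \<le> (wnorm V (taylor_coeff f))\<^sup>2
        / r"
      using r by (simp add: field_simps)
  qed simp
  finally show ?thesis by (simp add: V_def)
qed

end

section \<open>Euler steps along an inward pointing vector field\<close>

text \<open>Summing the geometric series also gives the rate, which makes the convergence of the
Euler polygons uniform.\<close>

lemma geometric_Cauchy_limit:
  fixes x :: "nat \<Rightarrow> complex"
  assumes "\<And>k. cmod (x (Suc k) - x k) \<le> C * (1/2) ^ k"
  obtains l where "x \<longlonglongrightarrow> l" "\<And>k. cmod (x k - l) \<le> 2 * C * (1/2) ^ k"
proof -
  have *: "cmod (x (k + m) - x k) \<le> 2 * C * (1/2) ^ k - 2 * C * (1/2) ^ (k + m)" for k m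
  proof (induction m)
    case (Suc m)
    have "cmod (x (k + Suc m) - x k) \<le> cmod (x (Suc (k + m)) - x (k + m)) + cmod (x (k + m) - x k)"
      using norm_triangle_ineq[of "x (Suc (k + m)) - x (k + m)" "x (k + m) - x k"] by simp
    also have "\<dots> \<le> C * (1/2) ^ (k + m) + (2 * C * (1/2) ^ k - 2 * C * (1/2) ^ (k + m))"
      using assms Suc by (intro add_mono) auto
    finally show ?case by (simp add: field_simps)
  qed simp
  have C: "0 \<le> C" using order_trans[OF norm_ge_zero assms[of 0]] by simp
  have le: "cmod (x m - x k) \<le> 2 * C * (1/2) ^ k" if "k \<le> m" for k m
    using *[of k "m - k"] that mult_nonneg_nonneg[OF C, of "2 * (1/2) ^ m"] by simp
  have lim0: "(\<lambda>k. 2 * C * (1/2) ^ k) \<longlonglongrightarrow> 0"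
    by real_asymp
  have "Cauchy x"
  proof (rule CauchyI')
    fix e :: real assume "0 < e"
    then obtain N where N: "2 * C * (1/2) ^ N < e / 2"
      using order_tendstoD(2)[OF lim0, of "e/2"] by (auto simp: eventually_sequentially)
    show "\<exists>M. \<forall>m\<ge>M. \<forall>n>m. dist (x m) (x n) < e"
    proof (intro exI allI impI)
      fix m n assume "N \<le> m" "m < n"
      have "cmod (x m - x n) \<le> cmod (x m - x N) + cmod (x n - x N)"
        using norm_triangle_ineq4[of "x m - x N" "x n - x N"] by simp
      also have "\<dots> < e" using le[of N m] le[of N n] N \<open>N \<le> m\<close> \<open>m < n\<close> by simp
      finally show "dist (x m) (x n) < e" by (simp add: dist_norm)
    qed
  qed
  then obtain l where l: "x \<longlonglongrightarrow> l" using Cauchy_convergent convergentD by blast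
  have "cmod (x k - l) \<le> 2 * C * (1/2) ^ k" for k
  proof -
    have "(\<lambda>m. cmod (x m - x k)) \<longlonglongrightarrow> cmod (l - x k)" by (intro tendsto_intros l)
    then have "cmod (l - x k) \<le> 2 * C * (1/2) ^ k"
      by (rule LIMSEQ_le_const2) (auto intro!: exI[of _ k] le)
    then show ?thesis by (simp add: norm_minus_commute)
  qed
  with l show ?thesis by (rule that)
qed

text \<open>What the flow needs from the vector field. The boundary condition is used only in this
form, in the interior of the disc.\<close>

locale inward_field =
  fixes G :: "complex \<Rightarrow> complex" and M K c \<rho>\<^sub>0 :: real
  assumes holo: "G holomorphic_on unit_disc"
    and M: "0 < M" "\<And>z. z \<in> unit_disc \<Longrightarrow> cmod (G z) \<le> M"
    and K: "0 \<le> K" "\<And>z. z \<in> unit_disc \<Longrightarrow> Re (deriv G z) \<le> K"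
    and c: "0 < c" and \<rho>\<^sub>0: "0 < \<rho>\<^sub>0" "\<rho>\<^sub>0 < 1"
    and inward: "\<And>z. z \<in> unit_disc \<Longrightarrow> \<rho>\<^sub>0 \<le> cmod z \<Longrightarrow> Re (cnj z * G z) \<le> - c"
begin

definition \<rho>\<^sub>1 :: real where "\<rho>\<^sub>1 = (1 + \<rho>\<^sub>0) / 2"

text \<open>Step sizes up to this bound keep an Euler step stable: the quadratic term \<open>h\<^sup>2|G|\<^sup>2\<close> uses
up at most half of the inward drift, the bound \<open>|z| - c h / 2\<close> stays nonnegative in the
annulus, and points of the disc of radius \<open>\<rho>\<^sub>0\<close> stay in the disc of radius \<open>\<rho>\<^sub>1\<close>.\<close>

definition h\<^sub>0 :: real where "h\<^sub>0 = min (min (c / M\<^sup>2) (2 * \<rho>\<^sub>0 / c)) ((1 - \<rho>\<^sub>0) / (2 * M))"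

lemma \<rho>\<^sub>1: "0 < \<rho>\<^sub>1" "\<rho>\<^sub>1 < 1" "\<rho>\<^sub>0 \<le> \<rho>\<^sub>1"
  using \<rho>\<^sub>0 by (auto simp: \<rho>\<^sub>1_def)

lemma h\<^sub>0: "0 < h\<^sub>0" "h\<^sub>0 * M\<^sup>2 \<le> c" "h\<^sub>0 * c \<le> 2 * \<rho>\<^sub>0" "h\<^sub>0 * M \<le> (1 - \<rho>\<^sub>0) / 2"
proof -
  show "0 < h\<^sub>0" using c M \<rho>\<^sub>0 by (simp add: h\<^sub>0_def)
  have "h\<^sub>0 \<le> c / M\<^sup>2" "h\<^sub>0 \<le> 2 * \<rho>\<^sub>0 / c" "h\<^sub>0 \<le> (1 - \<rho>\<^sub>0) / (2 * M)" by (simp_all add: h\<^sub>0_def)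
  then show "h\<^sub>0 * M\<^sup>2 \<le> c" "h\<^sub>0 * c \<le> 2 * \<rho>\<^sub>0" "h\<^sub>0 * M \<le> (1 - \<rho>\<^sub>0) / 2"
    using c M by (simp_all add: field_simps)
qed

definition euler :: "real \<Rightarrow> complex \<Rightarrow> complex" where
  "euler h z = z + of_real h * G z"

text \<open>In the annulus \<open>|z + h G|\<^sup>2 = |z|\<^sup>2 + 2 h Re (cnj z G) + h\<^sup>2 |G|\<^sup>2 \<le> |z|\<^sup>2 - c h\<close>.
Besides invariance of the discs this yields the drift towards the origin, from which the
compact image of the flow comes.\<close>

lemma euler_step:
  assumes z: "z \<in> unit_disc" and h: "0 \<le> h" "h \<le> h\<^sub>0"
  shows "cmod (euler h z) \<le> max \<rho>\<^sub>1 (cmod z - c / 2 * h)"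
proof (cases "\<rho>\<^sub>0 \<le> cmod z")
  case True
  have "(cmod (euler h z))\<^sup>2 = (cmod z)\<^sup>2 + 2 * h * Re (cnj z * G z) + h\<^sup>2 * (cmod (G z))\<^sup>2"
    unfolding euler_def cmod_power2 by (simp add: power2_eq_square algebra_simps)
  also have "\<dots> \<le> (cmod z)\<^sup>2 + 2 * h * (- c) + h\<^sup>2 * M\<^sup>2"
    using h inward[OF z True] M(2)[OF z]
    by (intro add_mono mult_left_mono power_mono) auto
  also have "h\<^sup>2 * M\<^sup>2 \<le> h * c"
    using h mult_left_mono[OF order_trans[OF mult_right_mono[OF h(2), of "M\<^sup>2"] h\<^sub>0(2)], of h]
    by (simp add: power2_eq_square mult_ac)
  also have "(cmod z)\<^sup>2 + 2 * h * (- c) + h * c \<le> (cmod z - c / 2 * h)\<^sup>2"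
  proof -
    have "c * h * cmod z \<le> c * h" using z h c by (simp add: mult_left_le)
    moreover have "0 \<le> (c / 2 * h)\<^sup>2" by simp
    moreover have "(cmod z - c / 2 * h)\<^sup>2 = (cmod z)\<^sup>2 - c * h * cmod z + (c / 2 * h)\<^sup>2"
      "2 * h * (- c) + h * c = - (c * h)"
      by (simp_all add: power2_eq_square algebra_simps)
    ultimately show ?thesis by linarith
  qed
  finally have "(cmod (euler h z))\<^sup>2 \<le> (cmod z - c / 2 * h)\<^sup>2" by simp
  moreover have "0 \<le> cmod z - c / 2 * h"
  proof -
    have "h * c \<le> h\<^sub>0 * c" using h c by (intro mult_right_mono) auto
    with h\<^sub>0(3) have "h * c \<le> 2 * \<rho>\<^sub>0" by linarith
    moreover have "c / 2 * h = (h * c) / 2" by simp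
    ultimately show ?thesis using True by linarith
  qed
  ultimately show ?thesis
    using power2_le_imp_le by fastforce
next
  case False
  have "cmod (euler h z) \<le> cmod z + h * cmod (G z)"
    unfolding euler_def using h norm_triangle_ineq[of z "of_real h * G z"] by (simp add: norm_mult)
  also have "\<dots> \<le> \<rho>\<^sub>0 + h\<^sub>0 * M"
    using False h M(2)[OF z] by (intro add_mono mult_mono) auto
  also have "\<dots> \<le> \<rho>\<^sub>1" using h\<^sub>0(4) by (simp add: \<rho>\<^sub>1_def)
  finally show ?thesis by simp
qed

lemma euler_iter:
  assumes z: "z \<in> unit_disc" and h: "0 \<le> h" "h \<le> h\<^sub>0"
  shows "cmod ((euler h ^^ n) z) \<le> max \<rho>\<^sub>1 (cmod z - c / 2 * (real n * h))"
proof (induction n)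
  case (Suc n)
  define b where "b = c / 2 * (real n * h)"
  define d where "d = c / 2 * h"
  have bd: "0 \<le> b" "0 \<le> d" "c / 2 * (real (Suc n) * h) = b + d"
    using c h by (simp_all add: b_def d_def algebra_simps)
  have IH: "cmod ((euler h ^^ n) z) \<le> max \<rho>\<^sub>1 (cmod z - b)" using Suc by (simp add: b_def)
  have "max \<rho>\<^sub>1 (cmod z - b) < 1" using z \<rho>\<^sub>1 bd by simp
  then have "(euler h ^^ n) z \<in> unit_disc" using le_less_trans[OF IH] by simp
  from euler_step[OF this h]
  have "cmod ((euler h ^^ Suc n) z) \<le> max \<rho>\<^sub>1 (cmod ((euler h ^^ n) z) - d)" by (simp add: d_def)
  also have "\<dots> \<le> max \<rho>\<^sub>1 (cmod z - c / 2 * (real (Suc n) * h))"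
    unfolding bd(3) using IH bd(1,2) by (simp add: max_def split: if_splits)
  finally show ?case .
qed simp

lemma euler_invariant:
  assumes z: "cmod z \<le> \<rho>" and \<rho>: "\<rho>\<^sub>1 \<le> \<rho>" "\<rho> < 1" and h: "0 \<le> h" "h \<le> h\<^sub>0"
  shows "cmod ((euler h ^^ n) z) \<le> \<rho>"
proof -
  have "0 \<le> c / 2 * (real n * h)" using c h by simp
  then show ?thesis using euler_iter[of z h n] z \<rho> h by (simp add: max_def split: if_splits)
qed

lemma lipschitz_on_cball:
  assumes "\<rho> < 1"
  obtains L where "0 \<le> L" "\<And>z w. cmod z \<le> \<rho> \<Longrightarrow> cmod w \<le> \<rho> \<Longrightarrow> cmod (G z - G w) \<le> L * cmod (z - w)"
proof -
  have sub: "cball 0 \<rho> \<subseteq> unit_disc" using assms by auto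
  have "deriv G holomorphic_on unit_disc" using holo by (intro holomorphic_intros) auto
  then have "compact (deriv G ` cball 0 \<rho>)"
    using sub by (intro compact_continuous_image holomorphic_on_imp_continuous_on)
      (auto elim!: holomorphic_on_subset)
  then have "bounded (deriv G ` cball 0 \<rho>)" by (rule compact_imp_bounded)
  then obtain L where L: "0 < L" "\<forall>z\<in>deriv G ` cball 0 \<rho>. cmod z \<le> L"
    unfolding bounded_pos by blast
  have "cmod (G z - G w) \<le> L * cmod (z - w)" if "cmod z \<le> \<rho>" "cmod w \<le> \<rho>" for z w
  proof (rule field_differentiable_bound[of "cball 0 \<rho>"])
    fix x :: complex assume x: "x \<in> cball 0 \<rho>"
    show "(G has_field_derivative deriv G x) (at x within cball 0 \<rho>)"
      using holomorphic_derivI[OF holo] sub x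
        by (auto intro: DERIV_subset has_field_derivative_at_within)
    show "norm (deriv G x) \<le> L" using L x by blast
  qed (use that in auto)
  with L(1) show ?thesis by (intro that[of L]) auto
qed

text \<open>The mean value theorem on the segment from \<open>w\<close> to \<open>z\<close>. Only the real part of \<open>G'\<close> enters,
so the constant does not depend on the distance to the boundary, in contrast to the Lipschitz
constant.\<close>

lemma one_sided_lipschitz:
  assumes "z \<in> unit_disc" "w \<in> unit_disc"
  shows "Re (cnj (z - w) * (G z - G w)) \<le> K * (cmod (z - w))\<^sup>2"
proof -
  define p where "p = (\<lambda>s::real. w + of_real s * (z - w))"
  have p: "p s \<in> unit_disc" if "0 \<le> s" "s \<le> 1" for s
    using convexD_alt[OF convex_ball assms(2,1) that]
    by (simp add: p_def scaleR_conv_of_real algebra_simps)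
  have "\<exists>s>0. s < 1 \<and> Re (cnj (z - w) * G (p 1)) - Re (cnj (z - w) * G (p 0))
      = (1 - 0) * Re (cnj (z - w) * (deriv G (p s) * (z - w)))"
  proof (rule MVT2)
    fix s :: real assume "0 \<le> s" "s \<le> 1"
    have "(p has_vector_derivative (z - w)) (at s)"
      unfolding p_def has_vector_derivative_def
      by (auto intro!: derivative_eq_intros simp: scaleR_conv_of_real algebra_simps)
    moreover have "(G has_field_derivative deriv G (p s)) (at (p s))"
      using p[OF \<open>0 \<le> s\<close> \<open>s \<le> 1\<close>] holomorphic_derivI[OF holo] by blast
    ultimately have "(G \<circ> p has_vector_derivative (z - w) * deriv G (p s)) (at s)"
      by (rule field_vector_diff_chain_at)
    then have "((\<lambda>s. G (p s)) has_vector_derivative (z - w) * deriv G (p s)) (at s)"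
      by (simp add: o_def)
    then have "((\<lambda>s. cnj (z - w) * G (p s)) has_vector_derivative cnj (z - w) *
        ((z - w) * deriv G (p s))) (at s)"
      by (intro derivative_eq_intros) auto
    from bounded_linear.has_vector_derivative[OF bounded_linear_Re this]
    show "((\<lambda>s. Re (cnj (z - w) * G (p s))) has_real_derivative Re
        (cnj (z - w) * (deriv G (p s) * (z - w)))) (at s)"
      by (simp add: has_real_derivative_iff_has_vector_derivative mult_ac)
  qed auto
  then obtain s where s: "0 < s" "s < 1" and
    "Re (cnj (z - w) * G (p 1)) - Re (cnj (z - w) * G (p 0))
        = Re (cnj (z - w) * (deriv G (p s) * (z - w)))"
    by auto
  then have "Re (cnj (z - w) * (G z - G w)) = Re (cnj (z - w) * (deriv G (p s) * (z - w)))"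
    by (simp add: p_def algebra_simps)
  also have "cnj (z - w) * (deriv G (p s) * (z - w)) = of_real ((cmod (z - w))\<^sup>2) * deriv G (p s)"
    unfolding complex_norm_square by (simp add: mult_ac)
  also have "Re \<dots> = (cmod (z - w))\<^sup>2 * Re (deriv G (p s))"
    by (simp only: Re_complex_of_real times_complex.sel Im_complex_of_real mult_zero_left
        diff_0_right)
  also have "\<dots> \<le> (cmod (z - w))\<^sup>2 * K"
    using K(2)[OF p[of s]] s by (intro mult_left_mono) auto
  finally show ?thesis by (simp add: mult.commute)
qed

lemma euler_lipschitz:
  assumes L: "0 \<le> L" "\<And>z w. cmod z \<le> \<rho> \<Longrightarrow> cmod w \<le> \<rho> \<Longrightarrow> cmod (G z - G w) \<le> L * cmod (z - w)"
    and \<rho>: "\<rho>\<^sub>1 \<le> \<rho>" "\<rho> < 1" and h: "0 \<le> h" "h \<le> h\<^sub>0"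
    and zw: "cmod z \<le> \<rho>" "cmod w \<le> \<rho>"
  shows "cmod ((euler h ^^ n) z - (euler h ^^ n) w) \<le> exp (L * (real n * h)) * cmod (z - w)"
proof -
  have "cmod ((euler h ^^ n) z - (euler h ^^ n) w) \<le> (1 + h * L) ^ n * cmod (z - w)"
  proof (induction n)
    case (Suc n)
    let ?a = "(euler h ^^ n) z" and ?b = "(euler h ^^ n) w"
    have "(euler h ^^ Suc n) z - (euler h ^^ Suc n) w = (?a - ?b) + of_real h * (G ?a - G ?b)"
      by (simp add: euler_def algebra_simps)
    then have "cmod ((euler h ^^ Suc n) z - (euler h ^^ Suc n) w) \<le> cmod (?a - ?b)
        + h * cmod (G ?a - G ?b)"
      using norm_triangle_ineq[of "?a - ?b" "of_real h * (G ?a - G ?b)"] h by (simp add: norm_mult)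
    also have "\<dots> \<le> cmod (?a - ?b) + h * (L * cmod (?a - ?b))"
      using h L euler_invariant[OF _ \<rho> h] zw by (intro add_mono mult_left_mono) auto
    also have "\<dots> = (1 + h * L) * cmod (?a - ?b)" by (simp add: algebra_simps)
    also have "\<dots> \<le> (1 + h * L) * ((1 + h * L) ^ n * cmod (z - w))"
      using Suc h L by (intro mult_left_mono) auto
    finally show ?case by (simp add: mult_ac)
  qed simp
  also have "(1 + h * L) ^ n \<le> exp (h * L) ^ n"
    using exp_ge_add_one_self[of "h * L"] h L by (intro power_mono) auto
  also have "exp (h * L) ^ n = exp (L * (real n * h))"
    by (simp add: exp_of_nat_mult[symmetric] mult_ac)
  finally show ?thesis by (simp add: mult_right_mono)
qed

text \<open>The local Lipschitz constant \<open>L\<close> enters only with the factor \<open>h\<close> and disappears in the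
limit.\<close>

lemma euler_one_sided_lipschitz:
  assumes L: "0 \<le> L" "\<And>z w. cmod z \<le> \<rho> \<Longrightarrow> cmod w \<le> \<rho> \<Longrightarrow> cmod (G z - G w) \<le> L * cmod (z - w)"
    and \<rho>: "\<rho>\<^sub>1 \<le> \<rho>" "\<rho> < 1" and h: "0 \<le> h" "h \<le> h\<^sub>0"
    and zw: "cmod z \<le> \<rho>" "cmod w \<le> \<rho>"
  shows "(cmod ((euler h ^^ n) z - (euler h ^^ n) w))\<^sup>2 \<le> exp ((2 * K + L\<^sup>2 * h) * (real n * h)) *
      (cmod (z - w))\<^sup>2"
proof -
  define q where "q = 1 + 2 * K * h + L\<^sup>2 * h\<^sup>2"
  have q: "0 \<le> q" using K h by (simp add: q_def)
  have "(cmod ((euler h ^^ n) z - (euler h ^^ n) w))\<^sup>2 \<le> q ^ n * (cmod (z - w))\<^sup>2"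
  proof (induction n)
    case (Suc n)
    let ?a = "(euler h ^^ n) z" and ?b = "(euler h ^^ n) w"
    have ab: "cmod ?a \<le> \<rho>" "cmod ?b \<le> \<rho>" using euler_invariant[OF _ \<rho> h] zw by auto
    have "(euler h ^^ Suc n) z - (euler h ^^ Suc n) w = (?a - ?b) + of_real h * (G ?a - G ?b)"
      by (simp add: euler_def algebra_simps)
    moreover have "(cmod (u + of_real h * v))\<^sup>2 = (cmod u)\<^sup>2 + 2 * h * Re (cnj u * v)
        + h\<^sup>2 * (cmod v)\<^sup>2" for u v
      unfolding cmod_power2 by (simp add: power2_eq_square algebra_simps)
    ultimately have "(cmod ((euler h ^^ Suc n) z - (euler h ^^ Suc n) w))\<^sup>2
      = (cmod (?a - ?b))\<^sup>2 + 2 * h * Re (cnj (?a - ?b) * (G ?a - G ?b)) + h\<^sup>2 *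
          (cmod (G ?a - G ?b))\<^sup>2"
      by (simp only:)
    also have "\<dots> \<le> (cmod (?a - ?b))\<^sup>2 + 2 * h * (K * (cmod (?a - ?b))\<^sup>2)
        + h\<^sup>2 * (L * cmod (?a - ?b))\<^sup>2"
      using ab h \<rho> L by (intro add_mono mult_left_mono power_mono one_sided_lipschitz) auto
    also have "\<dots> = q * (cmod (?a - ?b))\<^sup>2" by (simp add: q_def power_mult_distrib algebra_simps)
    also have "\<dots> \<le> q * (q ^ n * (cmod (z - w))\<^sup>2)"
      using Suc q by (intro mult_left_mono) auto
    finally show ?case by (simp add: mult_ac)
  qed simp
  also have "q ^ n \<le> exp (2 * K * h + L\<^sup>2 * h\<^sup>2) ^ n"
    using exp_ge_add_one_self[of "2 * K * h + L\<^sup>2 * h\<^sup>2"] q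
      by (intro power_mono) (auto simp: q_def add.assoc)
  also have "exp (2 * K * h + L\<^sup>2 * h\<^sup>2) ^ n = exp ((2 * K + L\<^sup>2 * h) * (real n * h))"
    by (simp add: exp_of_nat_mult[symmetric] power2_eq_square algebra_simps)
  finally show ?thesis by (simp add: mult_right_mono)
qed

lemma euler_displacement:
  assumes z: "z \<in> unit_disc" and h: "0 \<le> h" "h \<le> h\<^sub>0"
  shows "cmod ((euler h ^^ n) z - z) \<le> M * (real n * h)"
proof (induction n)
  case (Suc n)
  have "(euler h ^^ n) z \<in> unit_disc"
  proof -
    have "max \<rho>\<^sub>1 (cmod z) < 1" using z \<rho>\<^sub>1 by simp
    moreover have "cmod ((euler h ^^ n) z) \<le> max \<rho>\<^sub>1 (cmod z)"
      using calculation by (intro euler_invariant h) auto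
    ultimately show ?thesis by (simp only: mem_ball dist_0_norm)
  qed
  from M(2)[OF this] have "h * cmod (G ((euler h ^^ n) z)) \<le> h * M" using h
    by (intro mult_left_mono) auto
  moreover have "(euler h ^^ Suc n) z - z = ((euler h ^^ n) z - z) + of_real h * G
      ((euler h ^^ n) z)"
    by (simp add: euler_def)
  then have "cmod ((euler h ^^ Suc n) z - z) \<le> cmod ((euler h ^^ n) z - z)
      + h * cmod (G ((euler h ^^ n) z))"
    using norm_triangle_ineq[of "(euler h ^^ n) z - z" "of_real h * G ((euler h ^^ n) z)"] h
    by (simp only: norm_mult norm_of_real abs_of_nonneg)
  ultimately show ?case using Suc by (simp add: algebra_simps)
qed simp

lemma euler_first_order:
  assumes L: "0 \<le> L" "\<And>z w. cmod z \<le> \<rho> \<Longrightarrow> cmod w \<le> \<rho> \<Longrightarrow> cmod (G z - G w) \<le> L * cmod (z - w)"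
    and \<rho>: "\<rho>\<^sub>1 \<le> \<rho>" "\<rho> < 1" and h: "0 \<le> h" "h \<le> h\<^sub>0" and z: "cmod z \<le> \<rho>"
  shows "cmod ((euler h ^^ n) z - z - of_real (real n * h) * G z) \<le> L * M * (real n * h)\<^sup>2"
proof (induction n)
  case (Suc n)
  let ?a = "(euler h ^^ n) z"
  have zd: "z \<in> unit_disc" using z \<rho> by simp
  have "h * cmod (G ?a - G z) \<le> h * (L * (M * (real n * h)))"
    using L(2)[OF euler_invariant[OF z \<rho> h] z] mult_left_mono[OF euler_displacement[OF zd h, of n]
        L(1)] h
    by (intro mult_left_mono) (auto intro: order_trans)
  moreover have "(euler h ^^ Suc n) z - z - of_real (real (Suc n) * h) * G z
      = (?a - z - of_real (real n * h) * G z) + of_real h * (G ?a - G z)"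
    by (simp add: euler_def algebra_simps)
  then have "cmod ((euler h ^^ Suc n) z - z - of_real (real (Suc n) * h) * G z)
     \<le> cmod (?a - z - of_real (real n * h) * G z) + h * cmod (G ?a - G z)"
    using norm_triangle_ineq[of "?a - z - of_real (real n * h) * G z" "of_real h * (G ?a - G z)"] h
    by (simp only: norm_mult norm_of_real abs_of_nonneg)
  ultimately have "cmod ((euler h ^^ Suc n) z - z - of_real (real (Suc n) * h) * G z)
     \<le> L * M * (real n * h)\<^sup>2 + h * (L * (M * (real n * h)))"
    using Suc by linarith
  also have "\<dots> = L * M * h\<^sup>2 * (real n * real n + real n)"
    by (simp add: power2_eq_square algebra_simps)
  also have "\<dots> \<le> L * M * h\<^sup>2 * (real (Suc n) * real (Suc n))"
    using L M by (intro mult_left_mono) (auto simp: algebra_simps)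
  finally show ?case by (simp only: power2_eq_square mult_ac)
qed simp

text \<open>One step of size \<open>2h\<close> and two steps of size \<open>h\<close> differ by
\<open>h |G(z + h G(z)) - G(z)| = O(h\<^sup>2)\<close>; the Lipschitz bound propagates this error over \<open>n\<close> steps.\<close>

lemma euler_halving:
  assumes L: "0 \<le> L" "\<And>z w. cmod z \<le> \<rho> \<Longrightarrow> cmod w \<le> \<rho> \<Longrightarrow> cmod (G z - G w) \<le> L * cmod (z - w)"
    and \<rho>: "\<rho>\<^sub>1 \<le> \<rho>" "\<rho> < 1" and h: "0 \<le> h" "2 * h \<le> h\<^sub>0" and z: "cmod z \<le> \<rho>"
  shows "cmod ((euler h ^^ (2 * n)) z - (euler (2 * h) ^^ n) z)
    \<le> real n * (exp (2 * L * (real n * h)) * (L * M * h\<^sup>2))"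
proof (induction n)
  case (Suc n)
  define E where "E = exp (2 * L * (real n * h))"
  have h': "h \<le> h\<^sub>0" "0 \<le> 2 * h" using h by auto
  let ?a = "(euler h ^^ (2 * n)) z" and ?b = "(euler (2 * h) ^^ n) z"
  have ab: "cmod ?a \<le> \<rho>" "cmod ?b \<le> \<rho>"
    using euler_invariant[OF z \<rho> h(1) h'(1)] euler_invariant[OF z \<rho> h'(2) h(2)] by auto
  have e1: "cmod (euler h ?b) \<le> \<rho>" using euler_invariant[OF ab(2) \<rho> h(1) h'(1), of 1] by simp
  have bd: "?b \<in> unit_disc" using ab \<rho> by simp
  have local: "cmod ((euler h ^^ 2) ?b - euler (2 * h) ?b) \<le> L * M * h\<^sup>2"
  proof -
    have "(euler h ^^ 2) ?b - euler (2 * h) ?b = of_real h * (G (euler h ?b) - G ?b)"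
      by (simp add: euler_def eval_nat_numeral algebra_simps)
    then have "cmod ((euler h ^^ 2) ?b - euler (2 * h) ?b) = h * cmod (G (euler h ?b) - G ?b)"
      using h by (simp add: norm_mult)
    also have "\<dots> \<le> h * (L * cmod (euler h ?b - ?b))"
      using h by (intro mult_left_mono L e1 ab) auto
    also have "\<dots> \<le> h * (L * (M * h))"
      using euler_displacement[OF bd h(1) h'(1), of 1] h L by (intro mult_left_mono) auto
    finally show ?thesis by (simp add: power2_eq_square mult_ac)
  qed
  have "cmod ((euler h ^^ (2 * Suc n)) z - (euler (2 * h) ^^ Suc n) z)
      = cmod (((euler h ^^ 2) ?a - (euler h ^^ 2) ?b) + ((euler h ^^ 2) ?b - euler (2 * h) ?b))"
    by (simp add: eval_nat_numeral)
  also have "\<dots> \<le> exp (L * (real 2 * h)) * cmod (?a - ?b) + L * M * h\<^sup>2"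
    using euler_lipschitz[OF L \<rho> h(1) h'(1) ab, of 2] local
    by (intro norm_triangle_le add_mono)
  also have "\<dots> \<le> exp (L * (real 2 * h)) * (real n * (E * (L * M * h\<^sup>2))) + exp (L * (real 2 * h))
      * E * (L * M * h\<^sup>2)"
  proof (intro add_mono mult_left_mono)
    show "cmod (?a - ?b) \<le> real n * (E * (L * M * h\<^sup>2))" using Suc by (simp add: E_def)
    have "1 \<le> exp (L * (real 2 * h)) * E" unfolding E_def exp_add[symmetric]
      using L h by simp
    then show "L * M * h\<^sup>2 \<le> exp (L * (real 2 * h)) * E * (L * M * h\<^sup>2)"
      using L M mult_right_mono[of 1 "exp (L * (real 2 * h)) * E" "L * M * h\<^sup>2"] by simp
  qed simp
  also have "\<dots> = real (Suc n) * ((exp (L * (real 2 * h)) * E) * (L * M * h\<^sup>2))"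
    by (simp add: algebra_simps)
  also have "exp (L * (real 2 * h)) * E = exp (2 * L * (real (Suc n) * h))"
    unfolding E_def exp_add[symmetric] by (simp add: algebra_simps)
  finally show ?case .
qed simp

end

section \<open>The flow\<close>

context inward_field
begin

definition step :: "nat \<Rightarrow> real" where "step k = h\<^sub>0 * (1/2) ^ k"

text \<open>The number of complete steps up to time \<open>t\<close>. Rounding down loses less than one step,
which vanishes in the limit, and avoids a restriction to dyadic times.\<close>

definition steps :: "nat \<Rightarrow> real \<Rightarrow> nat" where "steps k t = nat \<lfloor>t / step k\<rfloor>"

definition polygon :: "nat \<Rightarrow> real \<Rightarrow> complex \<Rightarrow> complex" where
  "polygon k t = euler (step k) ^^ steps k t"

definition flow :: "real \<Rightarrow> complex \<Rightarrow> complex" where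
  "flow t z = lim (\<lambda>k. polygon k t z)"

lemma step: "0 < step k" "step k \<le> h\<^sub>0" "2 * step (Suc k) = step k" "step \<longlonglongrightarrow> 0"
proof -
  show "0 < step k" "2 * step (Suc k) = step k" using h\<^sub>0 by (auto simp: step_def)
  show "step k \<le> h\<^sub>0" using h\<^sub>0 mult_left_le[of "(1/2)^k" h\<^sub>0] by (simp add: step_def power_le_one)
  show "step \<longlonglongrightarrow> 0" unfolding step_def by real_asymp
qed

lemma step_nonneg: "0 \<le> step k" using step(1)[of k] by simp

lemma steps_le: "0 \<le> t \<Longrightarrow> real (steps k t) * step k \<le> t"
  "0 \<le> t \<Longrightarrow> t - step k < real (steps k t) * step k"
proof -
  assume t: "0 \<le> t"
  define x where "x = t / step k"
  have xt: "x * step k = t" using step(1)[of k] by (simp add: x_def)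
  have r: "real (steps k t) = of_int \<lfloor>x\<rfloor>"
    using t step_nonneg[of k] by (simp add: steps_def x_def)
  have "of_int \<lfloor>x\<rfloor> * step k \<le> x * step k"
    using step_nonneg by (intro mult_right_mono) auto
  then show "real (steps k t) * step k \<le> t" unfolding r xt .
  have "(x - 1) * step k < of_int \<lfloor>x\<rfloor> * step k"
    using step(1)[of k] by (intro mult_strict_right_mono) linarith+
  then show "t - step k < real (steps k t) * step k" unfolding r left_diff_distrib xt by simp
qed

lemma steps_tendsto: "0 \<le> t \<Longrightarrow> (\<lambda>k. real (steps k t) * step k) \<longlonglongrightarrow> t"
proof (rule tendsto_sandwich)
  show "(\<lambda>k. t - step k) \<longlonglongrightarrow> t" using tendsto_diff[OF tendsto_const step(4), of t] by simp
  show "(\<lambda>k. t) \<longlonglongrightarrow> t" by simp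
  show "\<forall>\<^sub>F k in sequentially. t - step k \<le> real (steps k t) * step k" if "0 \<le> t"
    using steps_le(2)[OF that] by (intro always_eventually allI less_imp_le)
  show "\<forall>\<^sub>F k in sequentially. real (steps k t) * step k \<le> t" if "0 \<le> t"
    using steps_le(1)[OF that] by (intro always_eventually allI)
qed

lemma steps_add:
  assumes "0 \<le> s" "0 \<le> t"
  shows "steps k (s + t) = steps k s + steps k t \<or> steps k (s + t) = Suc (steps k s + steps k t)"
proof -
  have nn: "0 \<le> s / step k" "0 \<le> t / step k" using assms step_nonneg[of k] by simp_all
  have "\<lfloor>s / step k + t / step k\<rfloor> = \<lfloor>s / step k\<rfloor> + \<lfloor>t / step k\<rfloor> \<or> \<lfloor>s / step k + t / step k\<rfloor>
      = \<lfloor>s / step k\<rfloor> + \<lfloor>t / step k\<rfloor> + 1"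
    by (simp add: floor_add)
  then show ?thesis unfolding steps_def add_divide_distrib using nn
    by (auto simp: nat_add_distrib)
qed

lemma steps_Suc:
  assumes "0 \<le> t"
  shows "steps (Suc k) t = 2 * steps k t \<or> steps (Suc k) t = Suc (2 * steps k t)"
proof -
  have "t / step (Suc k) = (t + t) / step k" using step(3)[of k, symmetric] by simp
  then show ?thesis
    using steps_add[OF assms assms, of k] unfolding steps_def by (simp only: mult_2)
qed

lemma euler_close:
  assumes z: "z \<in> unit_disc" and m: "m = n \<or> m = Suc n"
  shows "cmod ((euler (step k) ^^ m) z - (euler (step k) ^^ n) z) \<le> M * step k"
proof (cases "m = n")
  case True
  then show ?thesis using M step_nonneg[of k] by simp
next
  case False
  have "(euler (step k) ^^ n) z \<in> unit_disc"
  proof -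
    have "max \<rho>\<^sub>1 (cmod z) < 1" using z \<rho>\<^sub>1 by simp
    moreover have "cmod ((euler (step k) ^^ n) z) \<le> max \<rho>\<^sub>1 (cmod z)"
      using calculation by (intro euler_invariant step step_nonneg) auto
    ultimately show ?thesis by (simp only: mem_ball dist_0_norm)
  qed
  from M(2)[OF this] have "step k * cmod (G ((euler (step k) ^^ n) z)) \<le> step k * M"
    using step_nonneg[of k] by (intro mult_left_mono)
  with False m show ?thesis using step_nonneg[of k] by (simp add: euler_def norm_mult mult.commute)
qed

lemma polygon_invariant:
  "cmod z \<le> \<rho> \<Longrightarrow> \<rho>\<^sub>1 \<le> \<rho> \<Longrightarrow> \<rho> < 1 \<Longrightarrow> cmod (polygon k t z) \<le> \<rho>"
  unfolding polygon_def by (rule euler_invariant) (auto simp: step step_nonneg)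

text \<open>Consecutive polygons differ by the halving error and at most one additional step, both of
order \<open>2\<^sup>-\<^sup>k\<close>.\<close>

lemma polygon_converges:
  assumes \<rho>: "\<rho>\<^sub>1 \<le> \<rho>" "\<rho> < 1" and t: "0 \<le> t"
  obtains C where "\<And>k z. cmod z \<le> \<rho> \<Longrightarrow> cmod (polygon k t z - flow t z) \<le> C * (1/2) ^ k"
    "\<And>z. cmod z \<le> \<rho> \<Longrightarrow> (\<lambda>k. polygon k t z) \<longlonglongrightarrow> flow t z"
proof -
  obtain L where L: "0 \<le> L" "\<And>z w. cmod z \<le> \<rho> \<Longrightarrow> cmod w \<le> \<rho> \<Longrightarrow> cmod (G z - G w) \<le> L * cmod (z - w)"
    using lipschitz_on_cball[OF \<rho>(2)] by blast
  \<comment> \<open>The summand \<open>M\<close> pays for the possible extra step, the other one for halving \<open>t / h\<close> steps.\<close>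
  define C where "C = h\<^sub>0 * (M + t * (exp (L * t) * (L * M)))"
  have *: "cmod (polygon (Suc k) t z - polygon k t z) \<le> C * (1/2) ^ k" if z: "cmod z \<le> \<rho>" for k z
  proof -
    let ?h = "step (Suc k)" and ?n = "steps k t"
    have h: "0 \<le> ?h" "2 * ?h \<le> h\<^sub>0" using step_nonneg[of "Suc k"] step(2,3)[of k] by auto
    have nh: "real ?n * (2 * ?h) \<le> t" using steps_le(1)[OF t, of k] by (simp add: step(3))
    have zd: "z \<in> unit_disc" using z \<rho> by simp
    have "cmod (polygon (Suc k) t z - (euler ?h ^^ (2 * ?n)) z) \<le> M * ?h"
      unfolding polygon_def by (rule euler_close[OF zd steps_Suc[OF t]])
    moreover have "cmod ((euler ?h ^^ (2 * ?n)) z - polygon k t z)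
       \<le> real ?n * (exp (2 * L * (real ?n * ?h)) * (L * M * ?h\<^sup>2))"
      using euler_halving[OF L \<rho> h z, of ?n] unfolding polygon_def step(3) .
    moreover have "real ?n * (exp (2 * L * (real ?n * ?h)) * (L * M * ?h\<^sup>2))
        \<le> ?h * (t * (exp (L * t) * (L * M)))"
    proof -
      have "real ?n * (exp (2 * L * (real ?n * ?h)) * (L * M * ?h\<^sup>2))
         = ?h * ((real ?n * ?h) * (exp (L * (real ?n * (2 * ?h))) * (L * M)))"
        by (simp add: power2_eq_square mult_ac)
      also have "\<dots> \<le> ?h * (t * (exp (L * t) * (L * M)))"
      proof (rule mult_left_mono[OF mult_mono])
        show "real ?n * ?h \<le> t"
        proof -
          have "0 \<le> real ?n * ?h" using h by simp
          with nh show ?thesis by (simp add: mult.left_commute)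
        qed
        have "exp (L * (real ?n * (2 * ?h))) \<le> exp (L * t)" using mult_left_mono[OF nh L(1)] by simp
        then show "exp (L * (real ?n * (2 * ?h))) * (L * M) \<le> exp (L * t) * (L * M)"
          using L M by (intro mult_right_mono) auto
      qed (use h L M t in auto)
      finally show ?thesis .
    qed
    ultimately have "cmod (polygon (Suc k) t z - polygon k t z)
        \<le> M * ?h + ?h * (t * (exp (L * t) * (L * M)))"
      using norm_triangle_ineq[of "polygon (Suc k) t z - (euler ?h ^^ (2 * ?n)) z"
          "(euler ?h ^^ (2 * ?n)) z - polygon k t z"]
      by simp
    also have "\<dots> = ?h * (M + t * (exp (L * t) * (L * M)))" by (simp add: algebra_simps)
    also have "\<dots> \<le> step k * (M + t * (exp (L * t) * (L * M)))"
      using step(3)[of k] h L M t by (intro mult_right_mono) auto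
    finally show ?thesis by (simp add: C_def step_def mult_ac)
  qed
  have lim: "(\<lambda>k. polygon k t z) \<longlonglongrightarrow> flow t z \<and> (\<forall>k. cmod (polygon k t z - flow t z)
      \<le> 2 * C * (1/2) ^ k)"
    if z: "cmod z \<le> \<rho>" for z
  proof -
    obtain l where l: "(\<lambda>k. polygon k t z) \<longlonglongrightarrow> l" "\<And>k. cmod (polygon k t z - l) \<le> 2 * C * (1/2) ^ k"
      by (rule geometric_Cauchy_limit[OF *[OF z]]) (rule that)
    moreover have "flow t z = l" unfolding flow_def using l(1) by (rule limI)
    ultimately show ?thesis by simp
  qed
  show ?thesis
  proof (rule that[of "2 * C"])
    show "cmod (polygon k t z - flow t z) \<le> 2 * C * (1/2) ^ k" if "cmod z \<le> \<rho>" for k z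
      using lim[OF that] by blast
    show "(\<lambda>k. polygon k t z) \<longlonglongrightarrow> flow t z" if "cmod z \<le> \<rho>" for z
      using lim[OF that] by blast
  qed
qed

lemma polygon_tendsto:
  assumes "z \<in> unit_disc" "0 \<le> t"
  shows "(\<lambda>k. polygon k t z) \<longlonglongrightarrow> flow t z"
proof (rule polygon_converges[of "max \<rho>\<^sub>1 (cmod z)" t])
  show "max \<rho>\<^sub>1 (cmod z) < 1" using assms \<rho>\<^sub>1 by simp
qed (use assms in auto)

lemma flow_inward:
  assumes "z \<in> unit_disc" "0 \<le> t"
  shows "cmod (flow t z) \<le> max \<rho>\<^sub>1 (cmod z - c / 2 * t)"
proof (rule LIMSEQ_le)
  show "(\<lambda>k. cmod (polygon k t z)) \<longlonglongrightarrow> cmod (flow t z)"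
    by (intro tendsto_intros polygon_tendsto assms)
  show "(\<lambda>k. max \<rho>\<^sub>1 (cmod z - c / 2 * (real (steps k t) * step k))) \<longlonglongrightarrow> max \<rho>\<^sub>1 (cmod z - c / 2 * t)"
    by (intro tendsto_intros steps_tendsto assms)
  show "\<exists>N. \<forall>k\<ge>N. cmod (polygon k t z) \<le> max \<rho>\<^sub>1 (cmod z - c / 2 * (real (steps k t) * step k))"
    unfolding polygon_def using euler_iter[OF assms(1) step_nonneg step(2)] by auto
qed

lemma flow_invariant:
  assumes "cmod z \<le> \<rho>" "\<rho>\<^sub>1 \<le> \<rho>" "\<rho> < 1" "0 \<le> t"
  shows "cmod (flow t z) \<le> \<rho>"
proof -
  have "0 \<le> c / 2 * t" using c assms by simp
  then have "max \<rho>\<^sub>1 (cmod z - c / 2 * t) \<le> \<rho>" using assms by simp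
  moreover have "cmod (flow t z) \<le> max \<rho>\<^sub>1 (cmod z - c / 2 * t)" using assms
    by (intro flow_inward) auto
  ultimately show ?thesis by linarith
qed

lemma flow_in_disc:
  assumes "z \<in> unit_disc" "0 \<le> t"
  shows "flow t z \<in> unit_disc"
proof -
  have "max \<rho>\<^sub>1 (cmod z) < 1" using assms \<rho>\<^sub>1 by simp
  moreover have "cmod (flow t z) \<le> max \<rho>\<^sub>1 (cmod z)"
    using calculation assms by (intro flow_invariant) auto
  ultimately show ?thesis by (simp only: mem_ball dist_0_norm)
qed

text \<open>For \<open>t > 0\<close> this is a bound below one that does not depend on \<open>z\<close>.\<close>

lemma flow_compact_image:
  assumes "z \<in> unit_disc" "0 \<le> t"
  shows "cmod (flow t z) \<le> max \<rho>\<^sub>1 (1 - c / 2 * t)"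
  using flow_inward[OF assms] assms(1) by (simp add: max_def split: if_splits)

lemma flow_0: "z \<in> unit_disc \<Longrightarrow> flow 0 z = z"
  using polygon_tendsto[of z 0] by (simp add: polygon_def steps_def LIMSEQ_const_iff)

lemma flow_displacement:
  assumes "z \<in> unit_disc" "0 \<le> t"
  shows "cmod (flow t z - z) \<le> M * t"
proof (rule LIMSEQ_le)
  show "(\<lambda>k. cmod (polygon k t z - z)) \<longlonglongrightarrow> cmod (flow t z - z)"
    by (intro tendsto_intros polygon_tendsto assms)
  show "(\<lambda>k. M * (real (steps k t) * step k)) \<longlonglongrightarrow> M * t"
    by (intro tendsto_intros steps_tendsto assms)
  show "\<exists>N. \<forall>k\<ge>N. cmod (polygon k t z - z) \<le> M * (real (steps k t) * step k)"
    unfolding polygon_def using euler_displacement[OF assms(1) step_nonneg step(2)] by auto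
qed

text \<open>The initial velocity of the flow is \<open>G\<close>, with an error that is uniform on compact sets.
Together with the semigroup law this replaces the differential equation.\<close>

lemma flow_first_order:
  assumes \<rho>: "\<rho>\<^sub>1 \<le> \<rho>" "\<rho> < 1"
  obtains C where "0 \<le> C"
    "\<And>z t. cmod z \<le> \<rho> \<Longrightarrow> 0 \<le> t \<Longrightarrow> cmod (flow t z - z - of_real t * G z) \<le> C * t\<^sup>2"
proof -
  obtain L where L: "0 \<le> L" "\<And>z w. cmod z \<le> \<rho> \<Longrightarrow> cmod w \<le> \<rho> \<Longrightarrow> cmod (G z - G w) \<le> L * cmod (z - w)"
    using lipschitz_on_cball[OF \<rho>(2)] by blast
  have "cmod (flow t z - z - of_real t * G z) \<le> L * M * t\<^sup>2" if z: "cmod z \<le> \<rho>" and t: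
      "0 \<le> t" for z t
  proof (rule LIMSEQ_le)
    show "(\<lambda>k. cmod (polygon k t z - z - of_real (real (steps k t) * step k) * G z)) \<longlonglongrightarrow> cmod
        (flow t z - z - of_real t * G z)"
      using z \<rho> t by (intro tendsto_intros polygon_tendsto steps_tendsto) auto
    show "(\<lambda>k. L * M * (real (steps k t) * step k)\<^sup>2) \<longlonglongrightarrow> L * M * t\<^sup>2"
      using t by (intro tendsto_intros steps_tendsto)
    show "\<exists>N. \<forall>k\<ge>N. cmod (polygon k t z - z - of_real (real (steps k t) * step k) * G z)
        \<le> L * M * (real (steps k t) * step k)\<^sup>2"
      unfolding polygon_def using euler_first_order[OF L \<rho> step_nonneg step(2) z] by blast
  qed
  with L M show ?thesis by (intro that[of "L * M"]) auto
qed

lemma flow_lipschitz: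
  assumes zw: "z \<in> unit_disc" "w \<in> unit_disc" and t: "0 \<le> t"
  shows "cmod (flow t z - flow t w) \<le> exp (K * t) * cmod (z - w)"
proof -
  define \<rho> where "\<rho> = max \<rho>\<^sub>1 (max (cmod z) (cmod w))"
  have \<rho>: "\<rho>\<^sub>1 \<le> \<rho>" "\<rho> < 1" and z: "cmod z \<le> \<rho>" and w: "cmod w \<le> \<rho>"
    using zw \<rho>\<^sub>1 by (auto simp: \<rho>_def)
  obtain L where L: "0 \<le> L" "\<And>z w. cmod z \<le> \<rho> \<Longrightarrow> cmod w \<le> \<rho> \<Longrightarrow> cmod (G z - G w) \<le> L * cmod (z - w)"
    using lipschitz_on_cball[OF \<rho>(2)] by blast
  have "(cmod (flow t z - flow t w))\<^sup>2 \<le> exp ((2 * K + L\<^sup>2 * 0) * t) * (cmod (z - w))\<^sup>2"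
  proof (rule LIMSEQ_le)
    show "(\<lambda>k. (cmod (polygon k t z - polygon k t w))\<^sup>2) \<longlonglongrightarrow> (cmod (flow t z - flow t w))\<^sup>2"
      by (intro tendsto_intros polygon_tendsto zw t)
    show "(\<lambda>k. exp ((2 * K + L\<^sup>2 * step k) * (real (steps k t) * step k)) * (cmod (z - w))\<^sup>2)
       \<longlonglongrightarrow> exp ((2 * K + L\<^sup>2 * 0) * t) * (cmod (z - w))\<^sup>2"
      by (intro tendsto_intros step steps_tendsto t)
    show "\<exists>N. \<forall>k\<ge>N. (cmod (polygon k t z - polygon k t w))\<^sup>2
        \<le> exp ((2 * K + L\<^sup>2 * step k) * (real (steps k t) * step k)) * (cmod (z - w))\<^sup>2"
      unfolding polygon_def using euler_one_sided_lipschitz[OF L \<rho> step_nonneg step(2) z w] by blast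
  qed
  also have "\<dots> = (exp (K * t) * cmod (z - w))\<^sup>2"
    by (simp add: power_mult_distrib exp_double[symmetric] mult_ac)
  finally show ?thesis by (rule power2_le_imp_le) simp
qed

text \<open>Euler polygons satisfy the semigroup law up to one step, because rounding is additive up
to one.\<close>

lemma flow_add:
  assumes z: "z \<in> unit_disc" and s: "0 \<le> s" and t: "0 \<le> t"
  shows "flow (s + t) z = flow s (flow t z)"
proof -
  define \<rho> where "\<rho> = max \<rho>\<^sub>1 (cmod z)"
  have \<rho>: "\<rho>\<^sub>1 \<le> \<rho>" "\<rho> < 1" and z': "cmod z \<le> \<rho>"
    using z \<rho>\<^sub>1 by (auto simp: \<rho>_def)
  obtain L where L: "0 \<le> L" "\<And>z w. cmod z \<le> \<rho> \<Longrightarrow> cmod w \<le> \<rho> \<Longrightarrow> cmod (G z - G w) \<le> L * cmod (z - w)"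
    using lipschitz_on_cball[OF \<rho>(2)] by blast
  let ?D = "\<lambda>k. polygon k (s + t) z - polygon k s (polygon k t z)"
  let ?F = "\<lambda>k. polygon k s (polygon k t z) - polygon k s (flow t z)"
  have "?D \<longlonglongrightarrow> 0"
  proof (rule Lim_null_comparison)
    show "\<forall>\<^sub>F k in sequentially. norm (?D k) \<le> M * step k"
      using euler_close[OF z steps_add[OF s t]] by (auto simp: polygon_def funpow_add)
    show "(\<lambda>k. M * step k) \<longlonglongrightarrow> 0" using tendsto_mult_right_zero[OF step(4)] .
  qed
  moreover have "?F \<longlonglongrightarrow> 0"
  proof (rule Lim_null_comparison)
    have "norm (?F k) \<le> exp (L * s) * cmod (polygon k t z - flow t z)" for k
    proof -
      have "norm (?F k) \<le> exp (L * (real (steps k s) * step k)) * cmod (polygon k t z - flow t z)"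
        unfolding polygon_def[of k s]
        using euler_lipschitz[OF L \<rho> step_nonneg step(2) polygon_invariant[OF z' \<rho>]
            flow_invariant[OF z' \<rho> t]] by blast
      also have "\<dots> \<le> exp (L * s) * cmod (polygon k t z - flow t z)"
        using steps_le(1)[OF s] L by (intro mult_right_mono) (auto intro: mult_left_mono)
      finally show ?thesis .
    qed
    then show "\<forall>\<^sub>F k in sequentially. norm (?F k) \<le> exp (L * s) * cmod (polygon k t z - flow t z)"
      by simp
    have "(\<lambda>k. exp (L * s) * cmod (polygon k t z - flow t z)) \<longlonglongrightarrow> exp (L * s) * cmod
        (flow t z - flow t z)"
      by (intro tendsto_intros polygon_tendsto z t)
    then show "(\<lambda>k. exp (L * s) * cmod (polygon k t z - flow t z)) \<longlonglongrightarrow> 0" by simp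
  qed
  moreover have "(\<lambda>k. polygon k s (flow t z)) \<longlonglongrightarrow> flow s (flow t z)"
    by (intro polygon_tendsto flow_in_disc z s t)
  ultimately have "(\<lambda>k. ?D k + ?F k + polygon k s (flow t z)) \<longlonglongrightarrow> 0 + 0 + flow s (flow t z)"
    by (intro tendsto_add)
  moreover have "(\<lambda>k. ?D k + ?F k + polygon k s (flow t z)) = (\<lambda>k. polygon k (s + t) z)" by auto
  ultimately have "(\<lambda>k. polygon k (s + t) z) \<longlonglongrightarrow> flow s (flow t z)" by simp
  moreover have "(\<lambda>k. polygon k (s + t) z) \<longlonglongrightarrow> flow (s + t) z"
    by (intro polygon_tendsto z) (use s t in simp)
  ultimately show ?thesis by (rule LIMSEQ_unique[symmetric])
qed

lemma polygon_holomorphic: "polygon k t holomorphic_on unit_disc"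
proof -
  have "(euler (step k) ^^ n) holomorphic_on unit_disc \<and> (euler (step k) ^^ n) ` unit_disc \<subseteq>
      unit_disc" for n
  proof (induction n)
    case (Suc n)
    have *: "euler (step k) holomorphic_on unit_disc"
      unfolding euler_def by (intro holomorphic_intros holo)
    have "euler (step k) ` unit_disc \<subseteq> unit_disc"
    proof safe
      fix z :: complex assume "z \<in> unit_disc"
      then have "max \<rho>\<^sub>1 (cmod z) < 1" using \<rho>\<^sub>1 by simp
      moreover have "cmod ((euler (step k) ^^ 1) z) \<le> max \<rho>\<^sub>1 (cmod z)"
        using calculation by (intro euler_invariant step step_nonneg) auto
      then have "cmod (euler (step k) z) \<le> max \<rho>\<^sub>1 (cmod z)" by simp
      ultimately show "euler (step k) z \<in> unit_disc"
        by (simp only: mem_ball dist_0_norm)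
    qed
    then have "(euler (step k) ^^ Suc n) ` unit_disc \<subseteq> unit_disc"
      using conjunct2[OF Suc] by fastforce
    moreover have "(euler (step k) \<circ> (euler (step k) ^^ n)) holomorphic_on unit_disc"
      using holomorphic_on_compose_gen[OF conjunct1[OF Suc] * conjunct2[OF Suc]] .
    ultimately show ?case by (simp only: funpow.simps simp_thms)
  qed (auto simp: id_def)
  then show ?thesis by (simp add: polygon_def)
qed

lemma flow_holomorphic:
  assumes t: "0 \<le> t"
  shows "flow t holomorphic_on unit_disc"
proof (rule holomorphic_uniform_sequence[of _ "\<lambda>k. polygon k t"])
  fix z :: complex assume "z \<in> unit_disc"
  then obtain d where d: "0 < d" "cball z d \<subseteq> unit_disc"
    using open_contains_cball[of unit_disc] by blast
  define \<rho> where "\<rho> = max \<rho>\<^sub>1 (cmod z + d)"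
  have "cmod z + d < 1"
  proof (cases "z = 0")
    case True
    then have "of_real d \<in> cball z d" using d by simp
    with d have "complex_of_real d \<in> unit_disc" by blast
    then show ?thesis using True d by simp
  next
    case False
    have "z + of_real (d / cmod z) * z \<in> cball z d" using False d
      by (simp add: dist_norm norm_mult norm_divide)
    with d have "z + of_real (d / cmod z) * z \<in> unit_disc" by blast
    moreover have "z + of_real (d / cmod z) * z = of_real (1 + d / cmod z) * z"
      by (simp add: algebra_simps)
    ultimately have "cmod (of_real (1 + d / cmod z)) * cmod z < 1"
      by (simp only: mem_ball dist_0_norm norm_mult)
    moreover have "cmod (of_real (1 + d / cmod z)) * cmod z = cmod z + d"
      unfolding norm_of_real using False d by (simp add: field_simps)
    ultimately show ?thesis by simp
  qed
  then have \<rho>: "\<rho>\<^sub>1 \<le> \<rho>" "\<rho> < 1" using \<rho>\<^sub>1 by (auto simp: \<rho>_def)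
  have sub: "cmod x \<le> \<rho>" if "x \<in> cball z d" for x
    using that norm_triangle_ineq2[of x z] by (simp add: \<rho>_def dist_norm norm_minus_commute)
  obtain C where C: "\<And>k z. cmod z \<le> \<rho> \<Longrightarrow> cmod (polygon k t z - flow t z) \<le> C * (1/2) ^ k"
    by (rule polygon_converges[OF \<rho> t]) (rule that)
  have "uniform_limit (cball z d) (\<lambda>k. polygon k t) (flow t) sequentially"
  proof (rule uniform_limitI)
    fix e :: real assume "0 < e"
    have "(\<lambda>k. C * (1/2) ^ k) \<longlonglongrightarrow> 0" by real_asymp
    from order_tendstoD(2)[OF this \<open>0 < e\<close>]
    show "\<forall>\<^sub>F k in sequentially. \<forall>x\<in>cball z d. dist (polygon k t x) (flow t x) < e"
    proof eventually_elim
      case (elim k)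
      show ?case
        unfolding dist_norm by (intro ballI le_less_trans[OF C[OF sub] elim])
    qed
  qed
  with d show "\<exists>d>0. cball z d \<subseteq> unit_disc \<and> uniform_limit (cball z d) (\<lambda>k. polygon k t) (flow t)
      sequentially"
    by blast
qed (auto simp: polygon_holomorphic)

lemma flow_deriv_bound:
  assumes "z \<in> unit_disc" "0 \<le> t"
  shows "cmod (deriv (flow t) z) \<le> exp (K * t)"
proof -
  have "((\<lambda>w. (flow t w - flow t z) / (w - z)) \<longlongrightarrow> deriv (flow t) z) (at z)"
    using holomorphic_derivI[OF flow_holomorphic[OF assms(2)] open_ball assms(1)]
    by (simp add: has_field_derivative_iff)
  then show ?thesis
  proof (rule tendsto_norm[THEN tendsto_upperbound])
    show "\<forall>\<^sub>F w in at z. norm ((flow t w - flow t z) / (w - z)) \<le> exp (K * t)"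
      using eventually_at_in_open[OF open_ball assms(1)]
    proof eventually_elim
      case (elim w)
      then show ?case using flow_lipschitz[of w z t] assms by (auto simp: norm_divide divide_le_eq)
    qed
  qed simp
qed

end

section \<open>Boundary values of the vector field\<close>

text \<open>The function \<open>exp \<circ> F\<close> is bounded above and below by \<open>exp (\<plusminus> K)\<close>. Cauchy's estimate
bounds its derivative \<open>F' exp \<circ> F\<close>, and one divides.\<close>

lemma deriv_bound_of_bounded_Re:
  assumes F: "F holomorphic_on unit_disc" and K: "\<And>z. z \<in> unit_disc \<Longrightarrow> \<bar>Re (F z)\<bar> \<le> K"
    and z: "z \<in> unit_disc"
  shows "cmod (deriv F z) \<le> 2 * exp (2 * K) / (1 - cmod z)"
proof -
  define r where "r = (1 - cmod z) / 2"
  have r: "0 < r" using z by (simp add: r_def)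
  have sub: "cball z r \<subseteq> unit_disc"
  proof
    fix w assume "w \<in> cball z r"
    then have "cmod w \<le> cmod z + r" using norm_triangle_sub[of w z]
      by (simp add: dist_norm norm_minus_commute)
    also have "\<dots> < 1" using z by (simp add: r_def field_simps)
    finally show "w \<in> unit_disc" by simp
  qed
  have E: "(\<lambda>w. exp (F w)) holomorphic_on unit_disc" using F by (intro holomorphic_intros)
  have "cmod ((deriv ^^ 1) (\<lambda>w. exp (F w)) z) \<le> fact 1 * exp K / r ^ 1"
  proof (rule Cauchy_inequality[OF _ _ r])
    show "(\<lambda>w. exp (F w)) holomorphic_on ball z r"
      using E sub by (rule holomorphic_on_subset[OF _ order_trans[OF ball_subset_cball]])
    show "continuous_on (cball z r) (\<lambda>w. exp (F w))"
      using holomorphic_on_imp_continuous_on[OF holomorphic_on_subset[OF E sub]] .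
    fix w assume "cmod (z - w) = r"
    then have "w \<in> unit_disc" using sub by (auto simp: dist_norm subset_eq)
    then show "cmod (exp (F w)) \<le> exp K" using K[of w] by (auto simp: norm_exp_eq_Re)
  qed
  moreover have "deriv (\<lambda>w. exp (F w)) z = exp (F z) * deriv F z"
    using holomorphic_derivI[OF F open_ball z]
      by (intro DERIV_imp_deriv) (auto intro!: derivative_eq_intros)
  ultimately have "exp (Re (F z)) * cmod (deriv F z) \<le> exp K / r"
    by (simp add: norm_mult norm_exp_eq_Re)
  moreover have "exp (- K) * cmod (deriv F z) \<le> exp (Re (F z)) * cmod (deriv F z)"
    using K[OF z] by (intro mult_right_mono) auto
  ultimately have "exp K * (exp (- K) * cmod (deriv F z)) \<le> exp K * (exp K / r)"
    by (intro mult_left_mono) auto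
  moreover have "exp K * (exp (- K) * cmod (deriv F z)) = cmod (deriv F z)"
    by (simp add: exp_minus)
  moreover have "exp K * (exp K / r) = 2 * exp (2 * K) / (1 - cmod z)"
    unfolding exp_double r_def by (simp add: power2_eq_square)
  ultimately show ?thesis by linarith
qed

lemma radial_increment:
  assumes f: "f holomorphic_on unit_disc" and \<zeta>: "cmod \<zeta> = 1"
    and \<phi>: "\<And>x. 0 \<le> x \<Longrightarrow> x < 1 \<Longrightarrow> (\<phi> has_real_derivative \<phi>' x) (at x)"
    and le: "\<And>x. 0 \<le> x \<Longrightarrow> x < 1 \<Longrightarrow> cmod (deriv f (of_real x * \<zeta>)) \<le> \<phi>' x"
    and rs: "0 \<le> r" "r \<le> s" "s < 1"
  shows "cmod (f (of_real s * \<zeta>) - f (of_real r * \<zeta>)) \<le> \<phi> s - \<phi> r"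
proof (cases "r = s")
  case False
  have d: "((\<lambda>x. f (of_real x * \<zeta>)) has_vector_derivative \<zeta> * deriv f (of_real x * \<zeta>)) (at x)"
    if "0 \<le> x" "x < 1" for x
  proof -
    have "of_real x * \<zeta> \<in> unit_disc" using that \<zeta> by (simp add: norm_mult)
    from holomorphic_derivI[OF f open_ball this]
    have "(f has_field_derivative deriv f (of_real x * \<zeta>)) (at (of_real x * \<zeta>))" .
    moreover have "((\<lambda>x. of_real x * \<zeta>) has_vector_derivative \<zeta>) (at x)"
      unfolding has_vector_derivative_def
      by (auto intro!: derivative_eq_intros simp: scaleR_conv_of_real)
    ultimately show ?thesis
      using field_vector_diff_chain_at[of "\<lambda>x. of_real x * \<zeta>" \<zeta> x f] by (simp add: o_def)
  qed
  show ?thesis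
  proof (rule differentiable_bound_general)
    show "r < s" using rs False by simp
    show "continuous_on {r..s} (\<lambda>x. f (of_real x * \<zeta>))"
      using rs by (intro continuous_at_imp_continuous_on ballI has_vector_derivative_continuous[OF
          d]) auto
    show "continuous_on {r..s} \<phi>"
      using rs by (intro continuous_at_imp_continuous_on ballI DERIV_isCont[OF \<phi>]) auto
    fix x assume x: "r < x" "x < s"
    show "((\<lambda>x. f (of_real x * \<zeta>)) has_vector_derivative \<zeta> * deriv f (of_real x * \<zeta>)) (at x)"
      using x rs by (intro d) auto
    show "(\<phi> has_vector_derivative \<phi>' x) (at x)"
      using x rs \<phi>[of x] by (simp add: has_real_derivative_iff_has_vector_derivative)
    show "norm (\<zeta> * deriv f (of_real x * \<zeta>)) \<le> \<phi>' x"
      using x rs \<zeta> le[of x] by (simp add: norm_mult)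
  qed
qed simp

text \<open>Integrating \<open>|G''| \<le> C / (1 - x)\<close> twice along radii: \<open>C\<close> times \<open>- ln (1 - x)\<close> dominates
the increments of \<open>G'\<close>, and its antiderivative, which is continuous at \<open>x = 1\<close>, those of \<open>G\<close>.\<close>

lemma radial_modulus:
  assumes G: "G holomorphic_on unit_disc" and K: "\<And>z. z \<in> unit_disc \<Longrightarrow> \<bar>Re (deriv G z)\<bar> \<le> K"
  obtains \<delta> :: "real \<Rightarrow> real" where "(\<delta> \<longlongrightarrow> 0) (at_left 1)"
    "\<And>\<zeta> r s. cmod \<zeta> = 1 \<Longrightarrow> 0 \<le> r \<Longrightarrow> r \<le> s \<Longrightarrow> s < 1 \<Longrightarrow>
       cmod (G (of_real s * \<zeta>) - G (of_real r * \<zeta>)) \<le> \<delta> r"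
proof -
  define C where "C = 2 * exp (2 * K)"
  define A where "A = cmod (deriv G 0)"
  have C: "0 < C" and A: "0 \<le> A" by (simp_all add: C_def A_def)
  have G': "deriv G holomorphic_on unit_disc" using G by (intro holomorphic_intros) auto
  have G'_le: "cmod (deriv G (of_real x * \<zeta>)) \<le> A - C * ln (1 - x)"
    if \<zeta>: "cmod \<zeta> = 1" and x: "0 \<le> x" "x < 1" for x \<zeta>
  proof -
    have "cmod (deriv G (of_real x * \<zeta>) - deriv G (of_real 0 * \<zeta>)) \<le> - C * ln (1 - x) -
        - C * ln (1 - 0)"
    proof (rule radial_increment[OF G' \<zeta>, where \<phi>' = "\<lambda>x. C / (1 - x)"])
      show "((\<lambda>x. - C * ln (1 - x)) has_real_derivative C / (1 - x)) (at x)" if "0 \<le> x"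
          "x < 1" for x :: real
        using that by (auto intro!: derivative_eq_intros simp: field_simps)
      show "cmod (deriv (deriv G) (of_real x * \<zeta>)) \<le> C / (1 - x)" if "0 \<le> x" "x < 1" for x :: real
        using deriv_bound_of_bounded_Re[OF G' K, of "of_real x * \<zeta>"] that \<zeta>
        by (simp add: norm_mult C_def)
    qed (use x in auto)
    then show ?thesis
      using norm_triangle_sub[of "deriv G (of_real x * \<zeta>)" "deriv G 0"] by (simp add: A_def)
  qed
  \<comment> \<open>An antiderivative of \<open>A - C ln (1 - x)\<close> that stays below its limit \<open>A + C\<close> at \<open>x = 1\<close>.\<close>
  define W where "W = (\<lambda>x::real. (A + C) * x + C * ((1 - x) * ln (1 - x)))"
  define \<delta> where "\<delta> = (\<lambda>r. (A + C) - W r)"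
  show ?thesis
  proof
    show "(\<delta> \<longlongrightarrow> 0) (at_left 1)"
      unfolding \<delta>_def W_def by real_asymp
    fix \<zeta> :: complex and r s :: real
    assume \<zeta>: "cmod \<zeta> = 1" and rs: "0 \<le> r" "r \<le> s" "s < 1"
    have "cmod (G (of_real s * \<zeta>) - G (of_real r * \<zeta>)) \<le> W s - W r"
    proof (rule radial_increment[OF G \<zeta>, where \<phi>' = "\<lambda>x. A - C * ln (1 - x)"])
      show "(W has_real_derivative A - C * ln (1 - x)) (at x)" if "0 \<le> x" "x < 1" for x :: real
      proof -
        have "(W has_real_derivative (A + C) + C * (- 1 * ln (1 - x) + (- 1 / (1 - x)) * (1 - x)))
            (at x)"
          unfolding W_def using that by (auto intro!: derivative_eq_intros)
        also have "(A + C) + C * (- 1 * ln (1 - x) + (- 1 / (1 - x)) * (1 - x))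
            = A - C * ln (1 - x)"
          using that by (simp add: algebra_simps)
        finally show ?thesis .
      qed
    qed (use rs G'_le[OF \<zeta>] in auto)
    also have "W s \<le> A + C"
    proof -
      have "(1 - s) * ln (1 - s) \<le> 0" using rs by (intro mult_nonneg_nonpos) auto
      then have "C * ((1 - s) * ln (1 - s)) \<le> 0" by (rule mult_nonneg_nonpos[OF less_imp_le[OF C]])
      moreover have "(A + C) * s \<le> A + C" using A C rs by (intro mult_left_le) auto
      ultimately show ?thesis by (simp add: W_def)
    qed
    finally show "cmod (G (of_real s * \<zeta>) - G (of_real r * \<zeta>)) \<le> \<delta> r" by (simp add: \<delta>_def)
  qed
qed

text \<open>The radial limit exists: any accumulation point along a sequence of radii satisfies the
estimate, and the estimate forces convergence.\<close>

lemma radial_limit_rate: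
  assumes \<delta>: "(\<delta> \<longlongrightarrow> 0) (at_left 1)"
    and inc: "\<And>r s. 0 \<le> r \<Longrightarrow> r \<le> s \<Longrightarrow> s < 1 \<Longrightarrow>
       cmod (G (of_real s * \<zeta>) - G (of_real r * \<zeta>)) \<le> \<delta> r"
    and r: "0 \<le> r" "r < 1"
  shows "cmod (G (of_real r * \<zeta>) - radial_limit G \<zeta>) \<le> \<delta> r"
proof -
  define x :: "nat \<Rightarrow> real" where "x n = 1 - 1 / real (n + 2)" for n
  have x: "0 \<le> x n" "x n < 1" for n by (simp_all add: x_def field_simps)
  have xlim: "x \<longlonglongrightarrow> 1" unfolding x_def by real_asymp
  have "cmod (G (of_real (x n) * \<zeta>)) \<le> cmod (G 0) + \<delta> 0" for n
    using inc[of 0 "x n"] x[of n] norm_triangle_sub[of "G (of_real (x n) * \<zeta>)" "G 0"] by simp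
  then have "bounded (range (\<lambda>n. G (of_real (x n) * \<zeta>)))"
    unfolding bounded_iff by blast
  then obtain l \<sigma> where \<sigma>: "strict_mono (\<sigma> :: nat \<Rightarrow> nat)"
    and l: "((\<lambda>n. G (of_real (x n) * \<zeta>)) \<circ> \<sigma>) \<longlonglongrightarrow> l"
    using bounded_imp_convergent_subsequence by blast
  have rate: "cmod (G (of_real s * \<zeta>) - l) \<le> \<delta> s" if s: "0 \<le> s" "s < 1" for s
  proof -
    have "(\<lambda>n. cmod (((\<lambda>n. G (of_real (x n) * \<zeta>)) \<circ> \<sigma>) n - G (of_real s * \<zeta>))) \<longlonglongrightarrow> cmod
        (l - G (of_real s * \<zeta>))"
      by (intro tendsto_intros l)
    moreover have "eventually (\<lambda>n. s \<le> (x \<circ> \<sigma>) n) sequentially"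
      using order_tendstoD(1)[OF LIMSEQ_subseq_LIMSEQ[OF xlim \<sigma>] s(2)]
      by eventually_elim simp
    then have "eventually (\<lambda>n. cmod (((\<lambda>n. G (of_real (x n) * \<zeta>)) \<circ> \<sigma>) n - G (of_real s * \<zeta>))
        \<le> \<delta> s) sequentially"
      by eventually_elim (use inc s x in auto)
    ultimately have "cmod (l - G (of_real s * \<zeta>)) \<le> \<delta> s"
      by (rule tendsto_upperbound) simp
    then show ?thesis by (simp add: norm_minus_commute)
  qed
  have "((\<lambda>r. G (of_real r * \<zeta>)) \<longlongrightarrow> l) (at_left 1)"
  proof (rule Lim_transform2[OF tendsto_const], rule Lim_null_comparison[OF _ \<delta>])
    have "eventually (\<lambda>s::real. s \<in> {0<..<1}) (at_left 1)"
      by (rule eventually_at_leftI[of 0]) auto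
    then show "\<forall>\<^sub>F s in at_left 1. norm (l - G (of_real s * \<zeta>)) \<le> \<delta> s"
      by eventually_elim (use rate in \<open>auto simp: norm_minus_commute\<close>)
  qed
  then have "radial_limit G \<zeta> = l"
    unfolding radial_limit_def by (intro tendsto_Lim) auto
  with rate[OF r] show ?thesis by simp
qed

text \<open>The set where the inequality fails is relatively open, and a nonempty open set of angles
has positive measure. The angle zero is reached by continuity.\<close>

lemma AE_circle_continuous_le:
  fixes h :: "complex \<Rightarrow> real"
  assumes AE: "AE z in circle_measure. h z \<le> a" and cont: "continuous_on (sphere 0 1) h"
    and z: "cmod z = 1"
  shows "h z \<le> a"
proof -
  have "cis \<in> borel_measurable (restrict_space lborel {0..<2 * pi})"
    by (intro measurable_restrict_space1) (simp add: borel_measurable_continuous_onI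
        continuous_on_cis)
  then have m: "cis \<in> restrict_space lborel {0..<2 * pi} \<rightarrow>\<^sub>M restrict_space borel (sphere 0 1)"
    by (intro measurable_restrict_space2) auto
  have "AE \<theta> in restrict_space lborel {0..<2 * pi}. h (cis \<theta>) \<le> a"
    using AE_distrD[OF m] AE unfolding circle_measure_def by blast
  then have ae: "AE \<theta> in lborel. \<theta> \<in> {0..<2 * pi} \<longrightarrow> h (cis \<theta>) \<le> a"
    by (subst (asm) AE_restrict_space_iff) auto
  have hc: "continuous_on UNIV (\<lambda>\<theta>. h (cis \<theta>))"
    by (rule continuous_on_compose2[OF cont]) (auto intro: continuous_intros)
  define U where "U = {\<theta>. a < h (cis \<theta>)} \<inter> {0<..<2 * pi}"
  have oU: "open U"
    unfolding U_def using hc by (intro open_Int open_Collect_less continuous_intros) auto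
  have "AE \<theta> in lborel. \<theta> \<notin> U"
    using ae by eventually_elim (auto simp: U_def)
  then have "U \<in> null_sets lborel"
    using oU by (subst (asm) AE_iff_null_sets[symmetric]) auto
  then have "negligible U"
    using negligible_iff_null_sets null_sets_completionI by blast
  then have U: "U = {}" using open_not_negligible[OF oU] by blast
  have le: "h (cis \<theta>) \<le> a" if "0 < \<theta>" "\<theta> < 2 * pi" for \<theta>
  proof (rule ccontr)
    assume "\<not> h (cis \<theta>) \<le> a"
    with that have "\<theta> \<in> U" by (simp add: U_def)
    with U show False by simp
  qed
  obtain \<theta> where \<theta>: "0 \<le> \<theta>" "\<theta> < 2 * pi" "z = cis \<theta>"
  proof -
    have "z \<noteq> 0" using z by auto
    then show ?thesis
      using z Arg2pi_eq[of z] Arg2pi_ge_0[of z] Arg2pi_lt_2pi[of z] that[of "Arg2pi z"]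
        by (simp add: cis_conv_exp)
  qed
  have "closed {\<theta>. h (cis \<theta>) \<le> a}" by (intro closed_Collect_le hc continuous_intros)
  moreover have "{0<..<2 * pi} \<subseteq> {\<theta>. h (cis \<theta>) \<le> a}" using le by auto
  ultimately have "closure {0<..<2 * pi} \<subseteq> {\<theta>. h (cis \<theta>) \<le> a}" by (rule closure_minimal[rotated])
  then have "{0..2 * pi} \<subseteq> {\<theta>. h (cis \<theta>) \<le> a}" by simp
  moreover have "\<theta> \<in> {0..2 * pi}" using \<theta> by simp
  ultimately have "h (cis \<theta>) \<le> a" by blast
  then show ?thesis by (simp add: \<theta>(3))
qed

text \<open>Uniform convergence to the radial limits makes these continuous, so the boundary
inequality holds everywhere on the circle, and it persists with \<open>\<eta> / 2\<close> on circles close to the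
boundary. Passing from the unit vector \<open>z / |z|\<close> to \<open>z\<close> costs another factor \<open>|z| \<ge> 1 / 2\<close>.\<close>

lemma inward_field_from_boundary:
  fixes G :: "complex \<Rightarrow> complex" and \<eta> :: real
  assumes G: "G holomorphic_on unit_disc"
    and \<eta>: "\<eta> > 0"
    and ess: "esssup circle_measure (\<lambda>z. ereal (Re (cnj z * radial_limit G z))) \<le> ereal (- \<eta>)"
    and bdd: "bounded ((\<lambda>z. Re (deriv G z)) ` unit_disc)"
  obtains M K c \<rho>\<^sub>0 where "inward_field G M K c \<rho>\<^sub>0"
proof -
  obtain K where K: "0 < K" "\<And>z. z \<in> unit_disc \<Longrightarrow> \<bar>Re (deriv G z)\<bar> \<le> K"
    using bdd unfolding bounded_pos by auto
  obtain \<delta> where \<delta>: "(\<delta> \<longlongrightarrow> 0) (at_left 1)"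
    "\<And>\<zeta> r s. cmod \<zeta> = 1 \<Longrightarrow> 0 \<le> r \<Longrightarrow> r \<le> s \<Longrightarrow> s < 1 \<Longrightarrow>
       cmod (G (of_real s * \<zeta>) - G (of_real r * \<zeta>)) \<le> \<delta> r"
    using radial_modulus[OF G K(2)] by blast
  have rate: "cmod (G (of_real r * \<zeta>) - radial_limit G \<zeta>) \<le> \<delta> r" if "cmod \<zeta> = 1" "0 \<le> r"
      "r < 1" for r \<zeta>
    by (rule radial_limit_rate[OF \<delta>(1) \<delta>(2)[OF that(1)] that(2,3)])
  have near1: "eventually (\<lambda>s::real. s \<in> {0<..<1}) (at_left 1)"
    by (rule eventually_at_leftI[of 0]) auto
  have "uniform_limit (sphere 0 1) (\<lambda>r \<zeta>. G (of_real r * \<zeta>)) (radial_limit G) (at_left 1)"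
  proof (rule uniform_limitI)
    fix e :: real assume "0 < e"
    from order_tendstoD(2)[OF \<delta>(1) this] near1
    show "\<forall>\<^sub>F r in at_left 1. \<forall>\<zeta>\<in>sphere 0 1. dist (G (of_real r * \<zeta>)) (radial_limit G \<zeta>) < e"
    proof eventually_elim
      case (elim r)
      then show ?case
        unfolding dist_norm by (intro ballI le_less_trans[OF rate elim(1)]) auto
    qed
  qed
  moreover have "\<forall>\<^sub>F r in at_left 1. continuous_on (sphere 0 1) (\<lambda>\<zeta>. G (of_real r * \<zeta>))"
    using near1
  proof eventually_elim
    case (elim r)
    show ?case
      by (rule continuous_on_compose2[OF holomorphic_on_imp_continuous_on[OF G]])
        (use elim in \<open>auto intro!: continuous_intros simp: norm_mult\<close>)
  qed
  ultimately have cont: "continuous_on (sphere 0 1) (radial_limit G)"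
    by (intro uniform_limit_theorem[of _ _ "at_left (1::real)"]) auto
  have "AE z in circle_measure. ereal (Re (cnj z * radial_limit G z)) \<le> ereal (- \<eta>)"
    by (rule eventually_mono[OF esssup_AE]) (rule order_trans[OF _ ess])
  then have "AE z in circle_measure. Re (cnj z * radial_limit G z) \<le> - \<eta>" by simp
  then have bnd: "Re (cnj \<zeta> * radial_limit G \<zeta>) \<le> - \<eta>" if "cmod \<zeta> = 1" for \<zeta>
    by (rule AE_circle_continuous_le) (auto intro!: continuous_intros cont that)
  have "eventually (\<lambda>r. \<delta> r < \<eta> / 2) (at_left 1)"
    using order_tendstoD(2)[OF \<delta>(1), of "\<eta> / 2"] \<eta> by simp
  then obtain r0 where r0: "r0 < 1" "\<And>r. r0 < r \<Longrightarrow> r < 1 \<Longrightarrow> \<delta> r < \<eta> / 2"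
    using eventually_at_left[of 0 "1::real"] by (auto simp: eventually_at_left[of 0 "1::real"])
  define \<rho>\<^sub>0 where "\<rho>\<^sub>0 = (1 + max r0 0) / 2"
  have \<rho>\<^sub>0: "1 / 2 \<le> \<rho>\<^sub>0" "\<rho>\<^sub>0 < 1" "r0 < \<rho>\<^sub>0" using r0 by (auto simp: \<rho>\<^sub>0_def)
  have inward: "Re (cnj z * G z) \<le> - (\<eta> / 4)" if z: "z \<in> unit_disc" "\<rho>\<^sub>0 \<le> cmod z" for z
  proof -
    define r where "r = cmod z"
    define \<zeta> where "\<zeta> = z / of_real r"
    have r: "1 / 2 \<le> r" "r < 1" "r0 < r" using z \<rho>\<^sub>0 by (auto simp: r_def)
    have \<zeta>: "cmod \<zeta> = 1" "z = of_real r * \<zeta>" using r by (auto simp: \<zeta>_def norm_divide r_def)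
    have "Re (cnj \<zeta> * G z) = Re (cnj \<zeta> * radial_limit G \<zeta>) + Re (cnj \<zeta> * (G z - radial_limit G \<zeta>))"
      by (simp add: algebra_simps)
    also have "\<dots> \<le> - \<eta> + \<delta> r"
    proof (rule add_mono[OF bnd[OF \<zeta>(1)]])
      have "Re (cnj \<zeta> * (G z - radial_limit G \<zeta>)) \<le> cmod (cnj \<zeta> * (G z - radial_limit G \<zeta>))"
        by (rule complex_Re_le_cmod)
      also have "\<dots> \<le> \<delta> r" using rate[of \<zeta> r] \<zeta> r by (simp add: norm_mult)
      finally show "Re (cnj \<zeta> * (G z - radial_limit G \<zeta>)) \<le> \<delta> r" .
    qed
    also have "\<dots> \<le> - (\<eta> / 2)" using r0(2)[OF r(3,2)] by simp
    finally have "r * Re (cnj \<zeta> * G z) \<le> r * - (\<eta> / 2)" using r by (intro mult_left_mono) auto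
    also have "\<dots> \<le> 1 / 2 * - (\<eta> / 2)" using r \<eta> by (intro mult_right_mono_neg) auto
    also have "r * Re (cnj \<zeta> * G z) = Re (cnj z * G z)"
    proof -
      have "cnj z * G z = of_real r * (cnj \<zeta> * G z)" by (subst \<zeta>(2)) (simp add: mult.assoc)
      then show ?thesis by (simp only: Re_complex_of_real times_complex.sel Im_complex_of_real
          mult_zero_left diff_0_right)
    qed
    finally show ?thesis by simp
  qed
  have M: "cmod (G z) \<le> cmod (G 0) + \<bar>\<delta> 0\<bar> + 1" if z: "z \<in> unit_disc" for z
  proof (cases "z = 0")
    case False
    define \<zeta> where "\<zeta> = z / of_real (cmod z)"
    have "cmod \<zeta> = 1" "z = of_real (cmod z) * \<zeta>" using False by (auto simp: \<zeta>_def norm_divide)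
    then have "cmod (G z - G 0) \<le> \<delta> 0" using \<delta>(2)[of \<zeta> 0 "cmod z"] z by simp
    then show ?thesis using norm_triangle_sub[of "G z" "G 0"] by linarith
  qed simp
  have "inward_field G (cmod (G 0) + \<bar>\<delta> 0\<bar> + 1) K (\<eta> / 4) \<rho>\<^sub>0"
  proof
    show "0 < cmod (G 0) + \<bar>\<delta> 0\<bar> + 1" by (smt (verit) norm_ge_zero)
    show "Re (deriv G z) \<le> K" if "z \<in> unit_disc" for z using K(2)[OF that] by simp
  qed (use G M K \<eta> \<rho>\<^sub>0 inward in auto)
  then show ?thesis by (rule that)
qed

section \<open>Weighted Hilbert spaces of analytic functions\<close>

text \<open>The common form of the Hardy and the Dirichlet space. The lower bound on the weight makes
point evaluations bounded, the upper bound makes the norms on circles inside the disc finite.\<close>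

locale weighted_space =
  fixes X :: hilbert_fun_space and w :: "nat \<Rightarrow> real"
  assumes w_ge: "\<And>n. 1 \<le> w n" and w_le: "\<And>n. w n \<le> real (Suc n)"
    and elements_iff: "\<And>f. f \<in> elements X \<longleftrightarrow> f \<in> disc_analytic \<and> wsummable w (taylor_coeff f)"
    and inner: "\<And>f g. f \<in> elements X \<Longrightarrow> g \<in> elements X \<Longrightarrow>
        inner_prod X f g = wip w (taylor_coeff f) (taylor_coeff g)"
begin

lemma w_nonneg: "0 \<le> w n"
  using w_ge[of n] by simp

lemma element_holomorphic: "f \<in> elements X \<Longrightarrow> f holomorphic_on unit_disc"
  by (simp add: elements_iff disc_analytic_def)

lemma element_outside: "f \<in> elements X \<Longrightarrow> z \<notin> unit_disc \<Longrightarrow> f z = 0"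
  by (simp add: elements_iff disc_analytic_def)

lemma element_wsummable: "f \<in> elements X \<Longrightarrow> wsummable w (taylor_coeff f)"
  by (simp add: elements_iff)

lemma elementI:
  "f holomorphic_on unit_disc \<Longrightarrow> (\<And>z. z \<notin> unit_disc \<Longrightarrow> f z = 0) \<Longrightarrow>
    wsummable w (taylor_coeff f) \<Longrightarrow> f \<in> elements X"
  by (simp add: elements_iff disc_analytic_def)

lemma norm_eq: "f \<in> elements X \<Longrightarrow> norm_in X f = wnorm w (taylor_coeff f)"
  unfolding norm_in_def
  by (simp add: inner wip_self[OF w_nonneg] element_wsummable wnorm_nonneg[OF w_nonneg] flip:
      of_real_power)

lemma element_eqI:
  assumes "f \<in> elements X" "g \<in> elements X" "\<And>n. taylor_coeff f n = taylor_coeff g n"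
  shows "f = g"
proof
  fix z
  show "f z = g z"
  proof (cases "z \<in> unit_disc")
    case True
    have "(\<lambda>n. taylor_coeff g n * z ^ n) sums f z"
      using taylor_sums[OF element_holomorphic[OF assms(1)] True] assms(3) by simp
    then show ?thesis
      using taylor_sums[OF element_holomorphic[OF assms(2)] True] sums_unique2 by blast
  qed (simp add: element_outside assms)
qed

lemma coeff_add: "f \<in> elements X \<Longrightarrow> g \<in> elements X \<Longrightarrow>
    taylor_coeff (\<lambda>z. f z + g z) = (\<lambda>n. taylor_coeff f n + taylor_coeff g n)"
  by (rule ext) (simp add: taylor_coeff_add element_holomorphic)

lemma coeff_diff: "f \<in> elements X \<Longrightarrow> g \<in> elements X \<Longrightarrow>
    taylor_coeff (\<lambda>z. f z - g z) = (\<lambda>n. taylor_coeff f n - taylor_coeff g n)"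
  by (rule ext) (simp add: taylor_coeff_diff element_holomorphic)

lemma coeff_cmult: "f \<in> elements X \<Longrightarrow>
    taylor_coeff (\<lambda>z. c * f z) = (\<lambda>n. c * taylor_coeff f n)"
  by (rule ext) (simp add: taylor_coeff_cmult element_holomorphic)

lemma element_add:
  assumes "f \<in> elements X" "g \<in> elements X"
  shows "(\<lambda>z. f z + g z) \<in> elements X"
proof (rule elementI)
  show "(\<lambda>z. f z + g z) holomorphic_on unit_disc"
    using assms by (intro holomorphic_intros element_holomorphic)
  show "wsummable w (taylor_coeff (\<lambda>z. f z + g z))"
    unfolding coeff_add[OF assms] using assms
    by (intro wsummable_add[OF w_nonneg] element_wsummable)
qed (use assms in \<open>simp add: element_outside\<close>)

lemma element_diff:
  assumes "f \<in> elements X" "g \<in> elements X"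
  shows "(\<lambda>z. f z - g z) \<in> elements X"
proof (rule elementI)
  show "(\<lambda>z. f z - g z) holomorphic_on unit_disc"
    using assms by (intro holomorphic_intros element_holomorphic)
  show "wsummable w (taylor_coeff (\<lambda>z. f z - g z))"
    unfolding coeff_diff[OF assms] using assms
    by (intro wsummable_diff[OF w_nonneg] element_wsummable)
qed (use assms in \<open>simp add: element_outside\<close>)

lemma element_cmult:
  assumes "f \<in> elements X"
  shows "(\<lambda>z. c * f z) \<in> elements X"
proof (rule elementI)
  show "(\<lambda>z. c * f z) holomorphic_on unit_disc"
    using assms by (intro holomorphic_intros element_holomorphic)
  show "wsummable w (taylor_coeff (\<lambda>z. c * f z))"
    unfolding coeff_cmult[OF assms] using assms
    by (intro wsummable_cmult[OF w_nonneg] element_wsummable)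
qed (use assms in \<open>simp add: element_outside\<close>)

lemma element_zero: "(\<lambda>z. 0) \<in> elements X"
  by (rule elementI) (simp_all add: wsummable_def taylor_coeff_def)

lemma norm_nonneg: "f \<in> elements X \<Longrightarrow> 0 \<le> norm_in X f"
  by (simp add: norm_eq wnorm_nonneg[OF w_nonneg] element_wsummable)

lemma norm_cmult: "f \<in> elements X \<Longrightarrow> norm_in X (\<lambda>z. c * f z) = cmod c * norm_in X f"
  by (simp add: norm_eq element_cmult coeff_cmult wnorm_cmult[OF w_nonneg] element_wsummable)

lemma norm_triangle: "f \<in> elements X \<Longrightarrow> g \<in> elements X \<Longrightarrow>
    norm_in X (\<lambda>z. f z + g z) \<le> norm_in X f + norm_in X g"
  by (simp add: norm_eq element_add coeff_add wnorm_triangle[OF w_nonneg] element_wsummable)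

lemma inner_add_left: "f \<in> elements X \<Longrightarrow> g \<in> elements X \<Longrightarrow> h \<in> elements X \<Longrightarrow>
    inner_prod X (\<lambda>z. f z + g z) h = inner_prod X f h + inner_prod X g h"
  by (simp add: inner element_add coeff_add wip_add_left[OF w_nonneg] element_wsummable)

lemma inner_cmult_left: "f \<in> elements X \<Longrightarrow> h \<in> elements X \<Longrightarrow>
    inner_prod X (\<lambda>z. c * f z) h = c * inner_prod X f h"
  by (simp add: inner element_cmult coeff_cmult wip_cmult_left[OF w_nonneg] element_wsummable)

lemma inner_cnj: "f \<in> elements X \<Longrightarrow> h \<in> elements X \<Longrightarrow> inner_prod X h f = cnj (inner_prod X f h)"
  by (simp add: inner element_wsummable) (rule wip_cnj[OF w_nonneg]; simp add: element_wsummable)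

lemma inner_add_right: "f \<in> elements X \<Longrightarrow> g \<in> elements X \<Longrightarrow> h \<in> elements X \<Longrightarrow>
    inner_prod X h (\<lambda>z. f z + g z) = inner_prod X h f + inner_prod X h g"
  using inner_cnj[of "\<lambda>z. f z + g z" h] inner_cnj[of f h] inner_cnj[of g h]
  by (simp add: element_add inner_add_left)

lemma inner_cmult_right: "f \<in> elements X \<Longrightarrow> h \<in> elements X \<Longrightarrow>
    inner_prod X h (\<lambda>z. c * f z) = cnj c * inner_prod X h f"
  using inner_cnj[of "\<lambda>z. c * f z" h] inner_cnj[of f h]
  by (simp add: element_cmult inner_cmult_left)

lemma inner_self: "f \<in> elements X \<Longrightarrow> inner_prod X f f = of_real ((norm_in X f)\<^sup>2)"
  by (simp add: inner norm_eq wip_self[OF w_nonneg] element_wsummable)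

lemma Cauchy_Schwarz: "f \<in> elements X \<Longrightarrow> g \<in> elements X \<Longrightarrow>
    cmod (inner_prod X f g) \<le> norm_in X f * norm_in X g"
  by (simp add: inner norm_eq wip_Cauchy_Schwarz[OF w_nonneg] element_wsummable)

lemma coeff_le_norm:
  assumes "f \<in> elements X"
  shows "cmod (taylor_coeff f n) \<le> norm_in X f"
proof (rule power2_le_imp_le[OF _ norm_nonneg[OF assms]])
  have "(cmod (taylor_coeff f n))\<^sup>2 \<le> w n * (cmod (taylor_coeff f n))\<^sup>2"
    using mult_right_mono[OF w_ge, of "(cmod (taylor_coeff f n))\<^sup>2" n] by simp
  also have "\<dots> \<le> (norm_in X f)\<^sup>2"
    unfolding norm_eq[OF assms] by (rule wterm_le_wnorm_sq[OF w_nonneg element_wsummable[OF assms]])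
  finally show "(cmod (taylor_coeff f n))\<^sup>2 \<le> (norm_in X f)\<^sup>2" .
qed

lemma point_evaluation_le:
  assumes f: "f \<in> elements X" and z: "z \<in> unit_disc"
  shows "cmod (f z) \<le> norm_in X f / (1 - cmod z)"
proof -
  have s: "(\<lambda>n. taylor_coeff f n * z ^ n) sums f z"
    by (rule taylor_sums[OF element_holomorphic[OF f] z])
  have g: "(\<lambda>n. norm_in X f * cmod z ^ n) sums (norm_in X f * (1 / (1 - cmod z)))"
    using z by (intro sums_mult geometric_sums) simp
  have le: "cmod (taylor_coeff f n * z ^ n) \<le> norm_in X f * cmod z ^ n" for n
    unfolding norm_mult norm_power by (intro mult_right_mono coeff_le_norm f) auto
  have "cmod (f z) \<le> (\<Sum>n. norm_in X f * cmod z ^ n)"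
    using norm_suminf_le[of "\<lambda>n. taylor_coeff f n * z ^ n" "\<lambda>n. norm_in X f * cmod z ^ n"] le s g
    by (simp add: sums_iff)
  then show ?thesis using g by (simp add: sums_iff)
qed

text \<open>Completeness of the space in the form in which it is used: a weighted square-summable
sequence is bounded, so its power series converges on the disc.\<close>

lemma element_of_coeffs:
  assumes a: "wsummable w a"
  obtains f where "f \<in> elements X" "taylor_coeff f = a"
proof -
  have bd: "cmod (a n) \<le> wnorm w a" for n
  proof (rule power2_le_imp_le[OF _ wnorm_nonneg[OF w_nonneg a]])
    have "(cmod (a n))\<^sup>2 \<le> w n * (cmod (a n))\<^sup>2"
      using mult_right_mono[OF w_ge, of "(cmod (a n))\<^sup>2" n] by simp
    also have "\<dots> \<le> (wnorm w a)\<^sup>2" by (rule wterm_le_wnorm_sq[OF w_nonneg a])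
    finally show "(cmod (a n))\<^sup>2 \<le> (wnorm w a)\<^sup>2" .
  qed
  have "summable (\<lambda>n. a n * z ^ n)" if "z \<in> unit_disc" for z
  proof (rule summable_comparison_test')
    show "summable (\<lambda>n. wnorm w a * cmod z ^ n)" using that
      by (intro summable_mult summable_geometric) auto
    show "norm (a n * z ^ n) \<le> wnorm w a * cmod z ^ n" for n
      unfolding norm_mult norm_power by (intro mult_right_mono bd) auto
  qed
  note P = taylor_coeff_powser[OF this]
  define f where "f = on_disc (\<lambda>z. \<Sum>n. a n * z ^ n)"
  have tc: "taylor_coeff f = a" unfolding f_def
    by (rule ext) (rule trans[OF taylor_coeff_on_disc[OF P(1)] P(2)])
  moreover have "f \<in> elements X"
  proof (rule elementI)
    show "f holomorphic_on unit_disc"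
      unfolding f_def on_disc_def by (rule holomorphic_transform[OF P(1)]) auto
  qed (simp_all add: tc a, simp add: f_def on_disc_def)
  ultimately show ?thesis using that by blast
qed

definition monomial :: "nat \<Rightarrow> complex \<Rightarrow> complex" where
  "monomial n = on_disc (\<lambda>z. z ^ n)"

lemma coeff_monomial: "taylor_coeff (monomial n) m = (if m = n then 1 else 0)"
proof -
  have "taylor_coeff (\<lambda>z. z ^ n) m = (if m = n then 1 else 0)"
  proof (rule taylor_coeff_unique)
    fix z :: complex
    show "(\<lambda>m. (if m = n then 1 else 0) * z ^ m) sums z ^ n"
      using sums_single[of n "\<lambda>m. z ^ m"] by (simp add: if_distrib[of "\<lambda>x. x * _"] cong: if_cong)
  qed
  then show ?thesis unfolding monomial_def by (subst taylor_coeff_on_disc)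
      (auto intro: holomorphic_intros)
qed

lemma monomial_element: "monomial n \<in> elements X"
proof (rule elementI)
  show "monomial n holomorphic_on unit_disc"
    unfolding monomial_def on_disc_def
    by (rule holomorphic_transform[of "\<lambda>z. z ^ n"]) (auto intro: holomorphic_intros)
  show "wsummable w (taylor_coeff (monomial n))"
    unfolding wsummable_def by (rule summable_finite[of "{n}"]) (auto simp: coeff_monomial)
qed (simp add: monomial_def on_disc_def)

lemma inner_monomial: "f \<in> elements X \<Longrightarrow> inner_prod X f (monomial n) = of_real (w n) * taylor_coeff
    f n"
proof -
  assume f: "f \<in> elements X"
  have "inner_prod X f (monomial n) = (\<Sum>m\<in>{n}. of_real (w m) * taylor_coeff f m * cnj
      (taylor_coeff (monomial n) m))"
    unfolding inner[OF f monomial_element] wip_def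
      by (rule suminf_finite) (auto simp: coeff_monomial)
  then show ?thesis by (simp add: coeff_monomial)
qed

definition truncation :: "nat \<Rightarrow> (nat \<Rightarrow> complex) \<Rightarrow> complex \<Rightarrow> complex" where
  "truncation N a z = (\<Sum>n<N. a n * monomial n z)"

lemma truncation_element: "truncation N a \<in> elements X"
proof (induction N)
  case (Suc N)
  then show ?case
    using element_add[OF Suc element_cmult[OF monomial_element[of N], of "a N"]]
    by (simp add: truncation_def[abs_def])
qed (simp add: truncation_def[abs_def] element_zero)

lemma coeff_truncation: "taylor_coeff (truncation N a) n = (if n < N then a n else 0)"
proof (induction N)
  case (Suc N)
  have "truncation (Suc N) a = (\<lambda>z. truncation N a z + a N * monomial N z)"
    by (simp add: truncation_def[abs_def])
  then show ?case
    using Suc by (simp add: coeff_add coeff_cmult truncation_element element_cmult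
        monomial_element coeff_monomial less_Suc_eq)
qed (simp add: truncation_def[abs_def] taylor_coeff_def)

lemma truncation_tendsto:
  assumes g: "g \<in> elements X"
  shows "(\<lambda>N. norm_in X (\<lambda>z. g z - truncation N (taylor_coeff g) z)) \<longlonglongrightarrow> 0"
proof -
  define h where "h = (\<lambda>n. w n * (cmod (taylor_coeff g n))\<^sup>2)"
  have sh: "summable h" using element_wsummable[OF g] by (simp add: h_def wsummable_def)
  have "norm_in X (\<lambda>z. g z - truncation N (taylor_coeff g) z) = sqrt (\<Sum>n. h (n + N))" for N
  proof -
    define k where "k = (\<lambda>n. w n *
        (cmod (taylor_coeff g n - taylor_coeff (truncation N (taylor_coeff g)) n))\<^sup>2)"
    have "wsummable w (\<lambda>n. taylor_coeff g n - taylor_coeff (truncation N (taylor_coeff g)) n)"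
      by (intro wsummable_diff[OF w_nonneg] element_wsummable g truncation_element)
    then have sk: "summable k" by (simp add: k_def wsummable_def)
    have "norm_in X (\<lambda>z. g z - truncation N (taylor_coeff g) z) = sqrt (suminf k)"
      by (simp add: norm_eq element_diff g truncation_element coeff_diff wnorm_def k_def)
    also have "suminf k = (\<Sum>n. k (n + N)) + (\<Sum>n<N. k n)"
      by (rule suminf_split_initial_segment[OF sk])
    also have "(\<Sum>n<N. k n) = 0" by (simp add: k_def coeff_truncation)
    also have "(\<lambda>n. k (n + N)) = (\<lambda>n. h (n + N))" by (simp add: k_def h_def coeff_truncation)
    finally show ?thesis by simp
  qed
  moreover have "(\<lambda>N. sqrt (\<Sum>n. h (n + N))) \<longlonglongrightarrow> sqrt 0"
    by (intro tendsto_real_sqrt suminf_exist_split2 sh)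
  ultimately show ?thesis by simp
qed

definition bounded_form :: "((complex \<Rightarrow> complex) \<Rightarrow> (complex \<Rightarrow> complex) \<Rightarrow> complex) \<Rightarrow> real \<Rightarrow> bool"
    where
  "bounded_form b C \<longleftrightarrow> 0 \<le> C \<and>
     (\<forall>f\<in>elements X. \<forall>g\<in>elements X. \<forall>h\<in>elements X.
        b (\<lambda>z. f z + g z) h = b f h + b g h \<and> b h (\<lambda>z. f z + g z) = b h f + b h g) \<and>
     (\<forall>c. \<forall>f\<in>elements X. \<forall>h\<in>elements X.
        b (\<lambda>z. c * f z) h = c * b f h \<and> b h (\<lambda>z. c * f z) = cnj c * b h f) \<and>
     (\<forall>f\<in>elements X. \<forall>g\<in>elements X. cmod (b f g) \<le> C * (norm_in X f * norm_in X g))"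

text \<open>The image of \<open>f\<close> is given by its coefficients \<open>b f z\<^sup>n / w\<^sub>n\<close>. Testing the form with the
truncations of this sequence shows that it is square-summable, and bounded functionals that
agree on monomials agree because truncations converge in norm.\<close>

lemma Riesz_representation:
  assumes b: "bounded_form b C"
  obtains T where "bounded_op X T" "\<And>f. f \<in> elements X \<Longrightarrow> norm_in X (T f) \<le> C * norm_in X f"
    "\<And>f g. f \<in> elements X \<Longrightarrow> g \<in> elements X \<Longrightarrow> inner_prod X (T f) g = b f g"
proof -
  have b_add: "b (\<lambda>z. f z + g z) h = b f h + b g h" "b h (\<lambda>z. f z + g z) = b h f + b h g"
    if "f \<in> elements X" "g \<in> elements X" "h \<in> elements X" for f g h
    using b that by (auto simp: bounded_form_def)
  have b_cmult: "b (\<lambda>z. c * f z) h = c * b f h" "b h (\<lambda>z. c * f z) = cnj c * b h f"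
    if "f \<in> elements X" "h \<in> elements X" for c f h
    using b that by (auto simp: bounded_form_def)
  have b_le: "cmod (b f g) \<le> C * (norm_in X f * norm_in X g)" if "f \<in> elements X" "g \<in> elements X"
      for f g
    using b that by (auto simp: bounded_form_def)
  have C: "0 \<le> C" using b by (simp add: bounded_form_def)
  have w0: "w n \<noteq> 0" for n using w_ge[of n] by auto
  have b_trunc: "b f (truncation N a) = (\<Sum>n<N. cnj (a n) * b f (monomial n))" if f:
      "f \<in> elements X" for f N a
  proof (induction N)
    case 0
    have "b f (truncation 0 a) = b f (\<lambda>z. 0 * (\<lambda>z. 0) z)" by (simp add: truncation_def[abs_def])
    also have "\<dots> = 0" using b_cmult(2)[OF element_zero f, of 0] by simp
    finally show ?case by simp
  next
    case (Suc N)
    have "truncation (Suc N) a = (\<lambda>z. truncation N a z + a N * monomial N z)"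
      by (simp add: truncation_def[abs_def])
    then show ?case
      using Suc by (simp add: b_add b_cmult f truncation_element element_cmult monomial_element)
  qed
  have ex: "\<exists>u\<in>elements X. norm_in X u \<le> C * norm_in X f \<and> (\<forall>g\<in>elements X. inner_prod X u g
      = b f g)"
    if f: "f \<in> elements X" for f
  proof -
    define a where "a n = b f (monomial n) / of_real (w n)" for n
    have bm: "b f (monomial n) = of_real (w n) * a n" for n using w0 by (simp add: a_def)
    have part: "(\<Sum>n<N. w n * (cmod (a n))\<^sup>2) \<le> (C * norm_in X f)\<^sup>2" for N
    proof -
      define S where "S = (\<Sum>n<N. w n * (cmod (a n))\<^sup>2)"
      have S0: "0 \<le> S" unfolding S_def by (intro sum_nonneg) (simp add: w_nonneg)
      have "b f (truncation N a) = of_real S"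
        unfolding b_trunc[OF f] bm S_def of_real_sum of_real_mult complex_norm_square
          by (simp add: mult_ac)
      moreover have "(norm_in X (truncation N a))\<^sup>2 = S"
      proof -
        have "(norm_in X (truncation N a))\<^sup>2 = (\<Sum>n. w n * (cmod (if n < N then a n else 0))\<^sup>2)"
          by (simp add: norm_eq[OF truncation_element]
              wnorm_sq[OF w_nonneg element_wsummable[OF truncation_element]] coeff_truncation)
        also have "\<dots> = (\<Sum>n<N. w n * (cmod (if n < N then a n else 0))\<^sup>2)"
          by (rule suminf_finite) auto
        finally show ?thesis by (simp add: S_def)
      qed
      ultimately have "S \<le> C * (norm_in X f * sqrt S)"
        using b_le[OF f truncation_element, of N a] S0 norm_nonneg[OF truncation_element, of N a]
        by (simp add: real_sqrt_unique)
      then have "sqrt S * sqrt S \<le> (C * norm_in X f) * sqrt S" using S0 by (simp add: mult_ac)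
      then have "sqrt S \<le> C * norm_in X f"
        using S0 C norm_nonneg[OF f] mult_right_le_imp_le[of "sqrt S" "sqrt S" "C * norm_in X f"]
        by (cases "S = 0") simp_all
      from power_mono[OF this, of 2] show ?thesis using S0 by (simp add: S_def)
    qed
    have a: "wsummable w a" "(wnorm w a)\<^sup>2 \<le> (C * norm_in X f)\<^sup>2"
      using wnorm_sq_leI[OF w_nonneg part] by auto
    obtain u where u: "u \<in> elements X" "taylor_coeff u = a" using element_of_coeffs[OF a(1)]
      by blast
    have "norm_in X u \<le> C * norm_in X f"
      unfolding norm_eq[OF u(1)] u(2) by (rule power2_le_imp_le[OF a(2)]) (use C norm_nonneg[OF f]
          in auto)
    moreover have "inner_prod X u g = b f g" if g: "g \<in> elements X" for g
    proof -
      let ?t = "\<lambda>N. truncation N (taylor_coeff g)"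
      have t: "?t N \<in> elements X" for N by (rule truncation_element)
      have "inner_prod X u (?t N) = b f (?t N)" for N
      proof -
        have "inner_prod X u (?t N) = (\<Sum>n<N. of_real (w n) * a n * cnj (taylor_coeff g n))"
          unfolding inner[OF u(1) t] wip_def u(2) coeff_truncation
          by (subst suminf_finite[of "{..<N}"]) auto
        then show ?thesis unfolding b_trunc[OF f] bm by (simp add: mult_ac)
      qed
      moreover have "inner_prod X u g = inner_prod X u (?t N) + inner_prod X u (\<lambda>z. g z - ?t N z)"
          for N
        using inner_add_right[OF t element_diff[OF g t] u(1), of N N] by simp
      moreover have "b f g = b f (?t N) + b f (\<lambda>z. g z - ?t N z)" for N
        using b_add(2)[OF t element_diff[OF g t] f, of N N] by simp
      ultimately have eq: "inner_prod X u g - b f g = inner_prod X u (\<lambda>z. g z - ?t N z)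
          - b f (\<lambda>z. g z - ?t N z)" for N
        by (metis add_diff_cancel_left)
      have "cmod (inner_prod X u g - b f g) \<le> (norm_in X u + C * norm_in X f) * norm_in X
          (\<lambda>z. g z - ?t N z)" for N
        unfolding eq[of N]
        using norm_triangle_ineq4[of "inner_prod X u (\<lambda>z. g z - ?t N z)" "b f (\<lambda>z. g z - ?t N z)"]
          Cauchy_Schwarz[OF u(1) element_diff[OF g t], of N] b_le[OF f element_diff[OF g t], of N]
        by (simp add: algebra_simps)
      moreover have "(\<lambda>N. (norm_in X u + C * norm_in X f) * norm_in X (\<lambda>z. g z - ?t N z)) \<longlonglongrightarrow> 0"
        by (rule tendsto_mult_right_zero[OF truncation_tendsto[OF g]])
      ultimately have "cmod (inner_prod X u g - b f g) \<le> 0"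
        by (intro LIMSEQ_le_const) auto
      then show ?thesis by simp
    qed
    ultimately show ?thesis using u by blast
  qed
  then obtain T where T: "\<And>f. f \<in> elements X \<Longrightarrow> T f \<in> elements X"
    "\<And>f. f \<in> elements X \<Longrightarrow> norm_in X (T f) \<le> C * norm_in X f"
    "\<And>f g. f \<in> elements X \<Longrightarrow> g \<in> elements X \<Longrightarrow> inner_prod X (T f) g = b f g"
    by metis
  have unique: "u = v" if "u \<in> elements X" "v \<in> elements X" "\<And>g. g \<in> elements X \<Longrightarrow> inner_prod X u g
      = inner_prod X v g" for u v
    by (rule element_eqI[OF that(1,2)]) (use that(3)[OF monomial_element] that(1,2) w0 in \<open>simp
        add: inner_monomial\<close>)
  have "bounded_op X T"
    unfolding bounded_op_def
  proof (intro conjI ballI allI)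
    fix f g assume fg: "f \<in> elements X" "g \<in> elements X"
    show "T (\<lambda>z. f z + g z) = (\<lambda>z. T f z + T g z)"
      by (rule unique) (auto simp: T fg element_add inner_add_left b_add)
  next
    fix c f assume f: "f \<in> elements X"
    show "T (\<lambda>z. c * f z) = (\<lambda>z. c * T f z)"
      by (rule unique) (auto simp: T f element_cmult inner_cmult_left b_cmult)
  qed (use T in auto)
  then show ?thesis using T that by blast
qed

end

section \<open>Absolute values and the trace class\<close>

text \<open>The coefficients of the power series of \<open>sqrt (1 - x)\<close>.\<close>

definition sqrt_coeff :: "nat \<Rightarrow> real" where
  "sqrt_coeff k = (- 1) ^ k * ((1 / 2) gchoose k)"

lemma sqrt_coeff_0: "sqrt_coeff 0 = 1"
  by (simp add: sqrt_coeff_def)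

lemma sqrt_coeff_Suc: "sqrt_coeff (Suc k) * real (Suc k) = sqrt_coeff k * (real k - 1 / 2)"
proof -
  have "((1 / 2 :: real) gchoose Suc k) * real (Suc k) = ((1 / 2) gchoose k) * (1 / 2 - real k)"
    using gbinomial_absorb_comp[of "1 / 2 :: real" k] gbinomial_absorption[of k "1 / 2 :: real"]
    by (simp add: algebra_simps)
  then show ?thesis
    unfolding sqrt_coeff_def by (simp add: mult.assoc right_diff_distrib)
qed

lemma sqrt_coeff_nonpos: "1 \<le> k \<Longrightarrow> sqrt_coeff k \<le> 0"
proof (induction k rule: nat_induct_at_least)
  case base
  show ?case using sqrt_coeff_Suc[of 0] by (simp add: sqrt_coeff_0)
next
  case (Suc k)
  have "sqrt_coeff (Suc k) * real (Suc k) \<le> 0"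
    unfolding sqrt_coeff_Suc using Suc by (intro mult_nonpos_nonneg) auto
  then show ?case by (simp add: mult_le_0_iff)
qed

text \<open>The partial sums at \<open>x = 1\<close> are explicit. As they are nonnegative while all coefficients
but the first are negative, the series converges absolutely at \<open>x = 1\<close>.\<close>

lemma sqrt_coeff_partial_sum: "(\<Sum>k\<le>m. sqrt_coeff k) = (1 - 2 * real m) * sqrt_coeff m"
proof (induction m)
  case (Suc m)
  then show ?case using sqrt_coeff_Suc[of m] by (simp add: algebra_simps)
qed (simp add: sqrt_coeff_0)

lemma sqrt_coeff_partial_sum_nonneg: "0 \<le> (\<Sum>k\<le>m. sqrt_coeff k)"
  unfolding sqrt_coeff_partial_sum
  by (cases m) (auto simp: sqrt_coeff_0 intro!: mult_nonpos_nonpos sqrt_coeff_nonpos)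

lemma sqrt_coeff_abs_summable: "summable (\<lambda>k. \<bar>sqrt_coeff k\<bar>)"
proof (rule summableI_nonneg_bounded)
  fix n
  have "(\<Sum>k\<le>m. \<bar>sqrt_coeff k\<bar>) = 2 - (\<Sum>k\<le>m. sqrt_coeff k)" for m
    by (induction m) (simp_all add: sqrt_coeff_0 sqrt_coeff_nonpos)
  then have le: "(\<Sum>k\<le>m. \<bar>sqrt_coeff k\<bar>) \<le> 2" for m using sqrt_coeff_partial_sum_nonneg[of m] by simp
  have "(\<Sum>k<n. \<bar>sqrt_coeff k\<bar>) \<le> (\<Sum>k\<le>n. \<bar>sqrt_coeff k\<bar>)" by (rule sum_mono2) auto
  with le[of n] show "(\<Sum>k<n. \<bar>sqrt_coeff k\<bar>) \<le> 2" by simp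
qed simp

text \<open>This is \<open>sqrt (1 - x)\<^sup>2 = 1 - x\<close>, by the Vandermonde identity for the exponent
\<open>1/2 + 1/2\<close>.\<close>

lemma sqrt_coeff_convolution:
  "(\<Sum>i\<le>n. sqrt_coeff i * sqrt_coeff (n - i)) = (if n = 0 then 1 else if n = 1 then - 1 else 0)"
proof -
  have "(\<Sum>i\<le>n. sqrt_coeff i * sqrt_coeff (n - i)) = (- 1) ^ n * (\<Sum>i\<in>{0..n}. ((1 / 2) gchoose i) *
      ((1 / 2) gchoose (n - i)))"
    unfolding sum_distrib_left atMost_atLeast0
  proof (intro sum.cong refl)
    fix i assume "i \<in> {0..n}"
    then have "(- 1 :: real) ^ i * (- 1) ^ (n - i) = (- 1) ^ n" by (simp flip: power_add)
    then show "sqrt_coeff i * sqrt_coeff (n - i)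
        = (- 1) ^ n * (((1 / 2) gchoose i) * ((1 / 2) gchoose (n - i)))"
      unfolding sqrt_coeff_def by (metis mult.assoc mult.left_commute)
  qed
  also have "\<dots> = (- 1) ^ n * (1 gchoose n)"
    unfolding gbinomial_Vandermonde by simp
  also have "(1 gchoose n) = real (1 choose n)" by (simp add: binomial_gbinomial)
  finally show ?thesis by (cases n rule: nat.exhaust) (auto simp: binomial_eq_0)
qed

text \<open>Absolute convergence allows summation along the diagonals \<open>k + j = n\<close>, where the
convolution identity leaves only \<open>n = 0\<close> and \<open>n = 1\<close>. With \<open>m n = \<langle>B\<^sup>n f, g\<rangle>\<close> this squares the
operator \<open>sqrt (1 - B)\<close> inside scalar products.\<close>

lemma sqrt_coeff_double_series:
  fixes m :: "nat \<Rightarrow> complex"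
  assumes D: "\<And>n. cmod (m n) \<le> D"
  shows "(\<Sum>k. of_real (sqrt_coeff k) * (\<Sum>j. of_real (sqrt_coeff j) * m (k + j))) = m 0 - m 1"
proof -
  define F where "F = (\<lambda>(k, j). complex_of_real (sqrt_coeff k) * (of_real (sqrt_coeff j) * m
      (k + j)))"
  have D0: "0 \<le> D" using order_trans[OF norm_ge_zero D] .
  have sc: "(\<lambda>k. \<bar>sqrt_coeff k\<bar>) summable_on UNIV"
    using sqrt_coeff_abs_summable by (intro norm_summable_imp_summable_on) simp
  have "(\<lambda>x. norm ((\<lambda>(k, j). \<bar>sqrt_coeff k\<bar> * \<bar>sqrt_coeff j\<bar>) x)) summable_on UNIV \<times> UNIV"
    by (rule Infinite_Sum.abs_summable_on_Sigma_iff[THEN iffD2])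
      (use sc in \<open>auto simp: abs_mult infsum_cmult_right' intro!: summable_on_cmult_right
          summable_on_cmult_left\<close>)
  then have "(\<lambda>x. norm (D * (case x of (k, j) \<Rightarrow> \<bar>sqrt_coeff k\<bar> * \<bar>sqrt_coeff j\<bar>))) summable_on
      UNIV \<times> UNIV"
    unfolding norm_mult by (rule summable_on_cmult_right)
  then have F_abs: "(\<lambda>x. norm (F x)) summable_on UNIV \<times> UNIV"
  proof (rule Infinite_Sum.abs_summable_on_comparison_test)
    fix x :: "nat \<times> nat"
    obtain k j where x: "x = (k, j)" by fastforce
    have "\<bar>sqrt_coeff k\<bar> * \<bar>sqrt_coeff j\<bar> * cmod (m (k + j)) \<le> \<bar>sqrt_coeff k\<bar> * \<bar>sqrt_coeff j\<bar> * D"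
      by (intro mult_left_mono D) auto
    then show "norm (F x) \<le> norm (D * (case x of (k, j) \<Rightarrow> \<bar>sqrt_coeff k\<bar> * \<bar>sqrt_coeff j\<bar>))"
      using D0 by (simp add: x F_def norm_mult abs_mult mult_ac)
  qed
  then have F: "F summable_on UNIV \<times> UNIV" by (rule abs_summable_summable)
  have suminf_eq: "(\<Sum>k. f k) = infsum f UNIV" if "f summable_on UNIV" for f :: "nat \<Rightarrow> complex"
    using has_sum_imp_sums[OF has_sum_infsum[OF that]] by (simp add: sums_iff)
  have row: "(\<lambda>j. of_real (sqrt_coeff j) * m (k + j)) summable_on UNIV" for k
  proof (rule norm_summable_imp_summable_on, rule summable_comparison_test')
    show "summable (\<lambda>j. \<bar>sqrt_coeff j\<bar> * D)" using sqrt_coeff_abs_summable by (rule summable_mult2)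
    show "norm (norm (of_real (sqrt_coeff j) * m (k + j))) \<le> \<bar>sqrt_coeff j\<bar> * D" for j
      using D by (simp add: norm_mult mult_left_mono)
  qed
  have "(\<Sum>k. of_real (sqrt_coeff k) * (\<Sum>j. of_real (sqrt_coeff j) * m (k + j)))
      = (\<Sum>k. infsum (\<lambda>j. F (k, j)) UNIV)"
    by (intro suminf_cong) (simp add: suminf_eq[OF row] F_def infsum_cmult_right')
  also have "\<dots> = infsum (\<lambda>k. infsum (\<lambda>j. F (k, j)) UNIV) UNIV"
    using summable_on_Sigma_banach[of "\<lambda>k j. F (k, j)" UNIV "\<lambda>_. UNIV"] F
    by (intro suminf_eq) simp
  also have "\<dots> = infsum F (UNIV \<times> UNIV)"
    by (rule infsum_Sigma_banach[OF F])
  also have "\<dots> = infsum (\<lambda>(n, i). F (i, n - i)) (Sigma UNIV (\<lambda>n. {..n}))"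
    by (rule infsum_reindex_bij_witness[where i = "\<lambda>(n, i). (i, n - i)" and j =
        "\<lambda>(k, j). (k + j, k)"])
      auto
  also have "\<dots> = infsum (\<lambda>n. infsum (\<lambda>i. F (i, n - i)) {..n}) UNIV"
  proof -
    have "(\<lambda>(n, i). F (i, n - i)) summable_on (Sigma UNIV (\<lambda>n. {..n})) \<longleftrightarrow> F summable_on UNIV \<times> UNIV"
      by (rule summable_on_reindex_bij_witness[where j = "\<lambda>(n, i). (i, n - i)" and i =
          "\<lambda>(k, j). (k + j, k)"])
        auto
    with F have "(\<lambda>(n, i). F (i, n - i)) summable_on (Sigma UNIV (\<lambda>n. {..n}))" by simp
    from infsum_Sigma_banach[OF this] show ?thesis by simp
  qed
  also have "\<dots> = infsum (\<lambda>n. of_real (\<Sum>i\<le>n. sqrt_coeff i * sqrt_coeff (n - i)) * m n) UNIV"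
    by (intro infsum_cong) (simp add: F_def sum_distrib_right mult.assoc)
  also have "\<dots> = infsum (\<lambda>n. of_real (\<Sum>i\<le>n. sqrt_coeff i * sqrt_coeff (n - i)) * m n) {0, 1}"
    unfolding sqrt_coeff_convolution by (intro infsum_cong_neutral) auto
  also have "\<dots> = m 0 - m 1"
    unfolding sqrt_coeff_convolution by simp
  finally show ?thesis .
qed

context weighted_space
begin

text \<open>The quadratic polynomial \<open>b (f + c g) (f + c g)\<close> in \<open>s\<close>, where \<open>c\<close> is \<open>s\<close> times the phase
that makes the mixed terms real, is nonnegative.\<close>

lemma hermitian_form_Cauchy_Schwarz:
  assumes b: "bounded_form b C"
    and herm: "\<And>f g. f \<in> elements X \<Longrightarrow> g \<in> elements X \<Longrightarrow> b g f = cnj (b f g)"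
    and pos: "\<And>f. f \<in> elements X \<Longrightarrow> 0 \<le> Re (b f f)"
    and f: "f \<in> elements X" and g: "g \<in> elements X"
  shows "(cmod (b f g))\<^sup>2 \<le> Re (b f f) * Re (b g g)"
proof (cases "b f g = 0")
  case True
  then show ?thesis using pos f g by simp
next
  case False
  define m where "m = cmod (b f g)"
  have m: "0 < m" using False by (simp add: m_def)
  have quad: "0 \<le> Re (b f f) - 2 * s * m + s\<^sup>2 * Re (b g g)" for s :: real
  proof -
    \<comment> \<open>The phase of \<open>c\<close> makes \<open>cnj c * b f g = - s m\<close>.\<close>
    define c where "c = - of_real s * b f g / of_real m"
    have cg: "(\<lambda>z. c * g z) \<in> elements X" and fcg: "(\<lambda>z. f z + c * g z) \<in> elements X"
      using f g by (auto intro!: element_add element_cmult)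
    have "b (\<lambda>z. f z + c * g z) (\<lambda>z. f z + c * g z) = b f f + cnj c * b f g
        + (c * cnj (b f g) + c * cnj c * b g g)"
      using b f g cg fcg herm[OF f g] by (simp add: bounded_form_def algebra_simps)
    moreover have "cnj c * b f g = of_real (- s * m)"
    proof -
      have "cnj c * b f g = - of_real s * (b f g * cnj (b f g)) / of_real m" by (simp add: c_def)
      also have "b f g * cnj (b f g) = of_real (m\<^sup>2)" unfolding m_def complex_norm_square ..
      finally show ?thesis using m by (simp add: power2_eq_square)
    qed
    moreover have "c * cnj (b f g) = of_real (- s * m)"
      using arg_cong[OF calculation(2), of cnj] by simp
    moreover have "c * cnj c = of_real (s\<^sup>2)"
    proof -
      have "c * cnj c = of_real ((cmod c)\<^sup>2)" unfolding complex_norm_square ..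
      also have "cmod c = \<bar>s\<bar>" using m by (simp add: c_def norm_mult norm_divide m_def)
      finally show ?thesis by simp
    qed
    ultimately have "Re (b (\<lambda>z. f z + c * g z) (\<lambda>z. f z + c * g z)) = Re (b f f) - 2 * s * m
        + s\<^sup>2 * Re (b g g)"
      by simp
    with pos[OF fcg] show ?thesis by simp
  qed
  show ?thesis
  proof (cases "Re (b g g) = 0")
    case True
    \<comment> \<open>With a vanishing quadratic term the polynomial is affine, and this \<open>s\<close> makes it equal to
        \<open>-1\<close>.\<close>
    have "0 \<le> Re (b f f) - 2 * ((Re (b f f) + 1) / (2 * m)) * m"
      using quad[of "(Re (b f f) + 1) / (2 * m)"] True by simp
    then show ?thesis using m by (simp add: field_simps)
  next
    case False
    then have G: "0 < Re (b g g)" using pos[OF g] by simp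
    have "0 \<le> Re (b f f) - 2 * (m / Re (b g g)) * m + (m / Re (b g g))\<^sup>2 * Re (b g g)"
      by (rule quad)
    also have "\<dots> = Re (b f f) - m\<^sup>2 / Re (b g g)" using G
      by (simp add: field_simps power2_eq_square)
    finally show ?thesis using G by (simp add: m_def field_simps)
  qed
qed

lemma bounded_opD:
  assumes "bounded_op X S"
  shows "f \<in> elements X \<Longrightarrow> S f \<in> elements X"
    "f \<in> elements X \<Longrightarrow> g \<in> elements X \<Longrightarrow> S (\<lambda>z. f z + g z) = (\<lambda>z. S f z + S g z)"
    "f \<in> elements X \<Longrightarrow> S (\<lambda>z. c * f z) = (\<lambda>z. c * S f z)"
    "\<exists>C>0. \<forall>f\<in>elements X. norm_in X (S f) \<le> C * norm_in X f"
proof -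
  obtain C where C: "\<forall>f\<in>elements X. norm_in X (S f) \<le> C * norm_in X f"
    using assms by (auto simp: bounded_op_def)
  have "norm_in X (S f) \<le> (\<bar>C\<bar> + 1) * norm_in X f" if f: "f \<in> elements X" for f
    using C f mult_right_mono[of C "\<bar>C\<bar> + 1" "norm_in X f"] norm_nonneg[OF f] by force
  then show "\<exists>C>0. \<forall>f\<in>elements X. norm_in X (S f) \<le> C * norm_in X f"
    by (intro exI[of _ "\<bar>C\<bar> + 1"]) auto
qed (use assms in \<open>auto simp: bounded_op_def\<close>)

text \<open>If \<open>C\<close> bounds \<open>S\<close> then \<open>B = 1 - S* S / C\<^sup>2\<close> satisfies \<open>0 \<le> B \<le> 1\<close>, so it is a contraction
by the Cauchy-Schwarz inequality for its form, and the binomial series for \<open>C sqrt (1 - B)\<close>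
converges. It is positive because \<open>\<langle>B\<^sup>k f, f\<rangle> \<le> \<parallel>f\<parallel>\<^sup>2\<close> and the coefficients, of which only the
first is positive, have a nonnegative sum. All operators are obtained from their forms; neither
adjoints nor convergence of operators has to be discussed.\<close>

lemma absolute_value_exists:
  assumes S: "bounded_op X S"
  obtains P where "is_absolute_value X P S"
proof -
  note SE = bounded_opD(1)[OF S] and S_add = bounded_opD(2)[OF S] and S_cmult = bounded_opD(3)[OF S]
  obtain C where C: "0 < C" "\<And>f. f \<in> elements X \<Longrightarrow> norm_in X (S f) \<le> C * norm_in X f"
    using bounded_opD(4)[OF S] by blast
  define b where "b = (\<lambda>f g. inner_prod X f g - inner_prod X (S f) (S g) / of_real (C\<^sup>2))"
  have herm: "b g f = cnj (b f g)" if "f \<in> elements X" "g \<in> elements X" for f g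
    using that inner_cnj[of f g] inner_cnj[OF SE SE, of f g] by (simp add: b_def)
  have b_self: "b f f = of_real ((norm_in X f)\<^sup>2 - (norm_in X (S f))\<^sup>2 / C\<^sup>2)" if f:
      "f \<in> elements X" for f
    using f C by (simp add: b_def inner_self SE)
  have pos: "0 \<le> Re (b f f)" "Re (b f f) \<le> (norm_in X f)\<^sup>2" if f: "f \<in> elements X" for f
  proof -
    have "(norm_in X (S f))\<^sup>2 \<le> C\<^sup>2 * (norm_in X f)\<^sup>2"
      using power_mono[OF C(2)[OF f] norm_nonneg[OF SE[OF f]], of 2]
        by (simp add: power_mult_distrib)
    then show "0 \<le> Re (b f f)" using C by (simp add: b_self[OF f] field_simps)
    show "Re (b f f) \<le> (norm_in X f)\<^sup>2" by (simp add: b_self[OF f])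
  qed
  have b_form: "bounded_form b 2"
    unfolding bounded_form_def
  proof (intro conjI ballI allI)
    fix f g h assume fgh: "f \<in> elements X" "g \<in> elements X" "h \<in> elements X"
    show "b (\<lambda>z. f z + g z) h = b f h + b g h" "b h (\<lambda>z. f z + g z) = b h f + b h g"
      using fgh by (simp_all add: b_def S_add inner_add_left inner_add_right SE add_divide_distrib)
  next
    fix c f h assume fh: "f \<in> elements X" "h \<in> elements X"
    show "b (\<lambda>z. c * f z) h = c * b f h" "b h (\<lambda>z. c * f z) = cnj c * b h f"
      using fh by (simp_all add: b_def S_cmult inner_cmult_left inner_cmult_right SE
          right_diff_distrib)
  next
    fix f g assume fg: "f \<in> elements X" "g \<in> elements X"
    have "cmod (inner_prod X (S f) (S g)) \<le> (C * norm_in X f) * (C * norm_in X g)"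
      using fg C by (intro order_trans[OF Cauchy_Schwarz] mult_mono SE norm_nonneg)
          (auto simp: norm_nonneg)
    then have "cmod (inner_prod X (S f) (S g) / of_real (C\<^sup>2)) \<le> norm_in X f * norm_in X g"
      using C by (simp add: norm_divide divide_le_eq power2_eq_square mult_ac norm_mult)
    then show "cmod (b f g) \<le> 2 * (norm_in X f * norm_in X g)"
      unfolding b_def using Cauchy_Schwarz[OF fg] by (intro order_trans[OF norm_triangle_ineq4])
          simp
  qed simp
  have b_le: "cmod (b f g) \<le> norm_in X f * norm_in X g" if fg: "f \<in> elements X" "g \<in> elements X"
      for f g
  proof (rule power2_le_imp_le)
    have "(cmod (b f g))\<^sup>2 \<le> Re (b f f) * Re (b g g)"
      by (rule hermitian_form_Cauchy_Schwarz[OF b_form herm pos(1) fg])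
    also have "\<dots> \<le> (norm_in X f)\<^sup>2 * (norm_in X g)\<^sup>2"
      using pos fg by (intro mult_mono) auto
    finally show "(cmod (b f g))\<^sup>2 \<le> (norm_in X f * norm_in X g)\<^sup>2"
      by (simp add: power_mult_distrib)
  qed (use fg norm_nonneg in simp)
  \<comment> \<open>The constant one is what makes the iterates of the represented operator bounded.\<close>
  have "bounded_form b 1"
    using b_form b_le by (simp add: bounded_form_def)
  then obtain B where B: "bounded_op X B" "\<And>f. f \<in> elements X \<Longrightarrow> norm_in X (B f) \<le> 1 * norm_in X f"
    "\<And>f g. f \<in> elements X \<Longrightarrow> g \<in> elements X \<Longrightarrow> inner_prod X (B f) g = b f g"
    by (rule Riesz_representation) (rule that)
  note BE = bounded_opD(1)[OF B(1)] and B_add = bounded_opD(2)[OF B(1)] and B_cmult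
      = bounded_opD(3)[OF B(1)]
  have BkE: "(B ^^ k) f \<in> elements X" if "f \<in> elements X" for k f
    by (induction k) (auto simp: that BE)
  have Bk_norm: "norm_in X ((B ^^ k) f) \<le> norm_in X f" if f: "f \<in> elements X" for k f
  proof (induction k)
    case (Suc k)
    then show ?case using B(2)[OF BkE[OF f], of k] by simp
  qed simp
  have Bk_add: "(B ^^ k) (\<lambda>z. f z + g z) = (\<lambda>z. (B ^^ k) f z + (B ^^ k) g z)"
    if "f \<in> elements X" "g \<in> elements X" for k f g
    by (induction k) (auto simp: B_add BkE that)
  have Bk_cmult: "(B ^^ k) (\<lambda>z. c * f z) = (\<lambda>z. c * (B ^^ k) f z)" if "f \<in> elements X" for k c f
    by (induction k) (auto simp: B_cmult BkE that)
  have B_sym: "inner_prod X (B f) g = inner_prod X f (B g)" if "f \<in> elements X" "g \<in> elements X"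
      for f g
    using that B(3)[of f g] B(3)[of g f] herm[of f g] inner_cnj[of "B g" f] by (simp add: BE)
  have Bk_sym: "inner_prod X ((B ^^ k) f) g = inner_prod X f ((B ^^ k) g)"
    if "f \<in> elements X" "g \<in> elements X" for k f g
    using that
  proof (induction k arbitrary: f)
    case (Suc k)
    have "inner_prod X ((B ^^ Suc k) f) g = inner_prod X ((B ^^ k) (B f)) g"
      by (simp add: funpow_swap1)
    also have "\<dots> = inner_prod X (B f) ((B ^^ k) g)" using Suc by (simp add: BE)
    also have "\<dots> = inner_prod X f (B ((B ^^ k) g))" using Suc by (simp add: B_sym BkE)
    finally show ?case by simp
  qed simp
  have m_le: "cmod (inner_prod X ((B ^^ k) f) g) \<le> norm_in X f * norm_in X g"
    if "f \<in> elements X" "g \<in> elements X" for k f g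
    using that by (intro order_trans[OF Cauchy_Schwarz] mult_right_mono Bk_norm norm_nonneg BkE)
  define q where "q = (\<lambda>f g. \<Sum>k. of_real (sqrt_coeff k) * inner_prod X ((B ^^ k) f) g)"
  have q_abs: "summable (\<lambda>k. cmod (of_real (sqrt_coeff k) * inner_prod X ((B ^^ k) f) g))"
    if fg: "f \<in> elements X" "g \<in> elements X" for f g
  proof (rule summable_comparison_test')
    show "summable (\<lambda>k. \<bar>sqrt_coeff k\<bar> * (norm_in X f * norm_in X g))"
      using sqrt_coeff_abs_summable by (rule summable_mult2)
    show "norm (cmod (of_real (sqrt_coeff k) * inner_prod X ((B ^^ k) f) g))
        \<le> \<bar>sqrt_coeff k\<bar> * (norm_in X f * norm_in X g)" for k
      using m_le[OF fg] by (simp add: norm_mult mult_left_mono)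
  qed
  note q_summable = summable_norm_cancel[OF q_abs]
  have q_form: "bounded_form q (\<Sum>k. \<bar>sqrt_coeff k\<bar>)"
    unfolding bounded_form_def
  proof (intro conjI ballI allI)
    show "0 \<le> (\<Sum>k. \<bar>sqrt_coeff k\<bar>)" using sqrt_coeff_abs_summable by (rule suminf_nonneg) simp
  next
    fix f g h assume fgh: "f \<in> elements X" "g \<in> elements X" "h \<in> elements X"
    show "q (\<lambda>z. f z + g z) h = q f h + q g h"
      using suminf_add[OF q_summable[OF fgh(1,3)] q_summable[OF fgh(2,3)]] fgh
      by (simp add: q_def Bk_add inner_add_left BkE distrib_left)
    show "q h (\<lambda>z. f z + g z) = q h f + q h g"
      using suminf_add[OF q_summable[OF fgh(3,1)] q_summable[OF fgh(3,2)]] fgh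
      by (simp add: q_def inner_add_right BkE distrib_left)
  next
    fix c f h assume fh: "f \<in> elements X" "h \<in> elements X"
    show "q (\<lambda>z. c * f z) h = c * q f h"
      using suminf_mult[OF q_summable[OF fh], of c] fh
      by (simp add: q_def Bk_cmult inner_cmult_left BkE mult_ac)
    show "q h (\<lambda>z. c * f z) = cnj c * q h f"
      using suminf_mult[OF q_summable[OF fh(2,1)], of "cnj c"] fh
      by (simp add: q_def inner_cmult_right BkE mult_ac)
  next
    fix f g assume fg: "f \<in> elements X" "g \<in> elements X"
    have "cmod (q f g) \<le> (\<Sum>k. cmod (of_real (sqrt_coeff k) * inner_prod X ((B ^^ k) f) g))"
      unfolding q_def by (rule summable_norm[OF q_abs[OF fg]])
    also have "\<dots> \<le> (\<Sum>k. \<bar>sqrt_coeff k\<bar> * (norm_in X f * norm_in X g))"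
      by (intro suminf_le q_abs fg summable_mult2 sqrt_coeff_abs_summable)
        (simp add: norm_mult mult_left_mono m_le[OF fg])
    also have "\<dots> = (\<Sum>k. \<bar>sqrt_coeff k\<bar>) * (norm_in X f * norm_in X g)"
      by (rule suminf_mult2[symmetric, OF sqrt_coeff_abs_summable])
    finally show "cmod (q f g) \<le> (\<Sum>k. \<bar>sqrt_coeff k\<bar>) * (norm_in X f * norm_in X g)" .
  qed
  obtain R where R: "bounded_op X R" "\<And>f g. f \<in> elements X \<Longrightarrow> g \<in> elements X \<Longrightarrow> inner_prod X (R f) g
      = q f g"
    by (rule Riesz_representation[OF q_form]) (rule that)
  note RE = bounded_opD(1)[OF R(1)]
  have R_pos: "inner_prod X (R f) f \<in> \<real>\<^sub>\<ge>\<^sub>0" if f: "f \<in> elements X" for f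
  proof -
    define x where "x = (\<lambda>k. Re (inner_prod X ((B ^^ k) f) f))"
    have x: "inner_prod X ((B ^^ k) f) f = of_real (x k)" for k
    proof -
      have "inner_prod X ((B ^^ k) f) f = cnj (inner_prod X ((B ^^ k) f) f)"
        using Bk_sym[OF f f, of k] inner_cnj[OF BkE[OF f] f, of k] by simp
      then show ?thesis by (simp add: x_def complex_eq_iff)
    qed
    have x_le: "x k \<le> (norm_in X f)\<^sup>2" for k
      using m_le[OF f f, of k] unfolding x by (simp add: power2_eq_square abs_le_iff)
    have x0: "x 0 = (norm_in X f)\<^sup>2" by (simp add: x_def inner_self[OF f])
    have sx: "summable (\<lambda>k. sqrt_coeff k * x k)"
      using q_abs[OF f f] unfolding x by (intro summable_norm_cancel[of "\<lambda>k. sqrt_coeff k * x k"])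
          (simp add: norm_mult abs_mult)
    have sc: "summable sqrt_coeff" using sqrt_coeff_abs_summable by (rule summable_rabs_cancel)
    have "(\<lambda>m. \<Sum>k\<le>m. sqrt_coeff k) \<longlonglongrightarrow> suminf sqrt_coeff" using sc by (rule summable_LIMSEQ')
    then have sc0: "0 \<le> suminf sqrt_coeff"
      by (rule LIMSEQ_le_const) (use sqrt_coeff_partial_sum_nonneg in auto)
    have "0 \<le> suminf sqrt_coeff * (norm_in X f)\<^sup>2" using sc0 by simp
    also have "\<dots> = (\<Sum>k. sqrt_coeff k * (norm_in X f)\<^sup>2)" using sc by (rule suminf_mult2)
    also have "\<dots> \<le> (\<Sum>k. sqrt_coeff k * x k)"
    proof (intro suminf_le sx summable_mult2 sc)
      fix k show "sqrt_coeff k * (norm_in X f)\<^sup>2 \<le> sqrt_coeff k * x k"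
        using x0 x_le[of k] sqrt_coeff_nonpos[of k] by (cases k) (auto intro: mult_left_mono_neg)
    qed
    finally have "0 \<le> (\<Sum>k. sqrt_coeff k * x k)" .
    moreover have "inner_prod X (R f) f = of_real (\<Sum>k. sqrt_coeff k * x k)"
      unfolding R(2)[OF f f] q_def x using suminf_of_real[OF sx, where 'a = complex] by simp
    ultimately show ?thesis by simp
  qed
  have R_square: "inner_prod X (R (R f)) g = inner_prod X (S f) (S g) / of_real (C\<^sup>2)"
    if fg: "f \<in> elements X" "g \<in> elements X" for f g
  proof -
    define m where "m = (\<lambda>n. inner_prod X ((B ^^ n) f) g)"
    have "inner_prod X ((B ^^ k) (R f)) g = (\<Sum>j. of_real (sqrt_coeff j) * m (k + j))" for k
    proof -
      have "inner_prod X ((B ^^ k) (R f)) g = q f ((B ^^ k) g)"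
        using fg by (simp add: Bk_sym RE R(2) BkE)
      also have "\<dots> = (\<Sum>j. of_real (sqrt_coeff j) * m (k + j))"
        unfolding q_def m_def using fg by (simp add: Bk_sym[symmetric] BkE funpow_add)
      finally show ?thesis .
    qed
    then have "inner_prod X (R (R f)) g
        = (\<Sum>k. of_real (sqrt_coeff k) * (\<Sum>j. of_real (sqrt_coeff j) * m (k + j)))"
      using fg by (simp add: R(2) RE q_def)
    also have "\<dots> = m 0 - m 1"
      by (rule sqrt_coeff_double_series[of m "norm_in X f * norm_in X g"]) (simp add: m_def m_le fg)
    also have "\<dots> = inner_prod X (S f) (S g) / of_real (C\<^sup>2)"
      using fg by (simp add: m_def B(3) b_def)
    finally show ?thesis .
  qed
  define P where "P = (\<lambda>f z. of_real C * R f z)"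
  have PE: "P f \<in> elements X" if "f \<in> elements X" for f
    unfolding P_def using that by (intro element_cmult RE)
  have "bounded_op X P"
    unfolding bounded_op_def
  proof (intro conjI ballI allI)
    show "P f \<in> elements X" if "f \<in> elements X" for f using that by (rule PE)
    show "P (\<lambda>z. f z + g z) = (\<lambda>z. P f z + P g z)" if "f \<in> elements X" "g \<in> elements X" for f g
      using that by (simp add: P_def bounded_opD(2)[OF R(1)] distrib_left)
    show "P (\<lambda>z. c * f z) = (\<lambda>z. c * P f z)" if "f \<in> elements X" for c f
      using that by (simp add: P_def bounded_opD(3)[OF R(1)] mult_ac)
    obtain D where D: "\<And>f. f \<in> elements X \<Longrightarrow> norm_in X (R f) \<le> D * norm_in X f"
      using bounded_opD(4)[OF R(1)] by blast
    have "norm_in X (P f) \<le> (C * D) * norm_in X f" if f: "f \<in> elements X" for f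
      unfolding P_def norm_cmult[OF RE[OF f]] using C(1) D[OF f] by (simp add: mult.assoc)
    then show "\<exists>D. \<forall>f\<in>elements X. norm_in X (P f) \<le> D * norm_in X f" by blast
  qed
  moreover have "inner_prod X (P f) f \<in> \<real>\<^sub>\<ge>\<^sub>0" if f: "f \<in> elements X" for f
    unfolding P_def inner_cmult_left[OF RE[OF f] f] using R_pos[OF f] C(1)
    by (intro nonneg_Reals_mult_I) auto
  moreover have "inner_prod X (P (P f)) g = inner_prod X (S f) (S g)" if fg: "f \<in> elements X"
      "g \<in> elements X" for f g
  proof -
    have "P (P f) = (\<lambda>z. of_real (C\<^sup>2) * R (R f) z)"
      using fg by (simp add: P_def bounded_opD(3)[OF R(1)] RE power2_eq_square mult.assoc)
    then show ?thesis
      using fg C(1) by (simp add: inner_cmult_left RE R_square)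
  qed
  ultimately have "is_absolute_value X P S" by (simp add: is_absolute_value_def positive_op_def)
  then show ?thesis by (rule that)
qed

definition normalized_monomial :: "nat \<Rightarrow> complex \<Rightarrow> complex" where
  "normalized_monomial n = (\<lambda>z. of_real (1 / sqrt (w n)) * monomial n z)"

lemma normalized_monomial_element: "normalized_monomial n \<in> elements X"
  unfolding normalized_monomial_def by (intro element_cmult monomial_element)

lemma inner_normalized_monomial:
  "f \<in> elements X \<Longrightarrow> inner_prod X f (normalized_monomial n) = of_real (sqrt (w n)) * taylor_coeff f
      n"
proof -
  assume f: "f \<in> elements X"
  have "0 < w n" using w_ge[of n] by simp
  have "inner_prod X f (normalized_monomial n) = of_real (w n / sqrt (w n)) * taylor_coeff f n"
    unfolding normalized_monomial_def inner_cmult_right[OF monomial_element f]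
        inner_monomial[OF f] by simp
  also have "w n / sqrt (w n) = sqrt (w n)" by (rule real_div_sqrt) (simp add: w_nonneg)
  finally show ?thesis .
qed

lemma coeff_normalized_monomial: "taylor_coeff (normalized_monomial n) m
    = (if m = n then of_real (1 / sqrt (w n)) else 0)"
  unfolding normalized_monomial_def coeff_cmult[OF monomial_element] by (simp add: coeff_monomial)

lemma inner_normalized_monomials:
  "inner_prod X (normalized_monomial m) (normalized_monomial n) = (if m = n then 1 else 0)"
proof -
  have "0 < w n" using w_ge[of n] by simp
  then show ?thesis
    by (auto simp: inner_normalized_monomial[OF normalized_monomial_element]
        coeff_normalized_monomial simp flip: of_real_mult)
qed

lemma inj_normalized_monomial: "inj normalized_monomial"
proof (rule injI)
  fix m n assume "normalized_monomial m = normalized_monomial n"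
  then show "m = n"
    using inner_normalized_monomials[of m n] inner_normalized_monomials[of n n]
      by (auto split: if_splits)
qed

lemma orthonormal_basis_monomials: "orthonormal_basis X (range normalized_monomial)"
  unfolding orthonormal_basis_def
proof (intro conjI ballI impI)
  show "range normalized_monomial \<subseteq> elements X" using normalized_monomial_element by blast
next
  fix d e assume "d \<in> range normalized_monomial" "e \<in> range normalized_monomial"
  then show "inner_prod X d e = (if d = e then 1 else 0)"
    using inj_normalized_monomial by (auto simp: inner_normalized_monomials dest: injD)
next
  fix f assume f: "f \<in> elements X" and 0: "\<forall>e\<in>range normalized_monomial. inner_prod X f e = 0"
  show "f = (\<lambda>z. 0)"
  proof (rule element_eqI[OF f element_zero])
    fix n
    have "of_real (sqrt (w n)) * taylor_coeff f n = 0"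
      using 0 inner_normalized_monomial[OF f, of n] by auto
    moreover have "w n \<noteq> 0" using w_ge[of n] by auto
    ultimately show "taylor_coeff f n = taylor_coeff (\<lambda>z. 0) n" by (simp add: taylor_coeff_def)
  qed
qed

text \<open>Positivity makes the absolute value \<open>P\<close> symmetric by polarization, hence \<open>\<parallel>P e\<parallel> = \<parallel>S e\<parallel>\<close>,
and \<open>|\<langle>P e, e\<rangle>| \<le> \<parallel>P e\<parallel>\<close> for unit vectors.\<close>

lemma trace_class_of_summable_norms:
  assumes S: "bounded_op X S" and sum: "summable (\<lambda>n. norm_in X (S (normalized_monomial n)))"
  shows "trace_class X S"
proof -
  obtain P where P: "is_absolute_value X P S" using absolute_value_exists[OF S] by blast
  let ?e = normalized_monomial
  have bP: "bounded_op X P" and P_sq: "\<And>f g. f \<in> elements X \<Longrightarrow> g \<in> elements X \<Longrightarrow>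
      inner_prod X (P (P f)) g = inner_prod X (S f) (S g)"
    and P_pos: "\<And>f. f \<in> elements X \<Longrightarrow> inner_prod X (P f) f \<in> \<real>\<^sub>\<ge>\<^sub>0"
    using P by (auto simp: is_absolute_value_def positive_op_def)
  have P_sym: "inner_prod X (P f) g = inner_prod X f (P g)" if fg: "f \<in> elements X"
      "g \<in> elements X" for f g
  proof -
    have Im0: "Im (inner_prod X (P h) h) = 0" if "h \<in> elements X" for h
      using P_pos[OF that] by (simp add: complex_nonneg_Reals_iff)
    note PE = bounded_opD(1)[OF bP]
    have expand: "inner_prod X (P (\<lambda>z. f z + c * g z)) (\<lambda>z. f z + c * g z) =
       inner_prod X (P f) f + cnj c * inner_prod X (P f) g + c * inner_prod X (P g) f + c *
           (cnj c * inner_prod X (P g) g)" for c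
      using fg by (simp add: bounded_opD(2,3)[OF bP] element_cmult element_add PE inner_add_left
          inner_add_right
          inner_cmult_left inner_cmult_right algebra_simps)
    have "Im (inner_prod X (P f) g) = - Im (inner_prod X (P g) f)"
      using Im0[OF element_add[OF fg(1) element_cmult[OF fg(2)], of 1]] Im0[OF fg(1)] Im0[OF fg(2)]
      unfolding expand by simp
    moreover have "Re (inner_prod X (P f) g) = Re (inner_prod X (P g) f)"
      using Im0[OF element_add[OF fg(1) element_cmult[OF fg(2)], of \<i>]] Im0[OF fg(1)] Im0[OF fg(2)]
      unfolding expand by simp
    ultimately have "inner_prod X (P f) g = cnj (inner_prod X (P g) f)"
      by (simp add: complex_eq_iff)
    then show ?thesis using inner_cnj[OF PE[OF fg(2)] fg(1)] by simp
  qed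
  have norm_P: "norm_in X (P f) = norm_in X (S f)" if f: "f \<in> elements X" for f
  proof -
    have Pf: "P f \<in> elements X" and Sf: "S f \<in> elements X"
      using bounded_opD(1)[OF bP f] bounded_opD(1)[OF S f] by auto
    have "complex_of_real ((norm_in X (P f))\<^sup>2) = of_real ((norm_in X (S f))\<^sup>2)"
      unfolding inner_self[OF Pf, symmetric] inner_self[OF Sf, symmetric]
      using P_sym[OF Pf f] P_sq[OF f f] by simp
    then have "(norm_in X (P f))\<^sup>2 = (norm_in X (S f))\<^sup>2" by (simp only: of_real_eq_iff)
    then show ?thesis using norm_nonneg[OF Pf] norm_nonneg[OF Sf]
      by (simp add: power2_eq_iff_nonneg)
  qed
  have "norm_in X (?e n) = 1" for n
    using inner_self[OF normalized_monomial_element, of n]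
        norm_nonneg[OF normalized_monomial_element, of n]
    by (simp add: inner_normalized_monomials power2_eq_1_iff flip: of_real_power)
  then have le: "norm (inner_prod X (P (?e n)) (?e n)) \<le> norm_in X (S (?e n))" for n
    using Cauchy_Schwarz[OF bounded_opD(1)[OF bP normalized_monomial_element]
        normalized_monomial_element, of n n]
    by (simp add: norm_P normalized_monomial_element)
  have "(\<lambda>n. inner_prod X (P (?e n)) (?e n)) summable_on UNIV"
    by (rule norm_summable_imp_summable_on, rule summable_comparison_test'[OF sum]) (simp add: le)
  then have "(\<lambda>e. inner_prod X (P e) e) summable_on range ?e"
    by (subst summable_on_reindex[OF inj_normalized_monomial]) (simp add: o_def)
  then show ?thesis
    unfolding trace_class_def using S P orthonormal_basis_monomials by blast
qed

end

section \<open>Growth of composition with the flow\<close>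

text \<open>The weight enters the growth bound only through the inequality for the energy rate, which
has a different proof for each of the two spaces.\<close>

locale composition_semigroup = inward_field G M K c \<rho>\<^sub>0 + weighted_space X w
  for G :: "complex \<Rightarrow> complex" and M K c \<rho>\<^sub>0 :: real
    and X :: hilbert_fun_space and w :: "nat \<Rightarrow> real" +
  assumes dissipative: "\<And>r f. \<rho>\<^sub>0 \<le> r \<Longrightarrow> r < 1 \<Longrightarrow> f holomorphic_on unit_disc \<Longrightarrow>
    energy_rate (radial_weight w r) G f \<le> cmod (G 0) / r * (wnorm (radial_weight w r)
        (taylor_coeff f))\<^sup>2"
begin

definition \<omega> :: real where "\<omega> = cmod (G 0) / \<rho>\<^sub>0"

lemma \<omega>_nonneg: "0 \<le> \<omega>"
  using \<rho>\<^sub>0 by (simp add: \<omega>_def)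

definition radial_norm :: "real \<Rightarrow> (complex \<Rightarrow> complex) \<Rightarrow> real" where
  "radial_norm r u = wnorm (radial_weight w r) (taylor_coeff u)"

lemma radial_weight_nonneg: "0 \<le> r \<Longrightarrow> 0 \<le> radial_weight w r n"
  by (simp add: radial_weight_def w_nonneg)

lemma radial_summable: "0 < r \<Longrightarrow> r < 1 \<Longrightarrow> u holomorphic_on unit_disc \<Longrightarrow>
    wsummable (radial_weight w r) (taylor_coeff u)"
  by (intro radial_wsummable w_nonneg w_le)

lemma radial_norm_nonneg: "0 < r \<Longrightarrow> r < 1 \<Longrightarrow> u holomorphic_on unit_disc \<Longrightarrow> 0 \<le> radial_norm r u"
  unfolding radial_norm_def by (intro wnorm_nonneg radial_weight_nonneg radial_summable) auto

lemma radial_norm_cong: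
  "u holomorphic_on unit_disc \<Longrightarrow> (\<And>z. z \<in> unit_disc \<Longrightarrow> v z = u z) \<Longrightarrow> radial_norm r v = radial_norm r u"
  unfolding radial_norm_def using taylor_coeff_cong[of u v] by presburger

lemma radial_norm_triangle:
  assumes "0 < r" "r < 1" "u holomorphic_on unit_disc" "v holomorphic_on unit_disc"
  shows "radial_norm r (\<lambda>z. u z + v z) \<le> radial_norm r u + radial_norm r v"
proof -
  have "taylor_coeff (\<lambda>z. u z + v z) = (\<lambda>n. taylor_coeff u n + taylor_coeff v n)"
    using assms by (intro ext taylor_coeff_add)
  then show ?thesis
    unfolding radial_norm_def using assms
    by (simp add: wnorm_triangle radial_weight_nonneg radial_summable)
qed

lemma radial_norm_cmult:
  assumes "0 < r" "r < 1" "u holomorphic_on unit_disc"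
  shows "radial_norm r (\<lambda>z. a * u z) = cmod a * radial_norm r u"
proof -
  have "taylor_coeff (\<lambda>z. a * u z) = (\<lambda>n. a * taylor_coeff u n)"
    using assms by (intro ext taylor_coeff_cmult)
  then show ?thesis
    unfolding radial_norm_def using assms
    by (simp add: wnorm_cmult radial_weight_nonneg radial_summable)
qed

lemma radial_norm_sup:
  assumes "0 < r" "r < R" "R < 1" "u holomorphic_on unit_disc" "\<And>z. cmod z \<le> R \<Longrightarrow> cmod (u z) \<le> B"
  shows "radial_norm r u \<le> sqrt (radial_const r R) * B"
proof -
  have B: "0 \<le> B"
    by (rule order_trans[OF norm_ge_zero assms(5)[of 0]]) (use assms in simp)
  have "sqrt ((radial_norm r u)\<^sup>2) \<le> sqrt (radial_const r R * B\<^sup>2)"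
    unfolding radial_norm_def
    by (rule real_sqrt_le_mono, rule radial_norm_le_sup(2)[OF w_nonneg w_le assms])
  then show ?thesis
    using radial_norm_nonneg[of r u] assms B by (simp add: real_sqrt_mult)
qed

lemma radial_norm_le_norm:
  assumes "0 < r" "r < 1" "u \<in> elements X"
  shows "radial_norm r u \<le> norm_in X u"
proof (rule power2_le_imp_le[OF _ norm_nonneg[OF assms(3)]])
  have rw: "0 \<le> radial_weight w r n" for n using assms by (simp add: radial_weight_nonneg)
  show "(radial_norm r u)\<^sup>2 \<le> (norm_in X u)\<^sup>2"
    unfolding radial_norm_def
  proof (rule wnorm_sq_leI(2)[OF rw])
    fix N
    have "(\<Sum>n<N. radial_weight w r n * (cmod (taylor_coeff u n))\<^sup>2)
        \<le> (\<Sum>n<N. w n * (cmod (taylor_coeff u n))\<^sup>2)"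
      unfolding radial_weight_def using assms w_nonneg
      by (intro sum_mono mult_right_mono mult_left_le) (auto intro: power_le_one)
    also have "\<dots> \<le> (norm_in X u)\<^sup>2"
      unfolding norm_eq[OF assms(3)]
        by (rule wsum_le_wnorm_sq[OF w_nonneg element_wsummable[OF assms(3)]])
    finally show "(\<Sum>n<N. radial_weight w r n * (cmod (taylor_coeff u n))\<^sup>2) \<le> (norm_in X u)\<^sup>2" .
  qed
qed

text \<open>Let \<open>r \<rightarrow> 1\<close> in each partial sum. This both shows membership in the space and bounds the
norm.\<close>

lemma norm_le_of_radial:
  assumes u: "u holomorphic_on unit_disc" "\<And>z. z \<notin> unit_disc \<Longrightarrow> u z = 0"
    and le: "\<And>r. \<rho>\<^sub>1 \<le> r \<Longrightarrow> r < 1 \<Longrightarrow> radial_norm r u \<le> A"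
  shows "u \<in> elements X" "norm_in X u \<le> A"
proof -
  have A: "0 \<le> A" using le[of \<rho>\<^sub>1] radial_norm_nonneg[of \<rho>\<^sub>1 u] \<rho>\<^sub>1 u by simp
  have part: "(\<Sum>n<N. w n * (cmod (taylor_coeff u n))\<^sup>2) \<le> A\<^sup>2" for N
  proof (rule tendsto_upperbound)
    show "((\<lambda>r. \<Sum>n<N. radial_weight w r n * (cmod (taylor_coeff u n))\<^sup>2) \<longlongrightarrow>
        (\<Sum>n<N. w n * (cmod (taylor_coeff u n))\<^sup>2)) (at_left 1)"
    proof -
      have "((\<lambda>r. \<Sum>n<N. radial_weight w r n * (cmod (taylor_coeff u n))\<^sup>2) \<longlongrightarrow>
        (\<Sum>n<N. (w n * 1 ^ (2 * n)) * (cmod (taylor_coeff u n))\<^sup>2)) (at_left 1)"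
        unfolding radial_weight_def by (intro tendsto_intros)
      then show ?thesis by simp
    qed
    have "eventually (\<lambda>r::real. r \<in> {\<rho>\<^sub>1<..<1}) (at_left 1)"
      by (rule eventually_at_leftI[of \<rho>\<^sub>1]) (use \<rho>\<^sub>1 in auto)
    then show "\<forall>\<^sub>F r in at_left 1. (\<Sum>n<N. radial_weight w r n * (cmod (taylor_coeff u n))\<^sup>2) \<le> A\<^sup>2"
    proof eventually_elim
      case (elim r)
      then have r: "0 < r" "r < 1" "\<rho>\<^sub>1 \<le> r" using \<rho>\<^sub>1 by auto
      have "(\<Sum>n<N. radial_weight w r n * (cmod (taylor_coeff u n))\<^sup>2) \<le> (radial_norm r u)\<^sup>2"
        unfolding radial_norm_def using r u
          by (intro wsum_le_wnorm_sq radial_weight_nonneg radial_summable) auto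
      also have "\<dots> \<le> A\<^sup>2" using le[OF r(3,2)] radial_norm_nonneg[OF r(1,2) u(1)]
        by (intro power_mono)
      finally show ?case .
    qed
  qed simp
  from wnorm_sq_leI[OF w_nonneg part] show "u \<in> elements X"
    using u by (intro elementI)
  then show "norm_in X u \<le> A"
    using power2_le_imp_le[OF wnorm_sq_leI(2)[OF w_nonneg part] A] by (simp add: norm_eq)
qed

lemma holomorphic_comp_flow:
  "f holomorphic_on unit_disc \<Longrightarrow> 0 \<le> t \<Longrightarrow> (\<lambda>z. f (flow t z)) holomorphic_on unit_disc"
  using holomorphic_on_compose_gen[OF flow_holomorphic _ image_subsetI[OF flow_in_disc], of t f]
  by (simp add: o_def)

lemma holomorphic_symbol: "f holomorphic_on unit_disc \<Longrightarrow> (\<lambda>z. G z * deriv f z) holomorphic_on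
    unit_disc"
  using holo by (intro holomorphic_intros) auto

lemma derivative_bounds:
  assumes R: "0 < R" "R < R'" "R' < 1" and f: "f holomorphic_on unit_disc"
      "\<And>z. cmod z \<le> R' \<Longrightarrow> cmod (f z) \<le> B"
    and z: "cmod z \<le> R"
  shows "cmod (deriv f z) \<le> B / (R' - R)" "cmod (deriv (deriv f) z) \<le> 2 * B / (R' - R)\<^sup>2"
proof -
  have sub: "cmod x \<le> R'" if "x \<in> cball z (R' - R)" for x
    using that z norm_triangle_sub[of x z] by (simp add: dist_norm norm_minus_commute)
  have sub': "cball z (R' - R) \<subseteq> unit_disc"
  proof
    fix x assume "x \<in> cball z (R' - R)"
    from le_less_trans[OF sub[OF this] R(3)] show "x \<in> unit_disc" by simp
  qed
  have *: "cmod ((deriv ^^ n) f z) \<le> fact n * B / (R' - R) ^ n" for n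
  proof (rule Cauchy_inequality)
    show "f holomorphic_on ball z (R' - R)"
      by (rule holomorphic_on_subset[OF f(1) order_trans[OF ball_subset_cball sub']])
    show "continuous_on (cball z (R' - R)) f"
      by (rule holomorphic_on_imp_continuous_on[OF holomorphic_on_subset[OF f(1) sub']])
    show "cmod (f x) \<le> B" if "cmod (z - x) = R' - R" for x
      using sub[of x] that by (intro f) (auto simp: dist_norm)
  qed (use R in simp)
  show "cmod (deriv f z) \<le> B / (R' - R)" using *[of 1] by simp
  show "cmod (deriv (deriv f) z) \<le> 2 * B / (R' - R)\<^sup>2" using *[of 2] by (simp add: eval_nat_numeral)
qed

text \<open>Taylor's formula for \<open>f\<close> and the first order expansion of the flow. The error is linear
in the maximum of \<open>|f|\<close> on a slightly larger disc; the constant does not depend on \<open>f\<close>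
otherwise, so the same one serves all functions \<open>f \<circ> \<phi>\<^sub>s\<close>.\<close>

lemma comp_flow_first_order:
  assumes R: "\<rho>\<^sub>1 \<le> R" "R < R'" "R' < 1"
  obtains C where "0 \<le> C"
    "\<And>f B z h. f holomorphic_on unit_disc \<Longrightarrow> (\<And>z. cmod z \<le> R' \<Longrightarrow> cmod (f z) \<le> B) \<Longrightarrow>
      cmod z \<le> R \<Longrightarrow> 0 \<le> h \<Longrightarrow>
      cmod (f (flow h z) - f z - of_real h * (G z * deriv f z)) \<le> C * B * h\<^sup>2"
proof -
  have R1: "R < 1" "0 < R" using R \<rho>\<^sub>1 by auto
  obtain C1 where C1: "0 \<le> C1"
    "\<And>z t. cmod z \<le> R \<Longrightarrow> 0 \<le> t \<Longrightarrow> cmod (flow t z - z - of_real t * G z) \<le> C1 * t\<^sup>2"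
    using flow_first_order[OF R(1) R1(1)] by blast
  define d where "d = R' - R"
  have d: "0 < d" using R by (simp add: d_def)
  define C where "C = 2 / d\<^sup>2 * M\<^sup>2 + C1 / d"
  have "cmod (f (flow h z) - f z - of_real h * (G z * deriv f z)) \<le> C * B * h\<^sup>2"
    if f: "f holomorphic_on unit_disc" and B: "\<And>z. cmod z \<le> R' \<Longrightarrow> cmod (f z) \<le> B"
      and z: "cmod z \<le> R" and h: "0 \<le> h" for f B z h
  proof -
    have B0: "0 \<le> B"
      by (rule order_trans[OF norm_ge_zero B[of 0]]) (use R R1 in simp)
    have der: "cmod (deriv f x) \<le> B / d" "cmod (deriv (deriv f) x) \<le> 2 * B / d\<^sup>2" if
        "cmod x \<le> R" for x
      using derivative_bounds[OF R1(2) R(2,3) f _ that, of B] B unfolding d_def by blast+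
    have zd: "z \<in> unit_disc" using z R1 by simp
    let ?w = "flow h z"
    have w: "cmod ?w \<le> R" by (rule flow_invariant[OF z R(1) R1(1) h])
    have "cmod ((deriv ^^ 0) f ?w - (\<Sum>i\<le>1. (deriv ^^ i) f z * (?w - z) ^ i / fact i))
        \<le> (2 * B / d\<^sup>2) * cmod (?w - z) ^ Suc 1 / fact 1"
    proof (rule complex_Taylor[where S = "cball 0 R"])
      fix x :: complex assume x: "x \<in> cball 0 R"
      then have xd: "x \<in> unit_disc" using R1 by simp
      show "((deriv ^^ i) f has_field_derivative (deriv ^^ Suc i) f x) (at x within cball 0 R)"
          for i
        using holomorphic_derivI[OF holomorphic_higher_deriv[OF f open_ball] open_ball xd] by simp
      show "cmod ((deriv ^^ Suc 1) f x) \<le> 2 * B / d\<^sup>2" using der(2)[of x] x by simp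
    qed (use z w in auto)
    then have t1: "cmod (f ?w - f z - deriv f z * (?w - z)) \<le> (2 * B / d\<^sup>2) * (cmod (?w - z))\<^sup>2"
      by (simp add: eval_nat_numeral algebra_simps)
    also have "\<dots> \<le> (2 * B / d\<^sup>2) * (M * h)\<^sup>2"
      using flow_displacement[OF zd h] B0 by (intro mult_left_mono power_mono) auto
    finally have t2: "cmod (f ?w - f z - deriv f z * (?w - z)) \<le> (2 * B / d\<^sup>2) * (M * h)\<^sup>2" .
    have "cmod (deriv f z * (?w - z - of_real h * G z)) \<le> (B / d) * (C1 * h\<^sup>2)"
      unfolding norm_mult using der(1)[OF z] C1(2)[OF z h] B0 d by (intro mult_mono) auto
    moreover have "f ?w - f z - of_real h * (G z * deriv f z)
        = (f ?w - f z - deriv f z * (?w - z)) + deriv f z * (?w - z - of_real h * G z)"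
      by (simp add: algebra_simps)
    ultimately have "cmod (f ?w - f z - of_real h * (G z * deriv f z)) \<le> (2 * B / d\<^sup>2) * (M * h)\<^sup>2
        + (B / d) * (C1 * h\<^sup>2)"
      using t2 by (simp only:) (intro norm_triangle_le add_mono)
    also have "\<dots> = C * B * h\<^sup>2" by (simp add: C_def power_mult_distrib algebra_simps)
    finally show ?thesis .
  qed
  moreover have "0 \<le> C" using C1 d by (simp add: C_def)
  ultimately show ?thesis using that by blast
qed

text \<open>Expanding the squared norm of \<open>f + h G f' + O(h\<^sup>2)\<close>, the linear term is \<open>2 h\<close> times the
energy rate.\<close>

lemma radial_norm_step:
  assumes r: "\<rho>\<^sub>1 \<le> r" "r < R'" "R' < 1"
  obtains C where "0 \<le> C"
    "\<And>f B h. f holomorphic_on unit_disc \<Longrightarrow> (\<And>z. cmod z \<le> R' \<Longrightarrow> cmod (f z) \<le> B) \<Longrightarrow> 0 \<le> h \<Longrightarrow> h \<le> 1 \<Longrightarrow>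
      (radial_norm r (\<lambda>z. f (flow h z)))\<^sup>2 \<le> (1 + 2 * \<omega> * h) * (radial_norm r f)\<^sup>2 + C * B\<^sup>2 * h\<^sup>2"
proof -
  define R where "R = (r + R') / 2"
  have R: "r < R" "R < R'" "\<rho>\<^sub>1 \<le> R" "0 < r" "r < 1" "R < 1" "0 < R" using r \<rho>\<^sub>1
    by (auto simp: R_def)
  define d where "d = R' - R"
  have d: "0 < d" using R by (simp add: d_def)
  obtain C1 where C1: "0 \<le> C1"
    "\<And>f B z h. f holomorphic_on unit_disc \<Longrightarrow> (\<And>z. cmod z \<le> R' \<Longrightarrow> cmod (f z) \<le> B) \<Longrightarrow>
      cmod z \<le> R \<Longrightarrow> 0 \<le> h \<Longrightarrow>
      cmod (f (flow h z) - f z - of_real h * (G z * deriv f z)) \<le> C1 * B * h\<^sup>2"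
    using comp_flow_first_order[OF R(3,2) r(3)] by blast
  define \<kappa> where "\<kappa> = sqrt (radial_const r R)"
  have \<kappa>: "0 \<le> \<kappa>"
    unfolding \<kappa>_def radial_const_def using R
      by (intro real_sqrt_ge_zero suminf_nonneg radial_const_sums) auto
  define a where "a = \<kappa> * (1 + M / d)"
  define e where "e = \<kappa> * C1"
  define C where "C = (\<kappa> * (M / d))\<^sup>2 + 2 * a * e + e\<^sup>2"
  have ae: "0 \<le> a" "0 \<le> e" using \<kappa> C1 M d by (auto simp: a_def e_def)
  have main: "(radial_norm r (\<lambda>z. f (flow h z)))\<^sup>2 \<le> (1 + 2 * \<omega> * h) * (radial_norm r f)\<^sup>2
      + C * B\<^sup>2 * h\<^sup>2"
    if f: "f holomorphic_on unit_disc" and B: "\<And>z. cmod z \<le> R' \<Longrightarrow> cmod (f z) \<le> B"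
      and h: "0 \<le> h" "h \<le> 1" for f B h
  proof -
    have B0: "0 \<le> B"
      by (rule order_trans[OF norm_ge_zero B[of 0]]) (use R r in simp)
    define v where "v = (\<lambda>z. G z * deriv f z)"
    define u where "u = (\<lambda>z. f z + of_real h * v z)"
    define \<epsilon> where "\<epsilon> = (\<lambda>z. f (flow h z) - f z - of_real h * v z)"
    have v: "v holomorphic_on unit_disc" unfolding v_def by (rule holomorphic_symbol[OF f])
    have hv: "(\<lambda>z. of_real h * v z) holomorphic_on unit_disc" using v by (intro holomorphic_intros)
    have u: "u holomorphic_on unit_disc" unfolding u_def using f v by (intro holomorphic_intros)
    have \<epsilon>: "\<epsilon> holomorphic_on unit_disc"
      unfolding \<epsilon>_def using f v h by (intro holomorphic_intros holomorphic_comp_flow)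
    have nv: "radial_norm r v \<le> \<kappa> * (M / d) * B"
    proof -
      have "radial_norm r v \<le> \<kappa> * (M * (B / d))"
        unfolding \<kappa>_def
      proof (rule radial_norm_sup[OF R(4,1,6) v])
        fix z :: complex assume z: "cmod z \<le> R"
        have "z \<in> unit_disc" using z R by simp
        then show "cmod (v z) \<le> M * (B / d)"
          unfolding v_def norm_mult d_def
          using M derivative_bounds(1)[OF R(7,2) r(3) f _ z] B by (intro mult_mono) auto
      qed
      then show ?thesis by (simp add: mult_ac)
    qed
    have nf: "radial_norm r f \<le> \<kappa> * B"
      unfolding \<kappa>_def by (rule radial_norm_sup[OF R(4,1,6) f B]) (use R in auto)
    have n\<epsilon>: "radial_norm r \<epsilon> \<le> e * B * h\<^sup>2"
    proof -
      have "radial_norm r \<epsilon> \<le> \<kappa> * (C1 * B * h\<^sup>2)"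
        unfolding \<kappa>_def
        by (rule radial_norm_sup[OF R(4,1,6) \<epsilon>]) (unfold \<epsilon>_def v_def, rule C1(2)[OF f B _ h(1)])
      then show ?thesis by (simp add: e_def mult_ac)
    qed
    have nu: "radial_norm r u \<le> a * B"
    proof -
      have "radial_norm r u \<le> radial_norm r f + cmod (of_real h) * radial_norm r v"
        unfolding u_def using radial_norm_triangle[OF R(4,5) f hv] radial_norm_cmult[OF R(4,5) v]
          by simp
      also have "\<dots> \<le> \<kappa> * B + 1 * (\<kappa> * (M / d) * B)"
        using nf nv h radial_norm_nonneg[OF R(4,5) v] by (intro add_mono mult_mono) auto
      finally show ?thesis by (simp add: a_def algebra_simps)
    qed
    have nu2: "(radial_norm r u)\<^sup>2 \<le> (1 + 2 * \<omega> * h) * (radial_norm r f)\<^sup>2 + (\<kappa> * (M / d) * B)\<^sup>2 *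
        h\<^sup>2"
    proof -
      let ?W = "radial_weight w r"
      have W: "0 \<le> ?W n" for n using R by (simp add: radial_weight_nonneg)
      have ws: "wsummable ?W (taylor_coeff g)" if "g holomorphic_on unit_disc" for g
        using radial_summable[OF R(4,5) that] .
      have "taylor_coeff u = (\<lambda>n. taylor_coeff f n + of_real h * taylor_coeff v n)"
        unfolding u_def by (rule ext) (simp add: taylor_coeff_add[OF f hv] taylor_coeff_cmult[OF v])
      then have "(radial_norm r u)\<^sup>2 = (radial_norm r f)\<^sup>2
          + 2 * Re (wip ?W (\<lambda>n. of_real h * taylor_coeff v n) (taylor_coeff f))
          + (wnorm ?W (\<lambda>n. of_real h * taylor_coeff v n))\<^sup>2"
        unfolding radial_norm_def
        using wnorm_add_sq[OF W ws[OF f] wsummable_cmult[OF W ws[OF v]], of "of_real h"] by simp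
      also have "wip ?W (\<lambda>n. of_real h * taylor_coeff v n) (taylor_coeff f)
          = of_real h * wip ?W (taylor_coeff v) (taylor_coeff f)"
        by (rule wip_cmult_left[OF W ws[OF v] ws[OF f]])
      also have "wnorm ?W (\<lambda>n. of_real h * taylor_coeff v n) = h * radial_norm r v"
        unfolding radial_norm_def using wnorm_cmult[OF W ws[OF v], of "of_real h"] h by simp
      also have "Re (of_real h * wip ?W (taylor_coeff v) (taylor_coeff f)) = h * energy_rate ?W G f"
        unfolding energy_rate_def v_def by simp
      finally have eq: "(radial_norm r u)\<^sup>2 = (radial_norm r f)\<^sup>2 + 2 * (h * energy_rate ?W G f)
          + (h * radial_norm r v)\<^sup>2" .
      have "(h * radial_norm r v)\<^sup>2 \<le> (\<kappa> * (M / d) * B)\<^sup>2 * h\<^sup>2"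
        unfolding power_mult_distrib[of h] mult.commute[of "h\<^sup>2"]
        using nv radial_norm_nonneg[OF R(4,5) v] by (intro mult_right_mono power_mono) auto
      moreover have "h * energy_rate ?W G f \<le> h * (\<omega> * (radial_norm r f)\<^sup>2)"
      proof (rule mult_left_mono[OF _ h(1)])
        have "energy_rate ?W G f \<le> cmod (G 0) / r * (radial_norm r f)\<^sup>2"
          unfolding radial_norm_def using r \<rho>\<^sub>1 R by (intro dissipative f) auto
        also have "\<dots> \<le> \<omega> * (radial_norm r f)\<^sup>2"
          unfolding \<omega>_def using r \<rho>\<^sub>1 \<rho>\<^sub>0 by (intro mult_right_mono divide_left_mono) auto
        finally show "energy_rate ?W G f \<le> \<omega> * (radial_norm r f)\<^sup>2" .
      qed
      moreover have "(1 + 2 * \<omega> * h) * (radial_norm r f)\<^sup>2 = (radial_norm r f)\<^sup>2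
          + 2 * (h * (\<omega> * (radial_norm r f)\<^sup>2))"
        by (simp add: algebra_simps)
      ultimately show ?thesis unfolding eq by linarith
    qed
    have "radial_norm r (\<lambda>z. f (flow h z)) \<le> radial_norm r u + radial_norm r \<epsilon>"
    proof -
      have "(\<lambda>z. f (flow h z)) = (\<lambda>z. u z + \<epsilon> z)" by (simp add: u_def \<epsilon>_def)
      then show ?thesis using radial_norm_triangle[OF R(4,5) u \<epsilon>] by simp
    qed
    then have "(radial_norm r (\<lambda>z. f (flow h z)))\<^sup>2 \<le> (radial_norm r u + radial_norm r \<epsilon>)\<^sup>2"
      using h f by (intro power_mono radial_norm_nonneg R holomorphic_comp_flow) auto
    also have "\<dots> = (radial_norm r u)\<^sup>2 + 2 * (radial_norm r u * radial_norm r \<epsilon>)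
        + (radial_norm r \<epsilon>)\<^sup>2"
      by (simp add: power2_sum)
    also have "\<dots> \<le> ((1 + 2 * \<omega> * h) * (radial_norm r f)\<^sup>2 + (\<kappa> * (M / d) * B)\<^sup>2 * h\<^sup>2)
        + 2 * ((a * B) * (e * B * h\<^sup>2)) + e\<^sup>2 * B\<^sup>2 * h\<^sup>2"
    proof (intro add_mono nu2 mult_left_mono mult_mono nu n\<epsilon>)
      have "(radial_norm r \<epsilon>)\<^sup>2 \<le> (e * B * h\<^sup>2)\<^sup>2"
        using n\<epsilon> radial_norm_nonneg[OF R(4,5) \<epsilon>] by (intro power_mono)
      also have "\<dots> = e\<^sup>2 * B\<^sup>2 * h\<^sup>2 * h\<^sup>2"
        by (simp add: power_mult_distrib power2_eq_square mult_ac)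
      also have "\<dots> \<le> e\<^sup>2 * B\<^sup>2 * h\<^sup>2" using h by (intro mult_left_le power_le_one) auto
      finally show "(radial_norm r \<epsilon>)\<^sup>2 \<le> e\<^sup>2 * B\<^sup>2 * h\<^sup>2" .
    qed (use ae B0 radial_norm_nonneg[OF R(4,5) \<epsilon>] in auto)
    also have "\<dots> = (1 + 2 * \<omega> * h) * (radial_norm r f)\<^sup>2 + C * B\<^sup>2 * h\<^sup>2"
      by (simp add: C_def power_mult_distrib power2_eq_square algebra_simps)
    finally show ?thesis .
  qed
  show ?thesis
    by (rule that[of C]) (use ae main in \<open>auto simp: C_def\<close>)
qed

text \<open>Compose \<open>N\<close> steps of length \<open>t / N\<close>. The maximum of \<open>|f \<circ> \<phi>\<^sub>s|\<close> on an invariant disc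
stays below that of \<open>|f|\<close>, so the quadratic errors add up to \<open>O(1 / N)\<close>.\<close>

lemma radial_norm_comp_flow:
  assumes r: "\<rho>\<^sub>1 \<le> r" "r < 1" and f: "f holomorphic_on unit_disc" and t: "0 \<le> t"
  shows "radial_norm r (\<lambda>z. f (flow t z)) \<le> exp (\<omega> * t) * radial_norm r f"
proof -
  define R' where "R' = (1 + r) / 2"
  have R': "r < R'" "R' < 1" "\<rho>\<^sub>1 \<le> R'" "0 < r" using r \<rho>\<^sub>1 by (auto simp: R'_def)
  obtain C where C: "0 \<le> C"
    "\<And>f B h. f holomorphic_on unit_disc \<Longrightarrow> (\<And>z. cmod z \<le> R' \<Longrightarrow> cmod (f z) \<le> B) \<Longrightarrow> 0 \<le> h \<Longrightarrow> h \<le> 1 \<Longrightarrow>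
      (radial_norm r (\<lambda>z. f (flow h z)))\<^sup>2 \<le> (1 + 2 * \<omega> * h) * (radial_norm r f)\<^sup>2 + C * B\<^sup>2 * h\<^sup>2"
    using radial_norm_step[OF r(1) R'(1,2)] by blast
  obtain B where B: "0 \<le> B" "\<And>z. cmod z \<le> R' \<Longrightarrow> cmod (f z) \<le> B"
    using bounded_on_cball[OF f R'(2)] by blast
  let ?E = "(radial_norm r f)\<^sup>2"
  have iter: "(radial_norm r (\<lambda>z. f (flow (real j * h) z)))\<^sup>2
      \<le> (1 + 2 * \<omega> * h) ^ j * (?E + real j * (C * B\<^sup>2 * h\<^sup>2))"
    if h: "0 \<le> h" "h \<le> 1" for h j
  proof (induction j)
    case 0
    have "radial_norm r (\<lambda>z. f (flow (real 0 * h) z)) = radial_norm r f"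
      using f by (intro radial_norm_cong) (simp_all add: flow_0)
    then show ?case by simp
  next
    case (Suc j)
    define q where "q = 1 + 2 * \<omega> * h"
    have q: "1 \<le> q" using \<omega>_nonneg h by (simp add: q_def)
    have jh: "0 \<le> real j * h" using h by simp
    define g where "g = (\<lambda>z. f (flow (real j * h) z))"
    have g: "g holomorphic_on unit_disc" unfolding g_def by (rule holomorphic_comp_flow[OF f jh])
    have gB: "cmod (g z) \<le> B" if "cmod z \<le> R'" for z
      unfolding g_def by (intro B flow_invariant[OF that R'(3,2) jh])
    have "radial_norm r (\<lambda>z. f (flow (real (Suc j) * h) z)) = radial_norm r (\<lambda>z. g (flow h z))"
    proof (rule radial_norm_cong[OF holomorphic_comp_flow[OF g h(1)]])
      fix z :: complex assume "z \<in> unit_disc"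
      from flow_add[OF this jh h(1)]
      show "f (flow (real (Suc j) * h) z) = g (flow h z)" by (simp add: g_def algebra_simps)
    qed
    then have "(radial_norm r (\<lambda>z. f (flow (real (Suc j) * h) z)))\<^sup>2 \<le> q * (radial_norm r g)\<^sup>2
        + C * B\<^sup>2 * h\<^sup>2"
      using C(2)[OF g gB h] by (simp add: q_def)
    also have "\<dots> \<le> q * (q ^ j * (?E + real j * (C * B\<^sup>2 * h\<^sup>2))) + q ^ Suc j * (C * B\<^sup>2 * h\<^sup>2)"
    proof (intro add_mono mult_left_mono)
      show "(radial_norm r g)\<^sup>2 \<le> q ^ j * (?E + real j * (C * B\<^sup>2 * h\<^sup>2))" using Suc
        by (simp add: g_def q_def)
      have "1 \<le> q ^ Suc j" using q by (rule one_le_power)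
      then show "C * B\<^sup>2 * h\<^sup>2 \<le> q ^ Suc j * (C * B\<^sup>2 * h\<^sup>2)"
        using mult_right_mono[of 1 "q ^ Suc j" "C * B\<^sup>2 * h\<^sup>2"] C(1) by simp
    qed (use q in simp)
    also have "\<dots> = q ^ Suc j * (?E + real (Suc j) * (C * B\<^sup>2 * h\<^sup>2))" by (simp add: algebra_simps)
    finally show ?case by (simp add: q_def)
  qed
  have bound: "(radial_norm r (\<lambda>z. f (flow t z)))\<^sup>2
      \<le> exp (2 * \<omega> * t) * (?E + C * B\<^sup>2 * t\<^sup>2 / real N)"
    if N: "0 < N" "t \<le> real N" for N
  proof -
    define h where "h = t / real N"
    have h: "0 \<le> h" "h \<le> 1" "real N * h = t" using N t by (auto simp: h_def)
    have "(radial_norm r (\<lambda>z. f (flow t z)))\<^sup>2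
        \<le> (1 + 2 * \<omega> * h) ^ N * (?E + real N * (C * B\<^sup>2 * h\<^sup>2))"
      using iter[OF h(1,2), of N] by (simp add: h)
    also have "\<dots> \<le> exp (2 * \<omega> * h) ^ N * (?E + real N * (C * B\<^sup>2 * h\<^sup>2))"
      using exp_ge_add_one_self[of "2 * \<omega> * h"] \<omega>_nonneg h C by (intro mult_right_mono power_mono)
          auto
    also have "exp (2 * \<omega> * h) ^ N = exp (2 * \<omega> * t)"
      unfolding exp_of_nat_mult[symmetric] h(3)[symmetric] by (simp add: mult_ac)
    also have "real N * (C * B\<^sup>2 * h\<^sup>2) = C * B\<^sup>2 * t\<^sup>2 / real N"
      using N by (simp add: h_def power2_eq_square)
    finally show ?thesis .
  qed
  have "(radial_norm r (\<lambda>z. f (flow t z)))\<^sup>2 \<le> exp (2 * \<omega> * t) * (?E + 0)"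
  proof (rule tendsto_lowerbound)
    show "(\<lambda>N. exp (2 * \<omega> * t) * (?E + C * B\<^sup>2 * t\<^sup>2 / real N)) \<longlonglongrightarrow> exp (2 * \<omega> * t) * (?E + 0)"
      by (intro tendsto_intros tendsto_divide_0[OF tendsto_const] filterlim_real_sequentially
          filterlim_at_top_imp_at_infinity)
    have "eventually (\<lambda>N. 0 < N \<and> t \<le> real N) sequentially"
      using eventually_gt_at_top[of "0::nat"] eventually_ge_at_top[of "nat \<lceil>t\<rceil>"]
      by eventually_elim linarith
    then show "\<forall>\<^sub>F N in sequentially. (radial_norm r (\<lambda>z. f (flow t z)))\<^sup>2
        \<le> exp (2 * \<omega> * t) * (?E + C * B\<^sup>2 * t\<^sup>2 / real N)"
      by eventually_elim (auto intro: bound)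
  qed simp
  also have "\<dots> = (exp (\<omega> * t) * radial_norm r f)\<^sup>2"
    by (simp add: power_mult_distrib exp_double[symmetric] mult_ac)
  finally show ?thesis
    by (rule power2_le_imp_le) (use radial_norm_nonneg[OF R'(4) r(2) f] in simp)
qed

end

section \<open>The composition semigroup\<close>

context composition_semigroup
begin

definition flow_op :: "real \<Rightarrow> (complex \<Rightarrow> complex) \<Rightarrow> complex \<Rightarrow> complex" where
  "flow_op t f = on_disc (f \<circ> flow t)"

lemma flow_op_apply: "z \<in> unit_disc \<Longrightarrow> flow_op t f z = f (flow t z)"
  by (simp add: flow_op_def on_disc_def)

lemma flow_op_outside: "z \<notin> unit_disc \<Longrightarrow> flow_op t f z = 0"
  by (simp add: flow_op_def on_disc_def)

lemma flow_op_holomorphic: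
  assumes "f holomorphic_on unit_disc" "0 \<le> t"
  shows "flow_op t f holomorphic_on unit_disc"
  by (rule holomorphic_transform[OF holomorphic_comp_flow[OF assms]]) (simp add: flow_op_apply)

lemma flow_op_radial_norm:
  assumes "\<rho>\<^sub>1 \<le> r" "r < 1" "f holomorphic_on unit_disc" "0 \<le> t"
  shows "radial_norm r (flow_op t f) \<le> exp (\<omega> * t) * radial_norm r f"
proof -
  have "radial_norm r (flow_op t f) = radial_norm r (\<lambda>z. f (flow t z))"
    by (rule radial_norm_cong[OF holomorphic_comp_flow[OF assms(3,4)]]) (rule flow_op_apply)
  then show ?thesis using radial_norm_comp_flow[OF assms] by simp
qed

lemma flow_op_bound:
  assumes f: "f \<in> elements X" and t: "0 \<le> t"
  shows "flow_op t f \<in> elements X" "norm_in X (flow_op t f) \<le> exp (\<omega> * t) * norm_in X f"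
proof -
  have fh: "f holomorphic_on unit_disc" by (rule element_holomorphic[OF f])
  have "radial_norm r (flow_op t f) \<le> exp (\<omega> * t) * norm_in X f" if r: "\<rho>\<^sub>1 \<le> r" "r < 1" for r
  proof -
    have "radial_norm r (flow_op t f) \<le> exp (\<omega> * t) * radial_norm r f"
      by (rule flow_op_radial_norm[OF r fh t])
    also have "\<dots> \<le> exp (\<omega> * t) * norm_in X f"
      using r \<rho>\<^sub>1 f by (intro mult_left_mono radial_norm_le_norm) auto
    finally show ?thesis .
  qed
  from norm_le_of_radial[OF flow_op_holomorphic[OF fh t] flow_op_outside this]
  show "flow_op t f \<in> elements X" "norm_in X (flow_op t f) \<le> exp (\<omega> * t) * norm_in X f" by auto
qed

lemma flow_op_bounded_op:
  assumes "0 \<le> t"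
  shows "bounded_op X (flow_op t)"
  unfolding bounded_op_def
proof (intro conjI ballI allI)
  show "flow_op t f \<in> elements X" if "f \<in> elements X" for f by (rule flow_op_bound[OF that assms])
  show "flow_op t (\<lambda>z. f z + g z) = (\<lambda>z. flow_op t f z + flow_op t g z)" for f g
    by (auto simp: flow_op_def on_disc_def)
  show "flow_op t (\<lambda>z. a * f z) = (\<lambda>z. a * flow_op t f z)" for a f
    by (auto simp: flow_op_def on_disc_def)
  show "\<exists>C. \<forall>f\<in>elements X. norm_in X (flow_op t f) \<le> C * norm_in X f"
    using flow_op_bound(2)[OF _ assms] by blast
qed

lemma flow_op_0: "f \<in> elements X \<Longrightarrow> flow_op 0 f = f"
  by (rule ext) (auto simp: flow_op_def on_disc_def flow_0[simplified] element_outside)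

lemma flow_op_add:
  assumes "0 \<le> s" "0 \<le> t"
  shows "flow_op (s + t) f = flow_op s (flow_op t f)"
proof
  fix z
  show "flow_op (s + t) f z = flow_op s (flow_op t f) z"
  proof (cases "z \<in> unit_disc")
    case True
    have "flow s z \<in> unit_disc" by (rule flow_in_disc[OF True assms(1)])
    then show ?thesis
      using flow_add[OF True assms(2,1)] True by (simp only: flow_op_apply add.commute[of s])
  next
    case False
    then show ?thesis by (simp only: flow_op_outside not_False_eq_True)
  qed
qed

lemma flow_op_coeff_tendsto:
  assumes f: "f holomorphic_on unit_disc"
  shows "((\<lambda>t. taylor_coeff (flow_op t f) n) \<longlongrightarrow> taylor_coeff f n) (at_right 0)"
proof -
  define R where "R = \<rho>\<^sub>1"
  define R' where "R' = (1 + \<rho>\<^sub>1) / 2"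
  have R: "\<rho>\<^sub>1 \<le> R" "R < R'" "R' < 1" "0 < R" "R < 1" using \<rho>\<^sub>1 by (auto simp: R_def R'_def)
  obtain C where C: "0 \<le> C"
    "\<And>f B z h. f holomorphic_on unit_disc \<Longrightarrow> (\<And>z. cmod z \<le> R' \<Longrightarrow> cmod (f z) \<le> B) \<Longrightarrow>
      cmod z \<le> R \<Longrightarrow> 0 \<le> h \<Longrightarrow>
      cmod (f (flow h z) - f z - of_real h * (G z * deriv f z)) \<le> C * B * h\<^sup>2"
    using comp_flow_first_order[OF R(1,2,3)] by blast
  obtain B where B: "0 \<le> B" "\<And>z. cmod z \<le> R' \<Longrightarrow> cmod (f z) \<le> B"
    using bounded_on_cball[OF f R(3)] by blast
  obtain D where D: "0 \<le> D" "\<And>z. cmod z \<le> R \<Longrightarrow> cmod (G z * deriv f z) \<le> D"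
    using bounded_on_cball[OF holomorphic_symbol[OF f] R(5)] by blast
  have le: "norm (taylor_coeff (flow_op t f) n - taylor_coeff f n) \<le> (C * B * t\<^sup>2 + t * D) / R ^
      n" if t: "0 \<le> t" for t
  proof -
    have hol: "flow_op t f holomorphic_on unit_disc" by (rule flow_op_holomorphic[OF f t])
    have "cmod (taylor_coeff (\<lambda>z. flow_op t f z - f z) n) \<le> (C * B * t\<^sup>2 + t * D) / R ^ n"
    proof (rule taylor_coeff_le[OF _ R(4,5)])
      show "(\<lambda>z. flow_op t f z - f z) holomorphic_on unit_disc" using hol f
        by (intro holomorphic_intros)
      fix z :: complex assume z: "cmod z \<le> R"
      then have zd: "z \<in> unit_disc" using R by simp
      have "cmod (of_real t * (G z * deriv f z)) \<le> t * D"
        unfolding norm_mult[of "of_real t"] using D(2)[OF z] t by (simp add: mult_left_mono)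
      moreover have "cmod (f (flow t z) - f z - of_real t * (G z * deriv f z)) \<le> C * B * t\<^sup>2"
        by (rule C(2)[OF f _ z t]) (rule B)
      ultimately show "cmod (flow_op t f z - f z) \<le> C * B * t\<^sup>2 + t * D"
        using norm_triangle_ineq[of "f (flow t z) - f z - of_real t * (G z * deriv f z)"
            "of_real t * (G z * deriv f z)"]
        by (simp add: flow_op_apply[OF zd])
    qed
    then show ?thesis by (simp add: taylor_coeff_diff[OF hol f])
  qed
  have "((\<lambda>t. (C * B * t\<^sup>2 + t * D) / R ^ n) \<longlongrightarrow> (C * B * 0\<^sup>2 + 0 * D) / R ^ n) (at_right 0)"
    using R by (intro tendsto_intros) auto
  then have lim0: "((\<lambda>t. (C * B * t\<^sup>2 + t * D) / R ^ n) \<longlongrightarrow> 0) (at_right 0)" by simp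
  have "\<forall>\<^sub>F t in at_right 0. norm (taylor_coeff (flow_op t f) n - taylor_coeff f n)
      \<le> (C * B * t\<^sup>2 + t * D) / R ^ n"
    using eventually_at_right_less[of "0::real"] by eventually_elim (auto intro: le)
  from Lim_null_comparison[OF this lim0] show ?thesis
    by (rule LIM_zero_cancel)
qed

text \<open>The squared norm of \<open>T(t) f - f\<close> is \<open>\<parallel>T(t) f\<parallel>\<^sup>2 - \<parallel>f\<parallel>\<^sup>2 - 2 Re \<langle>T(t) f - f, f\<rangle>\<close>. The
growth bound controls the first difference, and the inner product tends to zero since
coefficients converge and \<open>T(t) f - f\<close> is bounded.\<close>

lemma flow_op_strongly_continuous:
  assumes f: "f \<in> elements X"
  shows "((\<lambda>t. norm_in X (\<lambda>z. flow_op t f z - f z)) \<longlongrightarrow> 0) (at_right 0)"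
proof -
  define F where "F = norm_in X f"
  have F0: "0 \<le> F" using norm_nonneg[OF f] by (simp add: F_def)
  have fh: "f holomorphic_on unit_disc" by (rule element_holomorphic[OF f])
  note Tf = flow_op_bound(1)[OF f]
  have expand: "(norm_in X (\<lambda>z. flow_op t f z - f z))\<^sup>2 \<le> (exp (2 * \<omega> * t) - 1) * F\<^sup>2
      - 2 * Re (inner_prod X (\<lambda>z. flow_op t f z - f z) f)"
    if t: "0 \<le> t" for t
  proof -
    define d where "d = (\<lambda>z. flow_op t f z - f z)"
    have d: "d \<in> elements X" unfolding d_def by (rule element_diff[OF Tf[OF t] f])
    have "of_real ((norm_in X (flow_op t f))\<^sup>2) = inner_prod X (\<lambda>z. d z + f z) (\<lambda>z. d z + f z)"
      using inner_self[OF Tf[OF t]] by (simp add: d_def)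
    also have "\<dots> = of_real ((norm_in X d)\<^sup>2) + (inner_prod X d f + cnj (inner_prod X d f))
        + of_real (F\<^sup>2)"
      using d f inner_cnj[OF d f] by (simp add: inner_add_left inner_add_right element_add
          inner_self F_def)
    finally have "(norm_in X (flow_op t f))\<^sup>2 = (norm_in X d)\<^sup>2 + 2 * Re (inner_prod X d f) + F\<^sup>2"
      unfolding complex_eq_iff by simp
    moreover have "(norm_in X (flow_op t f))\<^sup>2 \<le> exp (2 * \<omega> * t) * F\<^sup>2"
    proof -
      have "(norm_in X (flow_op t f))\<^sup>2 \<le> (exp (\<omega> * t) * F)\<^sup>2"
        unfolding F_def by (intro power_mono flow_op_bound f t norm_nonneg)
      also have "\<dots> = exp (2 * \<omega> * t) * F\<^sup>2" by (simp add: power_mult_distrib exp_double[symmetric]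
          mult_ac)
      finally show ?thesis .
    qed
    ultimately show ?thesis by (simp add: d_def algebra_simps)
  qed
  have weak: "((\<lambda>t. inner_prod X (\<lambda>z. flow_op t f z - f z) f) \<longlongrightarrow> 0) (at_right 0)"
  proof (rule tendstoI)
    fix e :: real assume e: "0 < e"
    \<comment> \<open>A bound for the norm of \<open>T(t) f - f\<close> for \<open>t \<le> 1\<close>.\<close>
    define A where "A = (exp (\<omega> * 1) + 1) * F"
    have A0: "0 \<le> A" using F0 by (simp add: A_def)
    have "(\<lambda>N. A * norm_in X (\<lambda>z. f z - truncation N (taylor_coeff f) z)) \<longlonglongrightarrow> 0"
      by (rule tendsto_mult_right_zero[OF truncation_tendsto[OF f]])
    from order_tendstoD(2)[OF this, of "e / 2"] e
    obtain N where N: "A * norm_in X (\<lambda>z. f z - truncation N (taylor_coeff f) z) < e / 2"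
      by (auto simp: eventually_sequentially)
    define p where "p = truncation N (taylor_coeff f)"
    have p: "p \<in> elements X" unfolding p_def by (rule truncation_element)
    have fp: "(\<lambda>z. f z - p z) \<in> elements X" by (rule element_diff[OF f p])
    have finite_part: "inner_prod X u p = (\<Sum>n<N. of_real (w n) * taylor_coeff u n * cnj
        (taylor_coeff f n))"
      if u: "u \<in> elements X" for u
      unfolding inner[OF u p] wip_def unfolding p_def coeff_truncation
        by (subst suminf_finite[of "{..<N}"]) auto
    have "((\<lambda>t. \<Sum>n<N. of_real (w n) * (taylor_coeff (flow_op t f) n - taylor_coeff f n) * cnj
        (taylor_coeff f n))
       \<longlongrightarrow> (\<Sum>n<N. of_real (w n) * (taylor_coeff f n - taylor_coeff f n) * cnj (taylor_coeff f n)))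
           (at_right 0)"
      by (intro tendsto_intros flow_op_coeff_tendsto fh)
    then have lim: "((\<lambda>t. \<Sum>n<N. of_real (w n) * (taylor_coeff (flow_op t f) n - taylor_coeff f n)
        * cnj (taylor_coeff f n))
       \<longlongrightarrow> 0) (at_right 0)" by simp
    have near0: "eventually (\<lambda>t::real. 0 < t \<and> t < 1) (at_right 0)"
      by (rule eventually_at_rightI[of 0 1]) auto
    show "\<forall>\<^sub>F t in at_right 0. dist (inner_prod X (\<lambda>z. flow_op t f z - f z) f) 0 < e"
      using tendstoD[OF lim half_gt_zero[OF e]] near0
    proof eventually_elim
      case (elim t)
      then have t: "0 \<le> t" "t \<le> 1" by auto
      define d where "d = (\<lambda>z. flow_op t f z - f z)"
      have d: "d \<in> elements X" unfolding d_def by (rule element_diff[OF Tf[OF t(1)] f])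
      have "taylor_coeff d n = taylor_coeff (flow_op t f) n - taylor_coeff f n" for n
        unfolding d_def coeff_diff[OF Tf[OF t(1)] f] ..
      then have dp: "cmod (inner_prod X d p) < e / 2"
        using elim(1) unfolding finite_part[OF d] by simp
      have "norm_in X d \<le> norm_in X (flow_op t f) + norm_in X (\<lambda>z. - 1 * f z)"
        using norm_triangle[OF Tf[OF t(1)] element_cmult[OF f, of "- 1"]] by (simp add: d_def)
      also have "norm_in X (\<lambda>z. - 1 * f z) = F" using norm_cmult[OF f, of "- 1"]
        by (simp add: F_def)
      also have "norm_in X (flow_op t f) \<le> exp (\<omega> * 1) * F"
      proof -
        have "norm_in X (flow_op t f) \<le> exp (\<omega> * t) * F" unfolding F_def
          by (rule flow_op_bound(2)[OF f t(1)])
        also have "\<dots> \<le> exp (\<omega> * 1) * F" using mult_left_mono[OF t(2) \<omega>_nonneg] F0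
          by (intro mult_right_mono) simp_all
        finally show ?thesis .
      qed
      finally have dA: "norm_in X d \<le> A" by (simp add: A_def algebra_simps)
      have "inner_prod X d f = inner_prod X d p + inner_prod X d (\<lambda>z. f z - p z)"
        using inner_add_right[OF p fp d] by simp
      then have "cmod (inner_prod X d f) \<le> cmod (inner_prod X d p) + norm_in X d * norm_in X
          (\<lambda>z. f z - p z)"
        using norm_triangle_ineq[of "inner_prod X d p" "inner_prod X d (\<lambda>z. f z - p z)"]
            Cauchy_Schwarz[OF d fp] by simp
      also have "norm_in X d * norm_in X (\<lambda>z. f z - p z) \<le> A * norm_in X (\<lambda>z. f z - p z)"
        using dA norm_nonneg[OF fp] by (intro mult_right_mono)
      also have "cmod (inner_prod X d p) + A * norm_in X (\<lambda>z. f z - p z) < e"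
        using dp N by (simp add: p_def)
      finally show "dist (inner_prod X (\<lambda>z. flow_op t f z - f z) f) 0 < e" by (simp add: d_def)
    qed
  qed
  have "((\<lambda>t. (exp (2 * \<omega> * t) - 1) * F\<^sup>2 - 2 * Re (inner_prod X (\<lambda>z. flow_op t f z - f z) f))
      \<longlongrightarrow> (exp (2 * \<omega> * 0) - 1) * F\<^sup>2 - 2 * Re 0) (at_right 0)"
    by (intro tendsto_intros weak)
  then have lim: "((\<lambda>t. (exp (2 * \<omega> * t) - 1) * F\<^sup>2
      - 2 * Re (inner_prod X (\<lambda>z. flow_op t f z - f z) f))
      \<longlongrightarrow> 0) (at_right 0)" by simp
  have "((\<lambda>t. (norm_in X (\<lambda>z. flow_op t f z - f z))\<^sup>2) \<longlongrightarrow> 0) (at_right 0)"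
  proof (rule Lim_null_comparison[OF _ lim])
    show "\<forall>\<^sub>F t in at_right 0. norm ((norm_in X (\<lambda>z. flow_op t f z - f z))\<^sup>2)
        \<le> (exp (2 * \<omega> * t) - 1) * F\<^sup>2 - 2 * Re (inner_prod X (\<lambda>z. flow_op t f z - f z) f)"
      using eventually_at_right_less[of "0::real"]
    proof eventually_elim
      case (elim t)
      then show ?case using expand[of t] by simp
    qed
  qed
  then have "((\<lambda>t. sqrt ((norm_in X (\<lambda>z. flow_op t f z - f z))\<^sup>2)) \<longlongrightarrow> sqrt 0) (at_right 0)"
    by (rule tendsto_real_sqrt)
  moreover have "\<forall>\<^sub>F t in at_right 0. sqrt ((norm_in X (\<lambda>z. flow_op t f z - f z))\<^sup>2)
      = norm_in X (\<lambda>z. flow_op t f z - f z)"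
    using eventually_at_right_less[of "0::real"]
  proof eventually_elim
    case (elim t)
    then show ?case using norm_nonneg[OF element_diff[OF Tf[of t] f]] by simp
  qed
  ultimately have "((\<lambda>t. norm_in X (\<lambda>z. flow_op t f z - f z)) \<longlongrightarrow> sqrt 0) (at_right 0)"
    by (rule Lim_transform_eventually)
  then show ?thesis by simp
qed

theorem flow_op_C0: "C0_semigroup X flow_op"
  unfolding C0_semigroup_def
  using flow_op_bounded_op flow_op_0 flow_op_add flow_op_strongly_continuous by auto

text \<open>This is \<open>T(t) f - f = \<integral>\<^sub>0\<^sup>t T(s) g ds\<close> without the integral: split \<open>[0, t]\<close> into \<open>N\<close>
intervals of length \<open>h\<close> and write each increment \<open>T(s + h) f - T(s) f\<close> as \<open>h T(s) g + O(h\<^sup>2)\<close>.\<close>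

lemma flow_op_increment_bound:
  assumes f: "f holomorphic_on unit_disc" and g: "g \<in> elements X"
    and gf: "\<And>z. z \<in> unit_disc \<Longrightarrow> g z = G z * deriv f z"
    and t: "0 \<le> t" and e: "\<And>s. 0 \<le> s \<Longrightarrow> s \<le> t \<Longrightarrow> norm_in X (\<lambda>z. flow_op s g z - g z) \<le> e"
    and r: "\<rho>\<^sub>1 \<le> r" "r < 1"
  shows "radial_norm r (\<lambda>z. flow_op t f z - f z - of_real t * g z) \<le> t * e"
proof -
  define R where "R = r + (1 - r) / 3"
  define R' where "R' = r + 2 * (1 - r) / 3"
  have R: "r < R" "\<rho>\<^sub>1 \<le> R" "R < R'" "R' < 1" "0 < r" "R < 1" using r \<rho>\<^sub>1
    by (auto simp: R_def R'_def field_simps)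
  have gh: "g holomorphic_on unit_disc" by (rule element_holomorphic[OF g])
  obtain C where C: "0 \<le> C"
    "\<And>f B z h. f holomorphic_on unit_disc \<Longrightarrow> (\<And>z. cmod z \<le> R' \<Longrightarrow> cmod (f z) \<le> B) \<Longrightarrow>
      cmod z \<le> R \<Longrightarrow> 0 \<le> h \<Longrightarrow>
      cmod (f (flow h z) - f z - of_real h * (G z * deriv f z)) \<le> C * B * h\<^sup>2"
    using comp_flow_first_order[OF R(2,3,4)] by blast
  obtain B where B: "0 \<le> B" "\<And>z. cmod z \<le> R' \<Longrightarrow> cmod (f z) \<le> B"
    using bounded_on_cball[OF f R(4)] by blast
  define k where "k = sqrt (radial_const r R) * (C * B)"
  define D where "D = (\<lambda>t z. flow_op t f z - f z - of_real t * g z)"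
  have Dh: "D s holomorphic_on unit_disc" if "0 \<le> s" for s
    unfolding D_def using flow_op_holomorphic[OF f that] f gh by (intro holomorphic_intros)
  have iter: "radial_norm r (D (real j * h)) \<le> real j * (k * h\<^sup>2 + h * e)"
    if h: "0 \<le> h" "real j * h \<le> t" for h j
    using h(2)
  proof (induction j)
    case 0
    have "radial_norm r (D (real 0 * h)) = radial_norm r (\<lambda>z. 0 * g z)"
    proof (rule radial_norm_cong)
      show "(\<lambda>z. 0 * g z) holomorphic_on unit_disc" using gh by (intro holomorphic_intros)
      fix z :: complex assume z: "z \<in> unit_disc"
      show "D (real 0 * h) z = 0 * g z"
        using flow_op_apply[OF z, of 0 f] flow_0[OF z] by (simp add: D_def)
    qed
    also have "\<dots> = 0" using radial_norm_cmult[OF R(5) r(2) gh, of 0] by simp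
    finally show ?case by simp
  next
    case (Suc j)
    define s where "s = real j * h"
    have s: "0 \<le> s" "s \<le> t" "real (Suc j) * h = s + h" using h Suc.prems
      by (auto simp: s_def algebra_simps)
    \<comment> \<open>The increment over \<open>[s, s + h]\<close> is \<open>h T(s) g\<close> plus the error \<open>u\<close>, and \<open>v\<close> compares \<open>T(s) g\<close>
        with \<open>g\<close>.\<close>
    define u where "u = (\<lambda>z. flow_op s (\<lambda>z. f (flow h z) - f z - of_real h * (G z * deriv f z)) z)"
    define v where "v = (\<lambda>z. flow_op s g z - g z)"
    have in_hol: "(\<lambda>z. f (flow h z) - f z - of_real h * (G z * deriv f z)) holomorphic_on unit_disc"
      using f h by (intro holomorphic_intros holomorphic_comp_flow holomorphic_symbol holo) auto
    have uh: "u holomorphic_on unit_disc" unfolding u_def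
      by (rule flow_op_holomorphic[OF in_hol s(1)])
    have v: "v \<in> elements X" unfolding v_def
      by (rule element_diff[OF flow_op_bound(1)[OF g s(1)] g])
    have vh: "v holomorphic_on unit_disc" by (rule element_holomorphic[OF v])
    have hvh: "(\<lambda>z. of_real h * v z) holomorphic_on unit_disc" using vh
      by (intro holomorphic_intros)
    have sum_h: "(\<lambda>z. u z + of_real h * v z) holomorphic_on unit_disc"
      by (rule holomorphic_on_add[OF uh hvh])
    have "radial_norm r (D (real (Suc j) * h))
        = radial_norm r (\<lambda>z. D s z + (u z + of_real h * v z))"
    proof (rule radial_norm_cong)
      show "(\<lambda>z. D s z + (u z + of_real h * v z)) holomorphic_on unit_disc"
        by (rule holomorphic_on_add[OF Dh[OF s(1)] sum_h])
      fix z :: complex assume z: "z \<in> unit_disc"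
      have fz: "flow s z \<in> unit_disc" by (rule flow_in_disc[OF z s(1)])
      have "flow (s + h) z = flow h (flow s z)" using flow_add[OF z h(1) s(1)]
        by (simp add: add.commute)
      then show "D (real (Suc j) * h) z = D s z + (u z + of_real h * v z)"
        unfolding s(3) by (simp add: D_def u_def v_def flow_op_apply[OF z] gf[OF fz] algebra_simps)
    qed
    also have "\<dots> \<le> radial_norm r (D s) + (radial_norm r u + h * radial_norm r v)"
      using radial_norm_triangle[OF R(5) r(2) Dh[OF s(1)] sum_h] radial_norm_triangle[OF R(5) r(2)
          uh hvh]
        radial_norm_cmult[OF R(5) r(2) vh, of "of_real h"] h(1) by simp
    also have "radial_norm r (D s) \<le> real j * (k * h\<^sup>2 + h * e)"
      unfolding s_def using Suc s by (simp add: s_def)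
    also have "radial_norm r u \<le> k * h\<^sup>2"
    proof -
      have "radial_norm r u \<le> sqrt (radial_const r R) * (C * B * h\<^sup>2)"
      proof (rule radial_norm_sup[OF R(5,1,6) uh])
        fix z :: complex assume z: "cmod z \<le> R"
        then have zd: "z \<in> unit_disc" using R by simp
        show "cmod (u z) \<le> C * B * h\<^sup>2"
          unfolding u_def flow_op_apply[OF zd]
          by (rule C(2)[OF f _ flow_invariant[OF z R(2,6) s(1)] h(1)]) (rule B)
      qed
      then show ?thesis by (simp add: k_def mult_ac)
    qed
    also have "h * radial_norm r v \<le> h * e"
    proof (rule mult_left_mono[OF _ h(1)])
      have "radial_norm r v \<le> norm_in X v" by (rule radial_norm_le_norm[OF R(5) r(2) v])
      also have "\<dots> \<le> e" unfolding v_def by (rule e[OF s(1,2)])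
      finally show "radial_norm r v \<le> e" .
    qed
    finally show ?case by (simp add: algebra_simps)
  qed
  have bound: "radial_norm r (D t) \<le> k * t\<^sup>2 / real N + t * e" if N: "0 < N" for N
  proof -
    have eq: "real N * (t / real N) = t" using N by simp
    have "radial_norm r (D t) \<le> real N * (k * (t / real N)\<^sup>2 + (t / real N) * e)"
      using iter[of "t / real N" N] t N by (simp add: eq)
    also have "\<dots> = k * t\<^sup>2 / real N + t * e" using N by (simp add: power2_eq_square field_simps)
    finally show ?thesis .
  qed
  have "radial_norm r (D t) \<le> 0 + t * e"
  proof (rule tendsto_lowerbound)
    show "(\<lambda>N. k * t\<^sup>2 / real N + t * e) \<longlonglongrightarrow> 0 + t * e"
      by (intro tendsto_intros tendsto_divide_0[OF tendsto_const] filterlim_real_sequentially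
          filterlim_at_top_imp_at_infinity)
    show "\<forall>\<^sub>F N in sequentially. radial_norm r (D t) \<le> k * t\<^sup>2 / real N + t * e"
      using eventually_gt_at_top[of "0::nat"] by eventually_elim (rule bound)
  qed simp
  then show ?thesis by (simp add: D_def)
qed

lemma symbol_op_generator_limit:
  assumes f: "f \<in> elements X" and g: "symbol_op G f \<in> elements X"
  shows "has_generator_limit X flow_op f (symbol_op G f)"
  unfolding has_generator_limit_def
proof (intro conjI g)
  define g' where "g' = symbol_op G f"
  have g': "g' \<in> elements X" using g by (simp add: g'_def)
  have gf: "\<And>z. z \<in> unit_disc \<Longrightarrow> g' z = G z * deriv f z"
    by (simp add: g'_def symbol_op_def on_disc_def)
  have fh: "f holomorphic_on unit_disc" by (rule element_holomorphic[OF f])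
  have "((\<lambda>t. norm_in X (\<lambda>z. (flow_op t f z - f z) / of_real t - g' z)) \<longlongrightarrow> 0) (at_right 0)"
  proof (rule tendstoI)
    fix e :: real assume "0 < e"
    then have e2: "0 < e / 2" by simp
    from tendstoD[OF flow_op_strongly_continuous[OF g'] e2]
    obtain \<delta> where \<delta>: "0 < \<delta>" "\<And>s. 0 < s \<Longrightarrow> s < \<delta> \<Longrightarrow> norm_in X (\<lambda>z. flow_op s g' z - g' z) \<le> e / 2"
      unfolding eventually_at_right_field by (force simp: dist_real_def)
    have \<delta>0: "norm_in X (\<lambda>z. flow_op s g' z - g' z) \<le> e / 2" if "0 \<le> s" "s < \<delta>" for s
    proof (cases "s = 0")
      case True
      have "(\<lambda>z. flow_op 0 g' z - g' z) = (\<lambda>z. 0 * g' z)" by (simp add: flow_op_0[OF g'])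
      then have "norm_in X (\<lambda>z. flow_op 0 g' z - g' z) = 0" using norm_cmult[OF g', of 0] by simp
      then show ?thesis using True e2 by simp
    qed (use \<delta> that in auto)
    have main: "norm_in X (\<lambda>z. (flow_op t f z - f z) / of_real t - g' z) \<le> e / 2"
      if t: "0 < t" "t < \<delta>" for t
    proof -
      define D where "D = (\<lambda>z. flow_op t f z - f z - of_real t * g' z)"
      have Tf: "flow_op t f \<in> elements X" using flow_op_bound(1)[OF f, of t] t by simp
      have D: "D \<in> elements X" unfolding D_def by (intro element_diff element_cmult Tf f g')
      have Dn: "norm_in X D \<le> t * (e / 2)"
      proof (rule norm_le_of_radial(2)[OF element_holomorphic[OF D] element_outside[OF D]])
        show "radial_norm r D \<le> t * (e / 2)" if r: "\<rho>\<^sub>1 \<le> r" "r < 1" for r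
          unfolding D_def using t by (intro flow_op_increment_bound[OF fh g' gf _ _ r] \<delta>0) auto
      qed
      have "(\<lambda>z. (flow_op t f z - f z) / of_real t - g' z) = (\<lambda>z. of_real (1 / t) * D z)"
        using t by (simp add: D_def field_simps)
      then have "norm_in X (\<lambda>z. (flow_op t f z - f z) / of_real t - g' z) = (1 / t) * norm_in X D"
        using norm_cmult[OF D, of "of_real (1 / t)"] t by (simp add: norm_divide)
      also have "\<dots> \<le> (1 / t) * (t * (e / 2))" using t Dn by (intro mult_left_mono) auto
      also have "\<dots> = e / 2" using t by simp
      finally show ?thesis .
    qed
    have "eventually (\<lambda>t::real. t \<in> {0<..<\<delta>}) (at_right 0)"
      by (rule eventually_at_rightI[of 0 \<delta>]) (use \<delta> in auto)
    then show "\<forall>\<^sub>F t in at_right 0. dist (norm_in X (\<lambda>z. (flow_op t f z - f z) / of_real t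
        - g' z)) 0 < e"
    proof eventually_elim
      case (elim t)
      then have t: "0 < t" "t < \<delta>" by auto
      have Tf: "flow_op t f \<in> elements X" using flow_op_bound(1)[OF f, of t] t by simp
      have "(\<lambda>z. of_real (1 / t) * (flow_op t f z - f z) - g' z) \<in> elements X"
        by (intro element_diff element_cmult Tf f g')
      then have "0 \<le> norm_in X (\<lambda>z. (flow_op t f z - f z) / of_real t - g' z)"
        using norm_nonneg by (simp add: divide_inverse mult.commute)
      with main[OF t] \<open>0 < e\<close> show ?case by simp
    qed
  qed
  then show "((\<lambda>t. norm_in X (\<lambda>z. (flow_op t f z - f z) / of_real t - symbol_op G f z)) \<longlongrightarrow> 0)
      (at_right 0)"
    by (simp add: g'_def)
qed

text \<open>Norm convergence implies pointwise convergence, and pointwise the difference quotient of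
\<open>f \<circ> \<phi>\<^sub>t\<close> tends to \<open>G f'\<close>.\<close>

lemma generator_limit_unique:
  assumes f: "f \<in> elements X" and lim: "has_generator_limit X flow_op f g"
  shows "g = symbol_op G f"
proof
  fix z
  have g: "g \<in> elements X" using lim by (simp add: has_generator_limit_def)
  have fh: "f holomorphic_on unit_disc" by (rule element_holomorphic[OF f])
  show "g z = symbol_op G f z"
  proof (cases "z \<in> unit_disc")
    case False
    then show ?thesis using element_outside[OF g] by (simp add: symbol_op_def on_disc_def)
  next
    case True
    have pos: "eventually (\<lambda>t::real. 0 < t) (at_right 0)" by (rule eventually_at_right_less)
    have "((\<lambda>t. (f (flow t z) - f z) / of_real t - g z) \<longlongrightarrow> 0) (at_right 0)"
    proof (rule Lim_null_comparison)
      show "((\<lambda>t. norm_in X (\<lambda>z. (flow_op t f z - f z) / of_real t - g z) / (1 - cmod z)) \<longlongrightarrow> 0)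
          (at_right 0)"
        using tendsto_divide_zero lim by (auto simp: has_generator_limit_def)
      show "\<forall>\<^sub>F t in at_right 0. norm ((f (flow t z) - f z) / of_real t - g z)
          \<le> norm_in X (\<lambda>z. (flow_op t f z - f z) / of_real t - g z) / (1 - cmod z)"
        using pos
      proof eventually_elim
        case (elim t)
        have Tf: "flow_op t f \<in> elements X" using flow_op_bound(1)[OF f, of t] elim by simp
        have "(\<lambda>z. of_real (1 / t) * (flow_op t f z - f z) - g z) \<in> elements X"
          by (intro element_diff element_cmult Tf f g)
        then have "(\<lambda>z. (flow_op t f z - f z) / of_real t - g z) \<in> elements X"
          by (simp add: divide_inverse mult.commute)
        from point_evaluation_le[OF this True] show ?case by (simp add: flow_op_apply[OF True])
      qed
    qed
    moreover have "((\<lambda>t. (f (flow t z) - f z) / of_real t - G z * deriv f z) \<longlongrightarrow> 0) (at_right 0)"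
    proof -
      define R where "R = max \<rho>\<^sub>1 (cmod z)"
      define R' where "R' = (1 + R) / 2"
      have R: "\<rho>\<^sub>1 \<le> R" "R < R'" "R' < 1" "cmod z \<le> R" using \<rho>\<^sub>1 True by (auto simp: R_def R'_def)
      obtain C where C: "0 \<le> C"
        "\<And>f B z h. f holomorphic_on unit_disc \<Longrightarrow> (\<And>z. cmod z \<le> R' \<Longrightarrow> cmod (f z) \<le> B) \<Longrightarrow>
          cmod z \<le> R \<Longrightarrow> 0 \<le> h \<Longrightarrow>
          cmod (f (flow h z) - f z - of_real h * (G z * deriv f z)) \<le> C * B * h\<^sup>2"
        using comp_flow_first_order[OF R(1,2,3)] by blast
      obtain B where B: "0 \<le> B" "\<And>z. cmod z \<le> R' \<Longrightarrow> cmod (f z) \<le> B"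
        using bounded_on_cball[OF fh R(3)] by blast
      show ?thesis
      proof (rule Lim_null_comparison)
        have "((\<lambda>t. C * B * t) \<longlongrightarrow> C * B * 0) (at_right 0)" by (intro tendsto_intros)
        then show "((\<lambda>t. C * B * t) \<longlongrightarrow> 0) (at_right 0)" by simp
        show "\<forall>\<^sub>F t in at_right 0. norm ((f (flow t z) - f z) / of_real t - G z * deriv f z)
            \<le> C * B * t"
          using pos
        proof eventually_elim
          case (elim t)
          have "cmod (f (flow t z) - f z - of_real t * (G z * deriv f z)) \<le> C * B * t\<^sup>2"
            by (rule C(2)[OF fh _ R(4)]) (use B elim in auto)
          moreover have "(f (flow t z) - f z) / of_real t - G z * deriv f z
              = (f (flow t z) - f z - of_real t * (G z * deriv f z)) / of_real t"
            using elim by (simp add: field_simps)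
          ultimately show ?case using elim by (simp add: norm_divide divide_le_eq power2_eq_square
              mult.assoc)
        qed
      qed
    qed
    ultimately have "((\<lambda>t. ((f (flow t z) - f z) / of_real t - G z * deriv f z)
        - ((f (flow t z) - f z) / of_real t - g z)) \<longlongrightarrow> 0 - 0) (at_right 0)"
      by (intro tendsto_diff)
    then have "((\<lambda>t::real. g z - G z * deriv f z) \<longlongrightarrow> 0) (at_right 0)" by simp
    then have "g z - G z * deriv f z = 0"
      by (simp add: tendsto_const_iff)
    then show ?thesis using True by (simp add: symbol_op_def on_disc_def)
  qed
qed

theorem flow_op_generator: "is_generator X flow_op (symbol_op_domain X G) (symbol_op G)"
  unfolding is_generator_def symbol_op_domain_def
proof (intro conjI ballI set_eqI)
  fix f
  show "f \<in> {f \<in> elements X. symbol_op G f \<in> elements X}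
      \<longleftrightarrow> f \<in> {f \<in> elements X. \<exists>g. has_generator_limit X flow_op f g}"
    using symbol_op_generator_limit generator_limit_unique by (auto simp: has_generator_limit_def)
qed (auto intro: symbol_op_generator_limit)

theorem flow_op_composition: "0 \<le> t \<Longrightarrow> composition_op X (flow_op t)"
  unfolding composition_op_def flow_op_def
  using flow_holomorphic flow_in_disc by (intro exI[of _ "flow t"]) auto

text \<open>By Parseval \<open>\<Sum> |c\<^sub>n|\<^sup>2 \<le> a\<^sup>2\<close> and \<open>\<Sum> n\<^sup>2 |c\<^sub>n|\<^sup>2 \<le> b\<^sup>2\<close>, and the weight is at most
\<open>1 + n\<^sup>2\<close>.\<close>

lemma norm_le_of_sup:
  assumes u: "u holomorphic_on unit_disc" "\<And>z. z \<notin> unit_disc \<Longrightarrow> u z = 0"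
    and a: "\<And>z. z \<in> unit_disc \<Longrightarrow> cmod (u z) \<le> a" and b: "\<And>z. z \<in> unit_disc \<Longrightarrow> cmod (deriv u z) \<le> b"
  shows "norm_in X u \<le> a + b"
proof (rule norm_le_of_radial(2)[OF u])
  fix r assume r: "\<rho>\<^sub>1 \<le> r" "r < 1"
  then have r0: "0 < r" using \<rho>\<^sub>1 by simp
  have a0: "0 \<le> a" by (rule order_trans[OF norm_ge_zero a[of 0]]) simp
  have b0: "0 \<le> b" by (rule order_trans[OF norm_ge_zero b[of 0]]) simp
  have u': "deriv u holomorphic_on unit_disc" using u by (intro holomorphic_intros) auto
  let ?W = "circle_weight r"
  have W: "0 \<le> ?W n" for n using r0 by simp
  have one: "wnorm ?W (taylor_coeff (\<lambda>z. 1)) = 1"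
  proof -
    have "taylor_coeff (\<lambda>z. 1) n = (if n = 0 then 1 else 0)" for n
    proof (rule taylor_coeff_unique)
      show "(\<lambda>n. (if n = 0 then 1 else 0) * z ^ n) sums 1" for z :: complex
        using sums_single[of 0 "\<lambda>n. z ^ n"] by (simp add: if_distrib[of "\<lambda>x. x * _"] cong: if_cong)
    qed
    then have "(\<Sum>n. ?W n * (cmod (taylor_coeff (\<lambda>z. 1) n))\<^sup>2)
        = (\<Sum>n\<in>{0}. ?W n * (cmod (taylor_coeff (\<lambda>z. 1) n))\<^sup>2)"
      by (intro suminf_finite) auto
    then show ?thesis by (simp add: wnorm_def taylor_coeff_0)
  qed
  have sup: "(wnorm ?W (taylor_coeff v))\<^sup>2 \<le> A\<^sup>2"
    if v: "v holomorphic_on unit_disc" "\<And>z. z \<in> unit_disc \<Longrightarrow> cmod (v z) \<le> A" for v A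
  proof -
    have "wnorm ?W (taylor_coeff (\<lambda>z. v z * 1)) \<le> A * wnorm ?W (taylor_coeff (\<lambda>z. 1))"
      by (rule circle_norm_mult_le[OF v(1) _ r0 r(2)]) (use v(2) r in auto)
    then show ?thesis
      using wnorm_nonneg[OF W circle_wsummable[OF r0 r(2) v(1)]]
        by (intro power_mono) (simp_all add: one)
  qed
  have rw: "0 \<le> radial_weight w r n" for n using r0 by (simp add: radial_weight_nonneg)
  have "(radial_norm r u)\<^sup>2 \<le> a\<^sup>2 + b\<^sup>2"
    unfolding radial_norm_def
  proof (rule wnorm_sq_leI(2)[OF rw])
    fix N
    define x where "x = (\<lambda>n. ?W n * (cmod (taylor_coeff u n))\<^sup>2)"
    define y where "y = (\<lambda>n. ?W n * (cmod (taylor_coeff (deriv u) n))\<^sup>2)"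
    have step: "radial_weight w r n * (cmod (taylor_coeff u n))\<^sup>2
        \<le> x n + (if n = 0 then 0 else y (n - 1))" for n
    proof (cases n)
      case 0
      have "w 0 = 1" using w_ge[of 0] w_le[of 0] by simp
      then show ?thesis by (simp add: 0 radial_weight_def x_def)
    next
      case (Suc m)
      define q where "q = r ^ (2 * m) * (cmod (taylor_coeff u n))\<^sup>2"
      have q: "0 \<le> q" using r0 by (simp add: q_def)
      have "radial_weight w r n * (cmod (taylor_coeff u n))\<^sup>2 = (w n * r\<^sup>2) * q"
        by (simp add: radial_weight_def q_def Suc power2_eq_square mult_ac)
      also have "\<dots> \<le> (r\<^sup>2 + (real n)\<^sup>2) * q"
      proof (rule mult_right_mono[OF _ q])
        have "w n * r\<^sup>2 \<le> (1 + real n) * r\<^sup>2" using w_le[of n] by (intro mult_right_mono) auto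
        also have "\<dots> = r\<^sup>2 + real n * r\<^sup>2" by (simp add: algebra_simps)
        also have "real n * r\<^sup>2 \<le> real n * 1" using r r0 by (intro mult_left_mono power_le_one) auto
        also have "real n * 1 \<le> (real n)\<^sup>2" using Suc by (simp add: power2_eq_square)
        finally show "w n * r\<^sup>2 \<le> r\<^sup>2 + (real n)\<^sup>2" by simp
      qed
      also have "\<dots> = x n + y m"
      proof -
        have "x n = r\<^sup>2 * q" by (simp add: x_def q_def Suc power2_eq_square mult_ac)
        moreover have "y m = (real n)\<^sup>2 * q"
          by (simp add: y_def q_def Suc taylor_coeff_deriv norm_mult power_mult_distrib mult_ac
              del: of_nat_Suc)
        ultimately show ?thesis by (simp only: distrib_right)
      qed
      finally show ?thesis by (simp add: Suc)
    qed
    have "(\<Sum>n<N. radial_weight w r n * (cmod (taylor_coeff u n))\<^sup>2) \<le> (\<Sum>n<N. x n) + (\<Sum>n<N. if n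
        = 0 then 0 else y (n - 1))"
      unfolding sum.distrib[symmetric] by (intro sum_mono step)
    also have "(\<Sum>n<N. if n = 0 then 0 else y (n - 1)) \<le> (\<Sum>n<N. y n)"
    proof (cases N)
      case (Suc m)
      have "(\<Sum>n<Suc m. if n = 0 then 0 else y (n - 1)) = (\<Sum>n<m. y n)"
        by (simp add: sum.lessThan_Suc_shift del: sum.lessThan_Suc)
      moreover have "0 \<le> y m" using r0 by (simp add: y_def)
      ultimately show ?thesis unfolding Suc by simp
    qed simp
    also have "(\<Sum>n<N. y n) \<le> b\<^sup>2"
      using wsum_le_wnorm_sq[OF W circle_wsummable[OF r0 r(2) u'], of N] sup[OF u' b]
        by (simp add: y_def)
    also have "(\<Sum>n<N. x n) \<le> a\<^sup>2"
      using wsum_le_wnorm_sq[OF W circle_wsummable[OF r0 r(2) u(1)], of N] sup[OF u(1) a]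
        by (simp add: x_def)
    finally show "(\<Sum>n<N. radial_weight w r n * (cmod (taylor_coeff u n))\<^sup>2) \<le> a\<^sup>2 + b\<^sup>2" by simp
  qed
  also have "\<dots> \<le> (a + b)\<^sup>2" using a0 b0 by (simp add: power2_sum)
  finally show "radial_norm r u \<le> a + b" by (rule power2_le_imp_le) (use a0 b0 in simp)
qed

text \<open>The images of the monomials are the powers \<open>\<phi>\<^sub>t\<^sup>n\<close>, whose norms decay geometrically
because \<open>\<phi>\<^sub>t\<close> maps the disc into a smaller one and has bounded derivative.\<close>

theorem flow_op_trace_class: "immediately_trace_class X flow_op"
  unfolding immediately_trace_class_def
proof (intro allI impI)
  fix t :: real assume t: "0 < t"
  define q where "q = max \<rho>\<^sub>1 (1 - c / 2 * t)"
  define L where "L = exp (K * t)"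
  have q: "0 < q" "q < 1" using \<rho>\<^sub>1 c t by (auto simp: q_def)
  have fq: "cmod (flow t z) \<le> q" if "z \<in> unit_disc" for z
    unfolding q_def by (rule flow_compact_image[OF that]) (use t in simp)
  have norm_power: "norm_in X (flow_op t (normalized_monomial n)) \<le> q ^ n + real n * q ^ (n - 1) *
      L" for n
  proof -
    have hol: "(\<lambda>z. flow t z ^ n) holomorphic_on unit_disc"
      using flow_holomorphic[of t] t by (intro holomorphic_intros) auto
    define u where "u = on_disc (\<lambda>z. flow t z ^ n)"
    have u: "u holomorphic_on unit_disc"
      unfolding u_def by (rule holomorphic_transform[OF hol]) (simp add: on_disc_def)
    have out: "u z = 0" if "z \<notin> unit_disc" for z using that by (simp add: u_def on_disc_def)
    have "norm_in X u \<le> q ^ n + real n * q ^ (n - 1) * L"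
    proof (rule norm_le_of_sup[OF u out])
      fix z :: complex assume z: "z \<in> unit_disc"
      show "cmod (u z) \<le> q ^ n"
        using z fq[OF z] by (simp add: u_def on_disc_def norm_power power_mono)
      have "deriv u z = deriv (\<lambda>z. flow t z ^ n) z"
        using u hol z by (intro complex_derivative_transform_within_open[of _ unit_disc])
            (auto simp: u_def on_disc_def)
      also have "\<dots> = of_nat n * flow t z ^ (n - 1) * deriv (flow t) z"
        using holomorphic_derivI[OF flow_holomorphic open_ball z, of t] t
        by (intro DERIV_imp_deriv) (auto intro!: derivative_eq_intros)
      finally have "cmod (deriv u z) = real n * cmod (flow t z) ^ (n - 1) * cmod (deriv (flow t) z)"
        by (simp add: norm_mult norm_power)
      also have "\<dots> \<le> real n * q ^ (n - 1) * L"
        unfolding L_def using fq[OF z] flow_deriv_bound[OF z, of t] t q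
        by (intro mult_mono power_mono) auto
      finally show "cmod (deriv u z) \<le> real n * q ^ (n - 1) * L" .
    qed
    moreover have "u = flow_op t (monomial n)"
    proof
      fix z
      show "u z = flow_op t (monomial n) z"
        using flow_in_disc[of z t] t by (auto simp: u_def flow_op_def on_disc_def monomial_def)
    qed
    moreover have "flow_op t (normalized_monomial n)
        = (\<lambda>z. of_real (1 / sqrt (w n)) * flow_op t (monomial n) z)"
      by (auto simp: normalized_monomial_def flow_op_def on_disc_def)
    then have "norm_in X (flow_op t (normalized_monomial n)) = cmod (of_real (1 / sqrt (w n))) *
        norm_in X (flow_op t (monomial n))"
      using norm_cmult[OF flow_op_bound(1)[OF monomial_element less_imp_le[OF t]]] by (simp only:)
    moreover have "cmod (of_real (1 / sqrt (w n))) * norm_in X (flow_op t (monomial n))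
        \<le> 1 * norm_in X (flow_op t (monomial n))"
      using t w_ge[of n] by (intro mult_right_mono norm_nonneg flow_op_bound monomial_element)
          (auto simp: norm_divide)
    ultimately show ?thesis by simp
  qed
  have "summable (\<lambda>n. q ^ n + real n * q ^ (n - 1) * L)"
  proof (intro summable_add summable_geometric summable_mult2)
    have "summable (\<lambda>n. diffs (\<lambda>_. 1::real) n * q ^ n)"
      by (rule termdiff_converges[of _ 1]) (use q in \<open>auto intro: summable_geometric\<close>)
    then have "summable (\<lambda>n. real (Suc n) * q ^ (Suc n - 1))" by (simp add: diffs_def)
    then show "summable (\<lambda>n. real n * q ^ (n - 1))"
      by (subst (asm) summable_Suc_iff)
  qed (use q in simp)
  then have "summable (\<lambda>n. norm_in X (flow_op t (normalized_monomial n)))"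
  proof (rule summable_comparison_test')
    show "norm (norm_in X (flow_op t (normalized_monomial n))) \<le> q ^ n + real n * q ^ (n - 1) * L"
        for n
      using norm_power[of n] norm_nonneg[OF flow_op_bound(1)[OF normalized_monomial_element], of t
          n] t by simp
  qed
  then show "trace_class X (flow_op t)"
    using t by (intro trace_class_of_summable_norms flow_op_bounded_op) auto
qed

end

section \<open>The Hardy space and the Dirichlet space\<close>

lemma weighted_space_hardy: "weighted_space hardy_space (\<lambda>_. 1)"
proof
  show "f \<in> elements hardy_space \<longleftrightarrow> f \<in> disc_analytic \<and> wsummable (\<lambda>_. 1) (taylor_coeff f)" for f
    by (simp add: hardy_space_def wsummable_def)
  show "inner_prod hardy_space f g = wip (\<lambda>_. 1) (taylor_coeff f) (taylor_coeff g)" for f g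
    by (simp add: hardy_space_def wip_def)
qed auto

lemma wsummable_dirichlet_weight:
  "wsummable dirichlet_weight a \<longleftrightarrow> summable (\<lambda>n. real n * (cmod (a n))\<^sup>2)"
proof -
  have "(\<lambda>n. dirichlet_weight (Suc n) * (cmod (a (Suc n)))\<^sup>2)
      = (\<lambda>n. real (Suc n) * (cmod (a (Suc n)))\<^sup>2)"
    by (simp add: dirichlet_weight_def)
  then show ?thesis
    unfolding wsummable_def
    using summable_Suc_iff[of "\<lambda>n. dirichlet_weight n * (cmod (a n))\<^sup>2"]
      summable_Suc_iff[of "\<lambda>n. real n * (cmod (a n))\<^sup>2"] by simp
qed

lemma weighted_space_dirichlet: "weighted_space dirichlet_space dirichlet_weight"
proof
  show iff: "f \<in> elements dirichlet_space \<longleftrightarrow> f \<in> disc_analytic \<and> wsummable dirichlet_weight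
      (taylor_coeff f)" for f
    by (simp add: dirichlet_space_def wsummable_dirichlet_weight)
  show "inner_prod dirichlet_space f g = wip dirichlet_weight (taylor_coeff f) (taylor_coeff g)"
    if "f \<in> elements dirichlet_space" "g \<in> elements dirichlet_space" for f g
  proof -
    define F where "F n = of_real (dirichlet_weight n) * taylor_coeff f n * cnj
        (taylor_coeff g n)" for n
    have "summable F"
      unfolding F_def
      by (rule wip_summable) (use that in \<open>auto simp: iff, simp add: dirichlet_weight_def\<close>)
    then have "(\<lambda>n. F n - (if n = 0 then F n else 0)) sums (suminf F - F 0)"
      by (intro sums_diff summable_sums sums_single)
    also have "(\<lambda>n. F n - (if n = 0 then F n else 0))
        = (\<lambda>n. of_nat n * taylor_coeff f n * cnj (taylor_coeff g n))"
      by (auto simp: F_def dirichlet_weight_def)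
    finally have "(\<Sum>n. of_nat n * taylor_coeff f n * cnj (taylor_coeff g n)) = suminf F - F 0"
      by (simp add: sums_iff)
    then show ?thesis
      by (simp add: dirichlet_space_def wip_def F_def[abs_def] dirichlet_weight_def)
  qed
qed (auto simp: dirichlet_weight_def)

theorem corollary3p7:
  fixes G :: "complex \<Rightarrow> complex" and \<eta> :: real
  assumes "G holomorphic_on unit_disc"
    and "\<eta> > 0"
    and "esssup circle_measure (\<lambda>z. ereal (Re (cnj z * radial_limit G z))) \<le> ereal (- \<eta>)"
    and "bounded ((\<lambda>z. Re (deriv G z)) ` unit_disc)"
  shows "\<forall>X \<in> {hardy_space, dirichlet_space}. \<exists>T.
           C0_semigroup X T \<and>
           is_generator X T (symbol_op_domain X G) (symbol_op G) \<and>
           (\<forall>t\<ge>0. composition_op X (T t)) \<and>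
           immediately_trace_class X T"
proof -
  obtain M K c \<rho> where field: "inward_field G M K c \<rho>"
    using inward_field_from_boundary[OF assms] .
  then interpret inward_field G M K c \<rho> .
  have flux: "Re (cnj z * G z) \<le> 0" if "\<rho> \<le> r" "r < 1" "cmod z = r" for z r
    using inward[of z] c that by simp
  have "composition_semigroup G M K c \<rho> hardy_space (\<lambda>_. 1)"
  proof (intro composition_semigroup.intro field weighted_space_hardy
      composition_semigroup_axioms.intro)
    show "energy_rate (radial_weight (\<lambda>_. 1) r) G f
        \<le> cmod (G 0) / r * (wnorm (radial_weight (\<lambda>_. 1) r) (taylor_coeff f))\<^sup>2"
      if "\<rho> \<le> r" "r < 1" "f holomorphic_on unit_disc" for r f
      unfolding radial_weight_1 using that \<rho>\<^sub>0
        by (intro hardy_dissipative holo flux[OF that(1,2)]) auto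
  qed
  moreover have "composition_semigroup G M K c \<rho> dirichlet_space dirichlet_weight"
  proof (intro composition_semigroup.intro field weighted_space_dirichlet
      composition_semigroup_axioms.intro)
    show "energy_rate (radial_weight dirichlet_weight r) G f
        \<le> cmod (G 0) / r * (wnorm (radial_weight dirichlet_weight r) (taylor_coeff f))\<^sup>2"
      if "\<rho> \<le> r" "r < 1" "f holomorphic_on unit_disc" for r f
      using that \<rho>\<^sub>0 by (intro dirichlet_dissipative holo flux[OF that(1,2)]) auto
  qed
  moreover have "\<exists>T. C0_semigroup X T \<and> is_generator X T (symbol_op_domain X G) (symbol_op G) \<and>
      (\<forall>t\<ge>0. composition_op X (T t)) \<and> immediately_trace_class X T"
    if "composition_semigroup G M K c \<rho> X w" for X w
  proof -
    interpret composition_semigroup G M K c \<rho> X w by (rule that)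
    show ?thesis
      using flow_op_C0 flow_op_generator flow_op_composition flow_op_trace_class by blast
  qed
  ultimately show ?thesis by blast
qed

end
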